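(* Let $G$ be a countable group with a normal subgroup $F$ that is a free non-abelian group of finite rank, and let $\mu$ be a nondegenerate probability measure on $G$. Consider the action of $G$ on the hyperbolic boundary $\partial F$ induced by conjugation of $G$ on $F$. Then there exists a unique $\mu$-stationary measure $\nu$ on $\partial F$. This measure $\nu$ is continuous (i.e. it has no atoms), and the pair $(\partial F,\nu)$ is a $\mu$-boundary of $(G,\mu)$.
   Context: Measures: a probability measure $\mu$ on a countable group $G$ is nondegenerate if its support generates $G$ as a semigroup. The random $\mu$-walk on $G$ is the Markov chain $\tau=\{\tau_i\}_{i\ge 0}$ with $\tau_0=e$ and transition probabilities $P(g,h)=\mu(g^{-1}h)$; a realization $\tau$ is called a path, and "almost every path" refers to the associated Markov measure on $G^{\mathbb Z_+}$. For a topological space $M$, $\mathcal P(M)$ is the space of regular Borel probability measures on $M$ with the weak$^*$ topology (against bounded continuous functions). If $G$ acts on $M$ by homeomorphisms, then $G$ acts on $\mathcal P(M)$ by $g\theta(E)=\theta(g^{-1}E)$. A measure $\nu\in\mathcal P(M)$ is $\mu$-stationary if $\sum_{g\in G}\mu(g)\,g\nu=\nu$. For a $\mu$-stationary $\nu$, the pair $(M,\nu)$ is a $\mu$-boundary of $(G,\mu)$ if for almost every path $\tau$ of the random $\mu$-walk the sequence of measures $\{\tau_i\nu\}$ converges to a point measure $\delta_{w(\tau)}$ with $w(\tau)\in M$. Boundary: for a free group $F$ of finite rank $\ge 2$ with a fixed basis, the hyperbolic compactification $F\cup\partial F$ is identified with the set of all finite (giving $F$) and right-infinite (giving $\partial F$)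 reduced words in the basis elements and their inverses; its topology is given by the metric $\rho(v,w)=((v|w)+1)^{-1}$ for $v\ne w$, where $(v|w)$ is the length of the longest common prefix of the two words. Every automorphism of $F$ extends uniquely to a homeomorphism of $F\cup\partial F$. If $F$ is normal in $G$, each $g\in G$ acts on $\partial F$ by the extension of the automorphism $x\mapsto gxg^{-1}$ of $F$. *)

theory Defs
  imports "HOL-Probability.Probability" "HOL-Algebra.Coset"
begin

definition borel_on :: "'m topology \<Rightarrow> 'm measure" where
  "borel_on T = sigma (topspace T) {U. openin T U}"

definition regular_measure :: "'m topology \<Rightarrow> 'm measure \<Rightarrow> bool" where
  "regular_measure T \<theta> \<longleftrightarrow>
     (\<forall>E\<in>sets \<theta>.
        emeasure \<theta> E = (SUP K\<in>{K. compactin T K \<and> K \<in> sets \<theta> \<and> K \<subseteq> E}. emeasure \<theta> K) \<and>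
        emeasure \<theta> E = (INF U\<in>{U. openin T U \<and> E \<subseteq> U}. emeasure \<theta> U))"

definition prob_measures :: "'m topology \<Rightarrow> 'm measure set" where
  "prob_measures T =
     {\<theta>. sets \<theta> = sets (borel_on T) \<and> prob_space \<theta> \<and> regular_measure T \<theta>}"

definition bounded_continuous :: "'m topology \<Rightarrow> ('m \<Rightarrow> real) set" where
  "bounded_continuous T =
     {f. continuous_map T euclideanreal f \<and> bounded (f ` topspace T)}"

text \<open>The weak* topology is the initial topology of the integration maps against all
  bounded continuous functions, i.e. the topology pulled back from a power of the reals.\<close>

definition weak_star :: "'m topology \<Rightarrow> 'm measure topology" where
  "weak_star T =
     pullback_topology (prob_measures T)
       (\<lambda>\<theta>. \<lambda>f\<in>bounded_continuous T. integral\<^sup>L \<theta> f)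
       (product_topology (\<lambda>_. euclideanreal) (bounded_continuous T))"

definition no_atoms :: "'m measure \<Rightarrow> bool" where
  "no_atoms \<theta> \<longleftrightarrow> (\<forall>w\<in>space \<theta>. emeasure \<theta> {w} = 0)"

inductive_set semigroup_span :: "('g, 'z) monoid_scheme \<Rightarrow> 'g set \<Rightarrow> 'g set"
  for G (structure) and S where
  incl: "s \<in> S \<Longrightarrow> s \<in> semigroup_span G S"
| mult: "a \<in> semigroup_span G S \<Longrightarrow> b \<in> semigroup_span G S \<Longrightarrow> a \<otimes> b \<in> semigroup_span G S"

definition nondegenerate :: "('g, 'z) monoid_scheme \<Rightarrow> 'g pmf \<Rightarrow> bool" where
  "nondegenerate G \<mu> \<longleftrightarrow> semigroup_span G (set_pmf \<mu>) = carrier G"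

text \<open>The law, on the space of all paths in \<open>S\<close>, of the Markov chain with initial state \<open>a\<close> and
  transition probabilities \<open>p\<close>; it is determined by its values on cylinders.\<close>

definition markov_measure :: "'g set \<Rightarrow> 'g \<Rightarrow> ('g \<Rightarrow> 'g \<Rightarrow> real) \<Rightarrow> (nat \<Rightarrow> 'g) measure" where
  "markov_measure S a p = (THE P.
     sets P = sets (PiM UNIV (\<lambda>_. count_space S)) \<and> prob_space P \<and>
     (\<forall>n. \<forall>h \<in> {..n} \<rightarrow> S.
        measure P {\<tau> \<in> space P. \<forall>i\<le>n. \<tau> i = h i} =
          (if h 0 = a then \<Prod>i<n. p (h i) (h (Suc i)) else 0)))"

definition walk_measure :: "('g, 'z) monoid_scheme \<Rightarrow> 'g pmf \<Rightarrow> (nat \<Rightarrow> 'g) measure" where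
  "walk_measure G \<mu> =
     markov_measure (carrier G) \<one>\<^bsub>G\<^esub> (\<lambda>g h. pmf \<mu> (inv\<^bsub>G\<^esub> g \<otimes>\<^bsub>G\<^esub> h))"

text \<open>Below, \<open>act g\<close> is the homeomorphism of \<open>T\<close> by which
  \<open>g\<close> acts. Since \<open>act g\<close> is invertible, the push-forward evaluates \<open>\<theta>\<close> at the
  translate of a set by the inverse of \<open>g\<close>.\<close>

definition translate :: "'m topology \<Rightarrow> ('g \<Rightarrow> 'm \<Rightarrow> 'm) \<Rightarrow> 'g \<Rightarrow> 'm measure \<Rightarrow> 'm measure" where
  "translate T act g \<theta> = distr \<theta> (borel_on T) (act g)"

definition stationary ::
  "('g, 'z) monoid_scheme \<Rightarrow> 'g pmf \<Rightarrow> 'm topology \<Rightarrow> ('g \<Rightarrow> 'm \<Rightarrow> 'm) \<Rightarrow> 'm measure \<Rightarrow> bool" where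
  "stationary G \<mu> T act \<nu> \<longleftrightarrow> \<nu> \<in> prob_measures T \<and>
     (\<forall>E\<in>sets \<nu>.
        ((\<lambda>g. pmf \<mu> g * measure (translate T act g \<nu>) E) has_sum measure \<nu> E) (carrier G))"

definition mu_boundary ::
  "('g, 'z) monoid_scheme \<Rightarrow> 'g pmf \<Rightarrow> 'm topology \<Rightarrow> ('g \<Rightarrow> 'm \<Rightarrow> 'm) \<Rightarrow> 'm measure \<Rightarrow> bool" where
  "mu_boundary G \<mu> T act \<nu> \<longleftrightarrow> stationary G \<mu> T act \<nu> \<and>
     (AE \<tau> in walk_measure G \<mu>. \<exists>w\<in>topspace T.
        limitin (weak_star T) (\<lambda>i. translate T act (\<tau> i) \<nu>) (return (borel_on T) w) sequentially)"

text \<open>A letter \<open>(x, True)\<close> stands for the basis element \<open>x\<close> and \<open>(x, False)\<close> for its inverse.\<close>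

type_synonym 'a letter = "'a \<times> bool"

definition inv_letter :: "'a letter \<Rightarrow> 'a letter" where
  "inv_letter l = (fst l, \<not> snd l)"

definition reduced_words :: "'a set \<Rightarrow> 'a letter list set" where
  "reduced_words X = {u. set u \<subseteq> X \<times> UNIV \<and> successively (\<lambda>l m. m \<noteq> inv_letter l) u}"

definition infinite_reduced_words :: "'a set \<Rightarrow> (nat \<Rightarrow> 'a letter) set" where
  "infinite_reduced_words X =
     {s. range s \<subseteq> X \<times> UNIV \<and> (\<forall>n. s (Suc n) \<noteq> inv_letter (s n))}"

definition eval_word :: "('a, 'z) monoid_scheme \<Rightarrow> 'a letter list \<Rightarrow> 'a" where
  "eval_word G u =
     foldr (\<lambda>l y. (if snd l then fst l else inv\<^bsub>G\<^esub> (fst l)) \<otimes>\<^bsub>G\<^esub> y) u \<one>\<^bsub>G\<^esub>"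

definition free_basis :: "('a, 'z) monoid_scheme \<Rightarrow> 'a set \<Rightarrow> 'a set \<Rightarrow> bool" where
  "free_basis G F X \<longleftrightarrow> X \<subseteq> F \<and> bij_betw (eval_word G) (reduced_words X) F"

datatype 'l word = Fin "'l list" | Inf "nat \<Rightarrow> 'l"

fun is_prefix :: "'l list \<Rightarrow> 'l word \<Rightarrow> bool" where
  "is_prefix u (Fin v) \<longleftrightarrow> (\<exists>z. v = u @ z)"
| "is_prefix u (Inf s) \<longleftrightarrow> u = map s [0..<length u]"

text \<open>Only used for distinct words, where the maximum is over a finite set.\<close>

definition common_prefix_length :: "'l word \<Rightarrow> 'l word \<Rightarrow> nat" where
  "common_prefix_length v w = Max {length u | u. is_prefix u v \<and> is_prefix u w}"

definition word_dist :: "'l word \<Rightarrow> 'l word \<Rightarrow> real" where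
  "word_dist v w = (if v = w then 0 else 1 / (real (common_prefix_length v w) + 1))"

definition hyp_compactification :: "'a set \<Rightarrow> 'a letter word topology" where
  "hyp_compactification X =
     Metric_space.mtopology (Fin ` reduced_words X \<union> Inf ` infinite_reduced_words X) word_dist"

definition hyp_boundary :: "'a set \<Rightarrow> 'a letter word topology" where
  "hyp_boundary X = subtopology (hyp_compactification X) (Inf ` infinite_reduced_words X)"

definition word_of :: "('a, 'z) monoid_scheme \<Rightarrow> 'a set \<Rightarrow> 'a \<Rightarrow> 'a letter word" where
  "word_of G X x = Fin (the_inv_into (reduced_words X) (eval_word G) x)"

text \<open>The unique homeomorphism of the compactification of \<open>F\<close> that extends the automorphism \<open>\<phi>\<close>
  of \<open>F\<close>. Functions being total in HOL, uniqueness requires a fixed value off the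
  compactification.\<close>

definition homeo_extension ::
  "('a, 'z) monoid_scheme \<Rightarrow> 'a set \<Rightarrow> 'a set \<Rightarrow> ('a \<Rightarrow> 'a) \<Rightarrow> 'a letter word \<Rightarrow> 'a letter word" where
  "homeo_extension G F X \<phi> = (THE f.
     homeomorphic_map (hyp_compactification X) (hyp_compactification X) f \<and>
     f \<in> extensional (topspace (hyp_compactification X)) \<and>
     (\<forall>x\<in>F. f (word_of G X x) = word_of G X (\<phi> x)))"

definition conj_action ::
  "('a, 'z) monoid_scheme \<Rightarrow> 'a set \<Rightarrow> 'a set \<Rightarrow> 'a \<Rightarrow> 'a letter word \<Rightarrow> 'a letter word" where
  "conj_action G F X g = homeo_extension G F X (\<lambda>x. g \<otimes>\<^bsub>G\<^esub> x \<otimes>\<^bsub>G\<^esub> inv\<^bsub>G\<^esub> g)"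

end

theory Submission
  imports Defs
begin

text \<open>Given a stationary \<open>\<nu>\<close> and a clopen \<open>E\<close>, the function \<open>g \<mapsto> (g\<nu>)(E)\<close> is bounded and
  harmonic. By the \<open>L\<^sup>2\<close> maximal inequality it converges along almost every path \<open>\<tau>\<close>, and orthogonality of
  increments makes \<open>(\<tau>\<^sub>i a \<nu>)(E) - (\<tau>\<^sub>i \<nu>)(E)\<close> tend to \<open>0\<close> for each fixed \<open>a\<close>. For \<open>a \<in> F\<close> the measure
  \<open>\<tau>\<^sub>i a \<nu>\<close> is the translate of \<open>\<lambda> = \<tau>\<^sub>i \<nu>\<close> by \<open>b = \<tau>\<^sub>i a \<tau>\<^sub>i\<^sup>-\<^sup>1 \<in> F\<close>, so \<open>\<lambda>\<close> is almost invariant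
  under the images \<open>b\<close> of any prescribed finite subset of \<open>F\<close> under an injective endomorphism of \<open>F\<close>.

  This alone forces \<open>\<lambda>\<close> to be concentrated on one cylinder of length \<open>K\<close>. A long \<open>b\<close> with
  \<open>K\<close>-prefixes \<open>s\<close> of \<open>b\<close> and \<open>s'\<close> of \<open>b\<^sup>-\<^sup>1\<close> maps the complement of the cylinder of \<open>s'\<close> into the
  cylinder of \<open>s\<close>, whence \<open>\<lambda>\<close> is nearly supported on these two cylinders. If \<open>s = s'\<close> and the cylinder
  does not carry nearly all mass, then the preimages of its complement under the powers of \<open>b\<close> are
  disjoint with masses bounded below, which is absurd. If \<open>s \<noteq> s'\<close> for both of two elements \<open>c, d\<close>, then
  up to inverting \<open>d\<close> they have the same pair of prefixes, \<open>cd\<close> and \<open>dc\<close> have equal length and start with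
  \<open>s\<close>, and the commutator \<open>(cd)(dc)\<^sup>-\<^sup>1\<close> falls under the first case. Elements with long images exist by
  the pigeonhole principle.

  Hence \<open>\<tau>\<^sub>i \<nu>\<close> converges to a point measure. Applying this to two stationary measures and to their
  average shows that the limit points agree, which gives uniqueness. Existence follows from
  compactness, and the points of maximal mass would form a finite \<open>F\<close>-invariant set, so there are no atoms.\<close>

section \<open>Reduced words\<close>

text \<open>The obstacle is uniformity. The automorphism
  \<open>x \<mapsto> \<tau>\<^sub>i x \<tau>\<^sub>i\<^sup>-\<^sup>1\<close> changes with
  \<open>i\<close> and may shorten or distort any given element, so nothing is used of it beyond
  being an injective homomorphism of \<open>F\<close> into itself. The finite test set therefore has
  to be fixed in terms of \<open>K\<close> and \<delta> alone, and still contain suitable long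
  elements after an arbitrary such map. Counting achieves this: balls of \<open>F\<close> are
  finite, so in a family of distinct elements all but a bounded number have long images. An element
  whose two end prefixes differ is compatible with mass spread over two cylinders, so powers of
  generators do not suffice; commutators are included because they can be forced to have equal end
  prefixes. Concentration at a single time does not say where the mass sits, and the heavy cylinder
  could jump with \<open>i\<close>. Convergence of the harmonic functions excludes this, which is
  why both convergence and vanishing increments are kept along a path. Clopen sets carry the whole
  argument; continuous test functions appear only when weak* convergence is concluded.\<close>

definition winv :: "'a letter list \<Rightarrow> 'a letter list" where
  "winv u = rev (map inv_letter u)"

lemma inv_letter_inv_letter [simp]: "inv_letter (inv_letter l) = l"
  by (simp add: inv_letter_def)

lemma inv_letter_neq [simp]: "inv_letter l \<noteq> l" "l \<noteq> inv_letter l"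
  by (auto simp: inv_letter_def prod_eq_iff)

lemma inv_letter_eq_iff: "inv_letter l = m \<longleftrightarrow> l = inv_letter m"
  by (metis inv_letter_inv_letter)

lemma fst_inv_letter [simp]: "fst (inv_letter l) = fst l"
  and snd_inv_letter [simp]: "snd (inv_letter l) = (\<not> snd l)"
  by (simp_all add: inv_letter_def)

lemma winv_simps [simp]:
  "winv [] = []" "winv (l # u) = winv u @ [inv_letter l]" "winv (u @ v) = winv v @ winv u"
  "length (winv u) = length u" "winv (winv u) = u"
  by (simp_all add: winv_def rev_map comp_def)

lemma winv_eq_Nil_iff [simp]: "winv u = [] \<longleftrightarrow> u = []"
  by (simp add: winv_def)

lemma reduced_words_append_iff:
  "u @ v \<in> reduced_words X \<longleftrightarrow> u \<in> reduced_words X \<and> v \<in> reduced_words X \<and>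
     (u = [] \<or> v = [] \<or> hd v \<noteq> inv_letter (last u))"
  by (auto simp: reduced_words_def successively_append_iff)

lemma reduced_words_Nil [simp]: "[] \<in> reduced_words X"
  by (simp add: reduced_words_def)

lemma reduced_words_singleton [simp]: "[l] \<in> reduced_words X \<longleftrightarrow> fst l \<in> X"
  by (cases l) (simp add: reduced_words_def)

lemma reduced_words_Cons_Cons [simp]:
  "l # m # u \<in> reduced_words X \<longleftrightarrow> fst l \<in> X \<and> m \<noteq> inv_letter l \<and> m # u \<in> reduced_words X"
  using reduced_words_append_iff[of "[l]" "m # u" X] by auto

lemma reduced_words_Cons:
  "l # u \<in> reduced_words X \<longleftrightarrow> fst l \<in> X \<and> u \<in> reduced_words X \<and> (u = [] \<or> hd u \<noteq> inv_letter l)"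
  using reduced_words_append_iff[of "[l]" u X] by auto

lemma winv_reduced: "u \<in> reduced_words X \<Longrightarrow> winv u \<in> reduced_words X"
proof (induction u)
  case (Cons l u)
  have "[l] @ u \<in> reduced_words X"
    using Cons.prems by simp
  then have *: "u \<in> reduced_words X" "fst l \<in> X" "u = [] \<or> hd u \<noteq> inv_letter l"
    unfolding reduced_words_append_iff by auto
  show ?case
  proof (cases u)
    case (Cons a list)
    then show ?thesis
      using Cons.IH * by (simp add: reduced_words_append_iff)
  qed (use * in simp)
qed simp

lemma take_reduced: "u \<in> reduced_words X \<Longrightarrow> take n u \<in> reduced_words X"
  using reduced_words_append_iff[of "take n u" "drop n u" X] by auto

lemma finite_reduced_words_le:
  "finite X \<Longrightarrow> finite {u \<in> reduced_words X. length u \<le> n}"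
  by (rule finite_subset[OF _ finite_lists_length_le[of "X \<times> UNIV" n]])
     (auto simp: reduced_words_def)

lemma countable_reduced_words: "finite X \<Longrightarrow> countable (reduced_words X)"
  by (rule countable_subset[OF _ countable_lists[of "X \<times> UNIV"]])
     (auto simp: reduced_words_def countable_finite)

text \<open>Letters are stripped at the seam, from the end of \<open>u\<close> against the front of
  \<open>v\<close>, until the seam no longer cancels. Naming the cancelled part \<open>c\<close>
  avoids a reduction function on words.\<close>

lemma cancel_decomposition:
  assumes "u \<in> reduced_words X" "v \<in> reduced_words X"
  obtains p c q where "u = p @ c" "v = winv c @ q" "p @ q \<in> reduced_words X"
proof -
  have "\<exists>p c q. u = p @ c \<and> v = winv c @ q \<and> p @ q \<in> reduced_words X"
    using assms
  proof (induction u arbitrary: v rule: rev_induct)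
    case (snoc l u)
    then have u: "u \<in> reduced_words X"
      by (simp add: reduced_words_append_iff)
    show ?case
    proof (cases "v \<noteq> [] \<and> hd v = inv_letter l")
      case True
      then have v: "v = inv_letter l # tl v"
        by (cases v) auto
      then have "[inv_letter l] @ tl v \<in> reduced_words X"
        using snoc.prems by simp
      then have "tl v \<in> reduced_words X"
        unfolding reduced_words_append_iff by simp
      from snoc.IH[OF u this] obtain p c q where
        "u = p @ c" "tl v = winv c @ q" "p @ q \<in> reduced_words X" by blast
      then show ?thesis
        using v by (intro exI[of _ p] exI[of _ "c @ [l]"] exI[of _ q]) simp
    next
      case False
      then have "u @ [l] = (u @ [l]) @ []" "v = winv [] @ v" "(u @ [l]) @ v \<in> reduced_words X"
        using snoc.prems by (auto simp: reduced_words_append_iff reduced_words_Cons)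
      then show ?thesis by blast
    qed
  qed simp
  then show ?thesis using that by blast
qed

text \<open>Here and below the \<open>K\<close>-prefixes of a long word and of its inverse play the role of its
  attracting and repelling points.\<close>

lemma take_product:
  assumes "b = p @ c" "v = winv c @ q" "2 * K \<le> length b" "take K v \<noteq> take K (winv b)"
  shows "take K (p @ q) = take K b" "length c < K"
proof -
  show c: "length c < K"
  proof (rule ccontr)
    assume "\<not> length c < K"
    then have "take K v = take K (winv b)" using assms by simp
    with assms show False by simp
  qed
  show "take K (p @ q) = take K b"
    using assms c by simp
qed

text \<open>Cyclic reduction: mutually inverse outer letters are removed in pairs until the core
  \<open>k\<close> is cyclically reduced.\<close>

lemma conjugate_decomposition:
  assumes "w \<in> reduced_words X" "w \<noteq> []"
  obtains u k where "w = u @ k @ winv u" "k \<noteq> []" "hd k \<noteq> inv_letter (last k)"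
proof -
  have "\<exists>u k. w = u @ k @ winv u \<and> k \<noteq> [] \<and> hd k \<noteq> inv_letter (last k)"
    using assms
  proof (induction "length w" arbitrary: w rule: less_induct)
    case less
    show ?case
    proof (cases "hd w \<noteq> inv_letter (last w)")
      case True
      then show ?thesis using less.prems
        by (intro exI[of _ "[]"] exI[of _ w]) simp
    next
      case False
      obtain l w' where l: "w = l # w'" using less.prems by (cases w) auto
      with False have "w' \<noteq> []" by auto
      then obtain w'' m where m: "w' = w'' @ [m]" by (cases w' rule: rev_cases) auto
      have m_eq: "m = inv_letter l" using False l m by (simp add: inv_letter_eq_iff)
      have "[l] @ w'' @ [m] \<in> reduced_words X" using less.prems l m by simp
      \<comment> \<open>An empty middle would put \<open>l\<close> next to its inverse, against
        reducedness.\<close>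
      then have w'': "w'' \<in> reduced_words X" "w'' \<noteq> []"
        using m_eq unfolding reduced_words_append_iff by auto
      have "length w'' < length w" using l m by simp
      from less.hyps[OF this w''] obtain u k where
        "w'' = u @ k @ winv u" "k \<noteq> []" "hd k \<noteq> inv_letter (last k)" by blast
      then show ?thesis using l m m_eq
        by (intro exI[of _ "l # u"] exI[of _ k]) simp
    qed
  qed
  then show ?thesis using that by blast
qed

text \<open>The first and last letters are carried along because the induction step only inspects
  the seam between \<open>last k\<close> and \<open>hd k\<close>.\<close>

lemma concat_replicate_reduced:
  assumes "k \<in> reduced_words X" "k \<noteq> []" "hd k \<noteq> inv_letter (last k)"
  shows "concat (replicate (Suc n) k) \<in> reduced_words X \<and> hd (concat (replicate (Suc n) k)) = hd k
    \<and> last (concat (replicate (Suc n) k)) = last k \<and> concat (replicate (Suc n) k) \<noteq> []"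
proof (induction n)
  case (Suc n)
  have "concat (replicate (Suc (Suc n)) k) = k @ concat (replicate (Suc n) k)" by simp
  with Suc assms show ?case
    by (auto simp: reduced_words_append_iff simp del: replicate.simps)
qed (use assms in simp)


section \<open>The normal free subgroup\<close>

locale free_normal_subgroup = normal F G for F and G (structure) +
  fixes X
  assumes basis: "free_basis G F X" and finite_X: "finite X"
begin

definition rw :: "'a \<Rightarrow> 'a letter list" where
  "rw x = the_inv_into (reduced_words X) (eval_word G) x"

lemma inv_cancel: "a \<in> carrier G \<Longrightarrow> z \<in> carrier G \<Longrightarrow> inv a \<otimes> (a \<otimes> z) = z"
  and cancel_inv: "a \<in> carrier G \<Longrightarrow> z \<in> carrier G \<Longrightarrow> a \<otimes> (inv a \<otimes> z) = z"
  by (simp_all add: m_assoc[symmetric])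

lemma X_subset: "X \<subseteq> F" and eval_bij: "bij_betw (eval_word G) (reduced_words X) F"
  using basis by (auto simp: free_basis_def)

lemma X_carrier: "x \<in> X \<Longrightarrow> x \<in> carrier G"
  using X_subset subset by blast

lemma eval_Nil [simp]: "eval_word G [] = \<one>"
  and eval_Cons: "eval_word G (l # u) = (if snd l then fst l else inv (fst l)) \<otimes> eval_word G u"
  by (simp_all add: eval_word_def)

lemma eval_carrier: "fst ` set u \<subseteq> X \<Longrightarrow> eval_word G u \<in> carrier G"
  by (induction u) (auto simp: eval_Cons X_carrier)

lemma eval_append:
  "fst ` set u \<subseteq> X \<Longrightarrow> fst ` set v \<subseteq> X \<Longrightarrow> eval_word G (u @ v) = eval_word G u \<otimes> eval_word G v"
  by (induction u) (auto simp: eval_Cons X_carrier eval_carrier m_assoc)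

lemma fst_set_winv [simp]: "fst ` set (winv u) = fst ` set u"
  by (induction u) auto

lemma eval_winv: "fst ` set u \<subseteq> X \<Longrightarrow> eval_word G (winv u) = inv (eval_word G u)"
proof (induction u)
  case (Cons l u)
  have "eval_word G [inv_letter l] = inv (eval_word G [l])"
    using Cons.prems by (auto simp: eval_Cons X_carrier)
  moreover have "eval_word G (l # u) = eval_word G [l] \<otimes> eval_word G u"
    using Cons.prems eval_append[of "[l]" u] by simp
  moreover have "eval_word G (winv (l # u)) = eval_word G (winv u) \<otimes> eval_word G [inv_letter l]"
    using Cons.prems eval_append[of "winv u" "[inv_letter l]"] by simp
  moreover have "eval_word G [l] \<in> carrier G" "eval_word G u \<in> carrier G"
    using Cons.prems eval_carrier[of "[l]"] eval_carrier[of u] by auto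
  ultimately show ?case
    using Cons by (simp add: inv_mult_group)
qed simp

lemma reduced_letters: "u \<in> reduced_words X \<Longrightarrow> fst ` set u \<subseteq> X"
  by (auto simp: reduced_words_def)

lemma eval_in_F: "u \<in> reduced_words X \<Longrightarrow> eval_word G u \<in> F"
  using eval_bij by (auto simp: bij_betw_def)

lemma rw_reduced [simp]: "x \<in> F \<Longrightarrow> rw x \<in> reduced_words X"
  unfolding rw_def using eval_bij by (auto simp: bij_betw_def intro: the_inv_into_into)

lemma eval_rw [simp]: "x \<in> F \<Longrightarrow> eval_word G (rw x) = x"
  unfolding rw_def using eval_bij by (auto simp: bij_betw_def intro: f_the_inv_into_f)

lemma rw_eval [simp]: "u \<in> reduced_words X \<Longrightarrow> rw (eval_word G u) = u"
  unfolding rw_def using eval_bij by (auto simp: bij_betw_def intro: the_inv_into_f_f)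

lemma word_of_eq: "word_of G X x = Fin (rw x)"
  by (simp add: word_of_def rw_def)

lemma rw_eqI: "u \<in> reduced_words X \<Longrightarrow> eval_word G u = x \<Longrightarrow> rw x = u"
  by auto

lemma rw_one [simp]: "rw \<one> = []"
  by (rule rw_eqI) auto

lemma F_carrier: "x \<in> F \<Longrightarrow> x \<in> carrier G"
  using subset by blast

lemma rw_inv: "x \<in> F \<Longrightarrow> rw (inv x) = winv (rw x)"
  by (rule rw_eqI) (auto simp: eval_winv reduced_letters winv_reduced)

text \<open>Multiplication in \<open>F\<close> is cancellation of \<open>c\<close> at the seam, so
  later estimates of lengths and prefixes become arithmetic with \<open>p\<close>, \<open>c\<close>
  and \<open>q\<close>.\<close>

lemma rw_mult:
  assumes "x \<in> F" "y \<in> F"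
  obtains p c q where "rw x = p @ c" "rw y = winv c @ q" "rw (x \<otimes> y) = p @ q"
proof -
  obtain p c q where *: "rw x = p @ c" "rw y = winv c @ q" "p @ q \<in> reduced_words X"
    using cancel_decomposition[of "rw x" X "rw y"] assms by auto
  have r: "p \<in> reduced_words X" "c \<in> reduced_words X" "winv c \<in> reduced_words X" "q \<in> reduced_words X"
    using rw_reduced[OF assms(1)] rw_reduced[OF assms(2)] *
    by (simp_all add: reduced_words_append_iff winv_reduced)
  note L = r[THEN reduced_letters]
  have C: "eval_word G p \<in> carrier G" "eval_word G c \<in> carrier G" "eval_word G q \<in> carrier G"
    using L by (auto intro: eval_carrier)
  have "x \<otimes> y = eval_word G (p @ c) \<otimes> eval_word G (winv c @ q)"
    using assms * eval_rw by metis
  also have "\<dots> = eval_word G p \<otimes> eval_word G c \<otimes> (inv (eval_word G c) \<otimes> eval_word G q)"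
    using L by (simp add: eval_append eval_winv)
  also have "\<dots> = eval_word G p \<otimes> eval_word G q"
    using C by (simp add: m_assoc cancel_inv)
  also have "\<dots> = eval_word G (p @ q)"
    using L by (simp add: eval_append)
  finally have "rw (x \<otimes> y) = p @ q"
    using *(3) by (intro rw_eqI) auto
  with * show ?thesis using that by blast
qed

text \<open>A right factor \<open>y\<close> can only destroy the last \<open>length (rw y)\<close>
  letters of \<open>rw x\<close>.\<close>

lemma take_rw_mult:
  assumes "x \<in> F" "y \<in> F" "k + length (rw y) \<le> length (rw x)"
  shows "take k (rw (x \<otimes> y)) = take k (rw x)"
  by (rule rw_mult[OF assms(1,2)]) (use assms in auto)

text \<open>Ping-pong for words: only an \<open>x\<close> that starts like the inverse of
  \<open>b\<close> can cancel \<open>K\<close> or more letters of \<open>b\<close>.\<close>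

lemma take_rw_mult_long:
  assumes "b \<in> F" "x \<in> F" "2 * K \<le> length (rw b)" "take K (rw x) \<noteq> take K (rw (inv b))"
  shows "take K (rw (b \<otimes> x)) = take K (rw b)"
  by (rule rw_mult[OF assms(1,2)]) (use assms take_product[of "rw b"] in \<open>auto simp: rw_inv\<close>)

text \<open>Finite rank enters the properness and the pigeonhole arguments through this finiteness
  of balls.\<close>

lemma finite_F_le: "finite {x \<in> F. length (rw x) \<le> n}"
proof -
  have "{x \<in> F. length (rw x) \<le> n} \<subseteq> eval_word G ` {u \<in> reduced_words X. length u \<le> n}"
    by (auto intro!: image_eqI[of _ _ "rw _"])
  then show ?thesis
    using finite_reduced_words_le[OF finite_X] finite_subset by blast
qed

lemma countable_F: "countable F"
  using eval_bij countable_reduced_words[OF finite_X] by (metis bij_betw_def countable_image)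

end

context free_normal_subgroup begin
text \<open>A word sharing a prefix with its inverse is conjugate by that prefix to a
  cyclically reduced word, so its powers keep the prefix.\<close>

lemma pow_prefix:
  assumes "c \<in> F" "2 * K \<le> length (rw c)" "0 < K" "take K (rw c) = take K (rw (inv c))" "0 < j"
  shows "2 * K \<le> length (rw (c [^] (j::nat)))"
    "take K (rw (c [^] j)) = take K (rw c)" "take K (rw (inv (c [^] j))) = take K (rw c)"
proof -
  have "rw c \<in> reduced_words X" "rw c \<noteq> []"
    using assms(1-3) by auto
  then obtain u k where uk: "rw c = u @ k @ winv u" "k \<noteq> []" "hd k \<noteq> inv_letter (last k)"
    by (rule conjugate_decomposition)
  \<comment> \<open>If \<open>u\<close> were shorter than \<open>K\<close>, the letters at position
    \<open>length u\<close> of \<open>rw c\<close> and of its inverse would agree. These are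
    \<open>hd k\<close> and the inverse of \<open>last k\<close>, which differ as \<open>k\<close>
    is cyclically reduced.\<close>
  have u: "K \<le> length u"
  proof (rule ccontr)
    assume "\<not> K \<le> length u"
    then have "rw c ! length u = rw (inv c) ! length u"
      using assms(4) by (metis not_le nth_take)
    moreover have "rw c ! length u = hd k"
      using uk(2) by (simp add: uk(1) nth_append hd_conv_nth)
    moreover have "rw (inv c) ! length u = hd (winv k)"
      using uk(2) by (simp add: rw_inv[OF assms(1)] uk(1) nth_append hd_conv_nth)
    ultimately show False
      using uk(2,3) by (simp add: winv_def hd_rev last_map)
  qed
  have red: "u @ k @ winv u \<in> reduced_words X" using rw_reduced[OF assms(1)] uk by simp
  then have k: "k \<in> reduced_words X" by (simp add: reduced_words_append_iff)
  define kk where "kk n = concat (replicate (Suc n) k)" for n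
  have kk: "kk n \<in> reduced_words X \<and> hd (kk n) = hd k \<and> last (kk n) = last k \<and> kk n \<noteq> []" for n
    unfolding kk_def using concat_replicate_reduced[OF k uk(2,3)] by blast
  have ukk: "u @ kk n @ winv u \<in> reduced_words X" for n
    using red kk[of n] uk(2) by (auto simp: reduced_words_append_iff hd_append)
  have lts: "fst ` set (kk n) \<subseteq> X" "fst ` set u \<subseteq> X" "fst ` set k \<subseteq> X" for n
    using kk[of n] k red reduced_letters by (auto simp: reduced_words_append_iff)
  have EC: "eval_word G u \<in> carrier G" "eval_word G k \<in> carrier G" "eval_word G (kk n) \<in> carrier G" for n
    using lts by (auto intro: eval_carrier)
  have c: "c = eval_word G u \<otimes> eval_word G k \<otimes> inv (eval_word G u)"
    using arg_cong[OF uk(1), of "eval_word G"] assms(1) lts EC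
    by (simp add: eval_append eval_winv m_assoc image_Un)
  have pow: "c [^] (Suc n) = eval_word G (u @ kk n @ winv u)" for n
  proof (induction n)
    case 0
    then show ?case using uk assms(1) F_carrier by (simp add: kk_def flip: uk(1))
  next
    case (Suc n)
    have "kk (Suc n) = kk n @ k"
    proof -
      have "replicate (Suc (Suc n)) k = replicate (Suc n) k @ [k]"
        by (metis replicate_Suc replicate_append_same)
      then show ?thesis unfolding kk_def by (simp only: concat_append) simp
    qed
    then have e: "eval_word G (u @ kk (Suc n) @ winv u)
        = eval_word G u \<otimes> eval_word G (kk n) \<otimes> eval_word G k \<otimes> inv (eval_word G u)"
      using lts EC by (simp add: eval_append eval_winv m_assoc image_Un)
    have "c [^] Suc (Suc n) = c [^] Suc n \<otimes> c" by simp
    also have "\<dots> = (eval_word G u \<otimes> eval_word G (kk n) \<otimes> inv (eval_word G u))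
        \<otimes> (eval_word G u \<otimes> eval_word G k \<otimes> inv (eval_word G u))"
      unfolding Suc.IH using lts EC c by (simp add: eval_append eval_winv m_assoc image_Un)
    also have "\<dots> = eval_word G u \<otimes> eval_word G (kk n) \<otimes> eval_word G k \<otimes> inv (eval_word G u)"
      using EC by (simp add: m_assoc inv_cancel)
    finally show ?case using e by simp
  qed
  obtain n where j: "j = Suc n" using assms(5) by (cases j) auto
  have rwj: "rw (c [^] j) = u @ kk n @ winv u"
    unfolding j pow using ukk by simp
  have cj: "c [^] j \<in> F" unfolding j pow using ukk eval_in_F by blast
  show "2 * K \<le> length (rw (c [^] j))" "take K (rw (c [^] j)) = take K (rw c)"
    "take K (rw (inv (c [^] j))) = take K (rw c)"
    using u cj by (simp_all add: rwj rw_inv uk(1))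
qed

end

section \<open>Measures on compact spaces with a countable base of clopen sets\<close>

text \<open>What the measure theory needs to know of the boundary: the clopen sets form a countable
  algebra generating the Borel sets, and compactness makes finite additivity on it as good as
  countable additivity.\<close>

locale clopen_space =
  fixes T :: "'m topology"
  assumes compact: "compact_space T"
    and countable_clopen: "countable {C. openin T C \<and> closedin T C}"
    and base: "\<And>U x. openin T U \<Longrightarrow> x \<in> U \<Longrightarrow> \<exists>C. openin T C \<and> closedin T C \<and> x \<in> C \<and> C \<subseteq> U"
begin

definition clopens :: "'m set set" where "clopens = {C. openin T C \<and> closedin T C}"

lemma open_Pow: "{U. openin T U} \<subseteq> Pow (topspace T)"
  using openin_subset by blast

lemma algebra_clopens: "algebra (topspace T) clopens"
  by (rule algebra_iff_Un[THEN iffD2]) (use open_Pow in \<open>auto simp: clopens_def\<close>)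

lemma sets_borel: "sets (borel_on T) = sigma_sets (topspace T) clopens"
  and space_borel [simp]: "space (borel_on T) = topspace T"
proof -
  note sub = open_Pow
  then have s: "sets (borel_on T) = sigma_sets (topspace T) {U. openin T U}"
    and "space (borel_on T) = topspace T"
    by (auto simp: borel_on_def sets_measure_of space_measure_of)
  then show "space (borel_on T) = topspace T" by simp
  show "sets (borel_on T) = sigma_sets (topspace T) clopens"
    unfolding s
  proof (rule sigma_sets_eqI)
    fix U assume "U \<in> {U. openin T U}"
    then have U: "openin T U" by simp
    \<comment> \<open>Countability of the clopen sets turns an arbitrary open set into a countable
      union of them.\<close>
    let ?D = "{C \<in> clopens. C \<subseteq> U}"
    have "U = \<Union>?D"
      using base[OF U] by (auto simp: clopens_def)
    moreover have "countable ?D"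
      using countable_clopen by (rule countable_subset[rotated]) (auto simp: clopens_def)
    moreover have "\<Union>?D \<in> sigma_sets (topspace T) clopens"
      using \<open>countable ?D\<close> by (intro sigma_sets_UNION) (auto intro: sigma_sets.Basic)
    ultimately show "U \<in> sigma_sets (topspace T) clopens" by simp
  qed (auto simp: clopens_def intro: sigma_sets.Basic)
qed

lemma clopens_sets: "C \<in> clopens \<Longrightarrow> C \<in> sets (borel_on T)"
  by (auto simp: sets_borel intro: sigma_sets.Basic)

lemma openin_sets: "openin T U \<Longrightarrow> U \<in> sets (borel_on T)"
  using open_Pow by (simp add: borel_on_def sets_measure_of sigma_sets.Basic)

lemma closedin_sets: "closedin T U \<Longrightarrow> U \<in> sets (borel_on T)"
  by (metis closedin_def openin_sets sets.compl_sets space_borel double_diff order_refl)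

section \<open>Determination by clopen sets and regularity\<close>

lemma borel_measure_eqI:
  assumes "finite_measure M" "sets M = sets (borel_on T)" "sets N = sets (borel_on T)"
    and "\<And>C. C \<in> clopens \<Longrightarrow> emeasure M C = emeasure N C"
  shows "M = N"
proof (rule measure_eqI_generator_eq[where E = clopens and \<Omega> = "topspace T" and A = "\<lambda>_. topspace T"])
  interpret algebra "topspace T" clopens by (rule algebra_clopens)
  show "Int_stable clopens" by (auto simp: Int_stable_def)
  show "clopens \<subseteq> Pow (topspace T)" using space_closed .
  show "sets M = sigma_sets (topspace T) clopens" "sets N = sigma_sets (topspace T) clopens"
    using assms sets_borel by auto
  show "range (\<lambda>_. topspace T) \<subseteq> clopens" by auto
  show "emeasure M (topspace T) \<noteq> \<infinity>"
    using assms(1) by (simp add: finite_measure.emeasure_eq_measure)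
qed (use assms in auto)

text \<open>The sets squeezed between a closed and an open set of almost equal measure form a
  \<open>\<sigma>\<close>-algebra.\<close>

lemma closed_open_approximation:
  assumes "finite_measure M" "sets M = sets (borel_on T)" "E \<in> sets M" "0 < e"
  shows "\<exists>K U. closedin T K \<and> openin T U \<and> K \<subseteq> E \<and> E \<subseteq> U \<and> measure M (U - K) < e"
proof -
  interpret finite_measure M by fact
  have M [simp]: "openin T U \<Longrightarrow> U \<in> sets M" "closedin T U \<Longrightarrow> U \<in> sets M" for U
    using openin_sets closedin_sets assms(2) by auto
  have sp: "space M = topspace T"
    using sets_eq_imp_space_eq[OF assms(2)] by simp
  have "E \<in> sigma_sets (topspace T) clopens" using assms sets_borel by simp
  then show ?thesis using \<open>0 < e\<close>
  proof (induction arbitrary: e)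
    case (Basic C)
    then show ?case
      by (intro exI[of _ C] conjI) (simp_all add: clopens_def)
  next
    case Empty
    then show ?case by (intro exI[of _ "{}"]) auto
  next
    case (Compl E)
    obtain K U where KU: "closedin T K" "openin T U" "K \<subseteq> E" "E \<subseteq> U" "measure M (U - K) < e"
      using Compl.IH[OF Compl.prems] by blast
    moreover have "(topspace T - K) - (topspace T - U) = U - K"
      using openin_subset[OF KU(2)] by blast
    ultimately have "closedin T (topspace T - U) \<and> openin T (topspace T - K) \<and>
        topspace T - U \<subseteq> topspace T - E \<and> topspace T - E \<subseteq> topspace T - K \<and>
        measure M ((topspace T - K) - (topspace T - U)) < e"
      by (metis Diff_mono closedin_diff closedin_topspace openin_diff openin_topspace order_refl)
    then show ?case by blast
  next
    case (Union a)
    \<comment> \<open>The geometric tolerances use up half of \<open>e\<close>; the other half is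
      reserved for cutting off the union of the closed sets.\<close>
    have "\<exists>K U. closedin T K \<and> openin T U \<and> K \<subseteq> a i \<and> a i \<subseteq> U
        \<and> measure M (U - K) < e / 2 * (1/2) ^ Suc i" for i
      using Union.IH[of "e / 2 * (1/2) ^ Suc i" i] Union.prems by simp
    then obtain K U where KU: "\<And>i. closedin T (K i)" "\<And>i. openin T (U i)"
      "\<And>i. K i \<subseteq> a i" "\<And>i. a i \<subseteq> U i" "\<And>i. measure M (U i - K i) < e / 2 * (1/2) ^ Suc i"
      by metis
    have s: "(\<lambda>i. e / 2 * (1/2) ^ Suc i) sums (e / 2 * 1)"
      by (intro sums_mult power_half_series)
    \<comment> \<open>Only finite unions of the closed sets are known to be closed, and continuity
      from below makes the cut-off cheap.\<close>
    let ?K = "\<lambda>n. \<Union>i\<le>n. K i"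
    have "(\<lambda>n. measure M (?K n)) \<longlonglongrightarrow> measure M (\<Union>n. ?K n)"
      using KU by (intro finite_Lim_measure_incseq) (auto simp: incseq_def intro: order_trans)
    moreover have "(\<Union>n. ?K n) = (\<Union>n. K n)" by auto
    ultimately have "(\<lambda>n. measure M (?K n)) \<longlonglongrightarrow> measure M (\<Union>n. K n)" by simp
    then have "\<forall>\<^sub>F n in sequentially. measure M (\<Union>n. K n) - e / 2 < measure M (?K n)"
      using Union.prems by (intro order_tendstoD) auto
    then obtain n where n: "measure M (\<Union>n. K n) - e / 2 < measure M (?K n)"
      by (auto simp: eventually_sequentially)
    have m: "(\<Union>n. K n) \<in> sets M" "(\<Union>n. U n) \<in> sets M" "?K n \<in> sets M"
      using KU by auto
    have le: "measure M (U i - K i) \<le> e / 2 * (1/2) ^ Suc i" for i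
      using KU(5)[of i] by (rule less_imp_le)
    then have sm: "summable (\<lambda>i. measure M (U i - K i))"
      by (intro summable_comparison_test'[OF sums_summable[OF s], of 0]) (simp only: real_norm_def abs_of_nonneg measure_nonneg)
    have D: "U i - K i \<in> sets M" for i
      using KU(1,2)[of i] by (intro sets.Diff) simp_all
    have "measure M ((\<Union>n. U n) - (\<Union>n. K n)) \<le> measure M (\<Union>n. (U n - K n))"
      using D by (intro finite_measure_mono sets.countable_UN) auto
    also have "\<dots> \<le> (\<Sum>i. measure M (U i - K i))"
      using D sm by (intro finite_measure_subadditive_countably) auto
    also have "\<dots> \<le> (\<Sum>i. e / 2 * (1/2) ^ Suc i)"
      using le sm sums_summable[OF s] by (rule suminf_le)
    also have "\<dots> = e / 2" using sums_unique[OF s] by simp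
    finally have 1: "measure M ((\<Union>n. U n) - (\<Union>n. K n)) \<le> e / 2" .
    have "measure M ((\<Union>n. U n) - ?K n) = measure M (((\<Union>n. U n) - (\<Union>n. K n)) \<union> ((\<Union>n. K n) - ?K n))"
      using KU(3,4) by (intro arg_cong[where f = "measure M"]) blast
    also have "\<dots> \<le> measure M ((\<Union>n. U n) - (\<Union>n. K n)) + measure M ((\<Union>n. K n) - ?K n)"
      using m by (intro measure_Un_le) auto
    also have "measure M ((\<Union>n. K n) - ?K n) = measure M (\<Union>n. K n) - measure M (?K n)"
      using m by (intro finite_measure_Diff) auto
    finally have "measure M ((\<Union>n. U n) - ?K n) < e"
      using 1 n by simp
    moreover have "closedin T (?K n)" "openin T (\<Union>n. U n)"
      using KU(1,2) by (auto intro!: closedin_Union)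
    moreover have "?K n \<subseteq> (\<Union>i. a i)" "(\<Union>i. a i) \<subseteq> (\<Union>n. U n)"
      using KU(3,4) by blast+
    ultimately show ?case by blast
  qed
qed

text \<open>Closed sets are compact here, so the squeezing closed sets give inner regularity and the
  open ones outer regularity. Hence any Borel probability measure belongs to
  \<open>prob_measures T\<close>.\<close>

lemma regular_finite_measure:
  assumes "finite_measure M" "sets M = sets (borel_on T)"
  shows "regular_measure T M"
  unfolding regular_measure_def
proof (intro ballI conjI)
  interpret finite_measure M by fact
  have M [simp]: "openin T U \<Longrightarrow> U \<in> sets M" "closedin T U \<Longrightarrow> U \<in> sets M" for U
    using openin_sets closedin_sets assms(2) by auto
  fix E assume E: "E \<in> sets M"
  have approx: "\<exists>K U. closedin T K \<and> openin T U \<and> K \<subseteq> E \<and> E \<subseteq> U \<and>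
      measure M E < measure M K + e \<and> measure M U < measure M E + e" if e: "0 < e" for e
  proof -
    obtain K U where KU: "closedin T K" "openin T U" "K \<subseteq> E" "E \<subseteq> U" "measure M (U - K) < e"
      using closed_open_approximation[OF assms E e] by blast
    have "measure M (U - K) = measure M U - measure M K"
      using KU by (intro finite_measure_Diff) auto
    moreover have "measure M K \<le> measure M E" "measure M E \<le> measure M U"
      using KU E by (auto intro: finite_measure_mono)
    ultimately show ?thesis using KU by (intro exI[of _ K] exI[of _ U]) auto
  qed
  let ?I = "{K. compactin T K \<and> K \<in> sets M \<and> K \<subseteq> E}"
  let ?O = "{U. openin T U \<and> E \<subseteq> U}"
  show "emeasure M E = (SUP K\<in>?I. emeasure M K)"
  proof (rule antisym)
    show "emeasure M E \<le> (SUP K\<in>?I. emeasure M K)"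
    proof (rule ennreal_le_epsilon)
      fix e :: real assume "0 < e"
      then obtain K U where KU: "closedin T K" "K \<subseteq> E" "measure M E < measure M K + e"
        using approx by blast
      then have "K \<in> ?I" using compact closedin_compact_space by auto
      have "emeasure M E \<le> ennreal (measure M K + e)"
        using KU by (simp add: emeasure_eq_measure ennreal_leI)
      also have "\<dots> = emeasure M K + ennreal e"
        using \<open>0 < e\<close> by (simp add: emeasure_eq_measure ennreal_plus)
      also have "\<dots> \<le> (SUP K\<in>?I. emeasure M K) + ennreal e"
        using \<open>K \<in> ?I\<close> by (intro add_mono SUP_upper) auto
      finally show "emeasure M E \<le> (SUP K\<in>?I. emeasure M K) + ennreal e" .
    qed
    show "(SUP K\<in>?I. emeasure M K) \<le> emeasure M E"
      using E by (intro SUP_least emeasure_mono) auto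
  qed
  show "emeasure M E = (INF U\<in>?O. emeasure M U)"
  proof (rule antisym)
    show "emeasure M E \<le> (INF U\<in>?O. emeasure M U)"
      by (intro INF_greatest emeasure_mono) auto
    show "(INF U\<in>?O. emeasure M U) \<le> emeasure M E"
    proof (rule ennreal_le_epsilon)
      fix e :: real assume "0 < e"
      then obtain K U where KU: "openin T U" "E \<subseteq> U" "measure M U < measure M E + e"
        using approx by blast
      have "(INF U\<in>?O. emeasure M U) \<le> emeasure M U"
        using KU by (intro INF_lower) auto
      also have "\<dots> \<le> ennreal (measure M E + e)"
        using KU by (simp add: emeasure_eq_measure ennreal_leI)
      also have "\<dots> = emeasure M E + ennreal e"
        using \<open>0 < e\<close> by (simp add: emeasure_eq_measure ennreal_plus)
      finally show "(INF U\<in>?O. emeasure M U) \<le> emeasure M E + ennreal e" .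
    qed
  qed
qed

section \<open>Constructing probability measures\<close>

lemma prob_measuresI:
  "prob_space M \<Longrightarrow> sets M = sets (borel_on T) \<Longrightarrow> M \<in> prob_measures T"
  by (auto simp: prob_measures_def intro!: regular_finite_measure prob_space.finite_measure)

lemma prob_measuresD:
  assumes "M \<in> prob_measures T"
  shows "prob_space M" "sets M = sets (borel_on T)" "space M = topspace T"
  using assms sets_eq_imp_space_eq[of M "borel_on T"] by (auto simp: prob_measures_def)

text \<open>Serves twice: for the convolution of \<open>\<mu>\<close> with a measure, mixing its
  translates, and for the average of two stationary measures.\<close>

lemma mixture:
  assumes "\<And>i. \<nu> i \<in> prob_measures T"
  obtains N where "N \<in> prob_measures T"
    "\<And>E. E \<in> sets (borel_on T) \<Longrightarrow> measure N E = measure_pmf.expectation p (\<lambda>i. measure (\<nu> i) E)"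
proof -
  have m: "\<nu> \<in> measurable (measure_pmf p) (subprob_algebra (borel_on T))"
    using assms prob_measuresD[OF assms]
    by (auto simp: space_subprob_algebra prob_space_imp_subprob_space)
  let ?N = "measure_pmf p \<bind> \<nu>"
  have s: "sets ?N = sets (borel_on T)"
    using prob_measuresD[OF assms] by (intro sets_bind) auto
  have P: "prob_space ?N"
    using m prob_measuresD[OF assms] by (intro measure_pmf.prob_space_bind[where S = "borel_on T"]) auto
  have "measure ?N E = measure_pmf.expectation p (\<lambda>i. measure (\<nu> i) E)" if "E \<in> sets (borel_on T)" for E
  proof -
    have "emeasure ?N E = (\<integral>\<^sup>+i. emeasure (\<nu> i) E \<partial>measure_pmf p)"
      using m that by (intro emeasure_bind) auto
    also have "\<dots> = (\<integral>\<^sup>+i. ennreal (measure (\<nu> i) E) \<partial>measure_pmf p)"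
      using prob_measuresD[OF assms]
      by (simp add: finite_measure.emeasure_eq_measure[OF prob_space.finite_measure])
    also have "\<dots> = ennreal (measure_pmf.expectation p (\<lambda>i. measure (\<nu> i) E))"
      using prob_measuresD(1)[OF assms] prob_space.prob_le_1
      by (intro nn_integral_eq_integral measure_pmf.integrable_const_bound[where B = 1]) auto
    finally show ?thesis
      using P by (simp add: measure_def integral_nonneg_AE)
  qed
  then show ?thesis using that prob_measuresI[OF P s] by blast
qed

text \<open>Compactness gives continuity at the empty set for free: a decreasing sequence of clopen
  sets with empty intersection is eventually empty, so Caratheodory's theorem applies to any
  finitely additive \<open>f\<close>.\<close>

lemma measure_extending_content:
  assumes nonneg: "\<And>C. C \<in> clopens \<Longrightarrow> 0 \<le> f C"
    and add: "\<And>A B. A \<in> clopens \<Longrightarrow> B \<in> clopens \<Longrightarrow> A \<inter> B = {} \<Longrightarrow> f (A \<union> B) = f A + f B"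
    and total: "f (topspace T) = (1::real)"
  obtains N where "N \<in> prob_measures T" "\<And>C. C \<in> clopens \<Longrightarrow> measure N C = f C"
proof -
  interpret algebra "topspace T" clopens by (rule algebra_clopens)
  have f0: "f {} = 0" using add[of "{}" "{}"] by simp
  have "\<exists>\<mu>. (\<forall>s\<in>clopens. \<mu> s = ennreal (f s)) \<and>
      measure_space (topspace T) (sigma_sets (topspace T) clopens) \<mu>"
  proof (rule caratheodory_empty_continuous)
    show "positive clopens (\<lambda>x. ennreal (f x))" by (simp add: positive_def f0)
    show "additive clopens (\<lambda>x. ennreal (f x))"
      by (auto simp: additive_def add nonneg ennreal_plus)
    fix A :: "nat \<Rightarrow> 'm set"
    assume A: "range A \<subseteq> clopens" "decseq A" "(\<Inter>i. A i) = {}"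
    have "\<exists>n. A n = {}"
    proof (rule ccontr)
      assume "\<nexists>n. A n = {}"
      then have "(\<Inter>n. A n) \<noteq> {}"
        using A(1) compact_space_imp_nest[OF compact, of A] A(2) by (auto simp: clopens_def)
      with A(3) show False by simp
    qed
    then obtain n where "A n = {}" ..
    then have "A i = {}" if "n \<le> i" for i
      using A(2) that by (metis decseq_def subset_empty)
    then have "\<forall>\<^sub>F i in sequentially. A i = {}"
      by (auto simp: eventually_sequentially)
    then show "(\<lambda>i. ennreal (f (A i))) \<longlonglongrightarrow> 0"
      by (rule tendsto_eventually[OF eventually_mono]) (simp add: f0)
  qed auto
  then obtain \<mu> where \<mu>: "\<And>s. s \<in> clopens \<Longrightarrow> \<mu> s = ennreal (f s)"
    "measure_space (topspace T) (sigma_sets (topspace T) clopens) \<mu>" by blast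
  define N where "N = measure_of (topspace T) clopens \<mu>"
  have s: "sets N = sets (borel_on T)"
    by (simp add: N_def sets_borel sets_measure_of space_closed)
  have eN: "emeasure N C = ennreal (f C)" if "C \<in> clopens" for C
    using \<mu> that by (subst emeasure_measure_of[OF N_def])
      (auto simp: measure_space_def space_closed s sets_borel intro: sigma_sets.Basic)
  have "space N = topspace T" using sets_eq_imp_space_eq[OF s] by simp
  then have "prob_space N" using eN[of "topspace T"] total by (intro prob_spaceI) auto
  moreover have "measure N C = f C" if "C \<in> clopens" for C
    using eN[OF that] nonneg[OF that] by (simp add: measure_def)
  ultimately show ?thesis using that prob_measuresI s by blast
qed

section \<open>Translates and existence of a stationary measure\<close>

lemma vimage_clopens:
  "continuous_map T T h \<Longrightarrow> C \<in> clopens \<Longrightarrow> {x \<in> topspace T. h x \<in> C} \<in> clopens"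
  by (auto simp: clopens_def openin_continuous_map_preimage closedin_continuous_map_preimage)

lemma continuous_measurable:
  assumes "continuous_map T T h"
  shows "h \<in> measurable (borel_on T) (borel_on T)"
proof -
  have "h \<in> measurable (borel_on T) (sigma (topspace T) {U. openin T U})"
  proof (rule measurable_measure_of)
    show "{U. openin T U} \<subseteq> Pow (topspace T)" by (rule open_Pow)
    show "h \<in> space (borel_on T) \<rightarrow> topspace T"
      using assms continuous_map_image_subset_topspace by fastforce
    fix U assume "U \<in> {U. openin T U}"
    moreover have "h -` U \<inter> space (borel_on T) = {x \<in> topspace T. h x \<in> U}" by auto
    ultimately show "h -` U \<inter> space (borel_on T) \<in> sets (borel_on T)"
      using assms by (auto intro!: openin_sets openin_continuous_map_preimage)
  qed
  then show ?thesis by (simp add: borel_on_def)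
qed

lemma translate_prob_measures:
  assumes "continuous_map T T (act g)" "\<nu> \<in> prob_measures T"
  shows "translate T act g \<nu> \<in> prob_measures T"
    and "E \<in> sets (borel_on T) \<Longrightarrow>
      measure (translate T act g \<nu>) E = measure \<nu> {x \<in> topspace T. act g x \<in> E}"
proof -
  note \<nu> = prob_measuresD[OF assms(2)]
  have m: "act g \<in> measurable \<nu> (borel_on T)"
    using continuous_measurable[OF assms(1)] \<nu>(2) measurable_cong_sets by blast
  show "translate T act g \<nu> \<in> prob_measures T"
    unfolding translate_def using prob_space.prob_space_distr[OF \<nu>(1) m]
    by (intro prob_measuresI) auto
  show "measure (translate T act g \<nu>) E = measure \<nu> {x \<in> topspace T. act g x \<in> E}"
    if "E \<in> sets (borel_on T)"
    unfolding translate_def using m that \<nu>(3)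
    by (subst measure_distr) (auto intro!: arg_cong[where f = "measure \<nu>"])
qed


text \<open>Krylov-Bogoliubov: a limit point of the Cesaro means of the iterates of a point mass is
  fixed. The argument runs on contents of clopen sets, so that compactness of a countable product of
  intervals replaces weak* compactness.\<close>

lemma stationary_exists:
  fixes \<mu> :: "'g pmf"
  assumes cont: "\<And>g. g \<in> set_pmf \<mu> \<Longrightarrow> continuous_map T T (act g)" and "topspace T \<noteq> {}"
  obtains \<nu> where "\<nu> \<in> prob_measures T"
    "\<And>E. E \<in> sets (borel_on T) \<Longrightarrow>
      measure_pmf.expectation \<mu> (\<lambda>g. measure (translate T act g \<nu>) E) = measure \<nu> E"
proof -
  interpret algebra "topspace T" clopens by (rule algebra_clopens)
  obtain w where w: "w \<in> topspace T" using assms(2) by blast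
  \<comment> \<open>Continuity is given on the support only; the identity elsewhere makes every map
    continuous without changing expectations.\<close>
  define act' where "act' g = (if g \<in> set_pmf \<mu> then act g else (\<lambda>x. x))" for g
  have cont': "continuous_map T T (act' g)" for g
    using cont by (simp add: act'_def)
  define pb where "pb g C = {x \<in> topspace T. act' g x \<in> C}" for g C
  have pb: "pb g C \<in> clopens" if "C \<in> clopens" for g C
    unfolding pb_def using vimage_clopens[OF cont' that] .
  have pb_Un: "pb g (A \<union> B) = pb g A \<union> pb g B" and pb_Int: "pb g A \<inter> pb g B = pb g (A \<inter> B)"
    and pb_empty: "pb g {} = {}" for g A B
    by (auto simp: pb_def)
  have pb_top: "pb g (topspace T) = topspace T" for g
    using cont'[of g] continuous_map_image_subset_topspace by (fastforce simp: pb_def)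
  \<comment> \<open>\<open>q n\<close> is the \<open>n\<close>-fold convolution power of
    \<open>\<mu>\<close> applied to the point mass at \<open>w\<close>, evaluated on sets.\<close>
  define q where "q n = ((\<lambda>q C. measure_pmf.expectation \<mu> (\<lambda>g. q (pb g C))) ^^ n) (\<lambda>C. of_bool (w \<in> C) :: real)"
    for n
  have q0: "q 0 C = of_bool (w \<in> C)" and qS: "q (Suc n) C = measure_pmf.expectation \<mu> (\<lambda>g. q n (pb g C))" for n C
    by (simp_all add: q_def)
  have int: "integrable (measure_pmf \<mu>) h" if "\<And>g. 0 \<le> h g \<and> h g \<le> (1::real)" for h
    using that by (intro measure_pmf.integrable_const_bound[where B = 1]) (auto simp: abs_le_iff intro: order_trans)
  have q01: "0 \<le> q n C \<and> q n C \<le> 1" for n C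
  proof (induction n arbitrary: C)
    case (Suc n)
    have "measure_pmf.expectation \<mu> (\<lambda>g. q n (pb g C)) \<le> measure_pmf.expectation \<mu> (\<lambda>g. 1)"
      using Suc int by (intro integral_mono) auto
    then show ?case using Suc by (simp add: qS)
  qed (simp add: q0)
  have q_add: "q n (A \<union> B) = q n A + q n B" if "A \<in> clopens" "B \<in> clopens" "A \<inter> B = {}" for n A B
    using that
  proof (induction n arbitrary: A B)
    case (Suc n)
    have "q n (pb g (A \<union> B)) = q n (pb g A) + q n (pb g B)" for g
      unfolding pb_Un using Suc.prems by (intro Suc.IH pb) (simp_all add: pb_Int pb_empty)
    then show ?case
      using q01 int by (simp add: qS)
  qed (auto simp: q0)
  have q_top: "q n (topspace T) = 1" for n
    by (induction n) (auto simp: q0 qS pb_top w)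
  define m where "m n C = (\<Sum>k<Suc n. q k C) / Suc n" for n C
  have m01: "0 \<le> m n C \<and> m n C \<le> 1" for n C
  proof -
    have "(\<Sum>k<Suc n. q k C) \<le> (\<Sum>k<Suc n. 1)"
      using q01 by (intro sum_mono) auto
    moreover have "0 \<le> (\<Sum>k<Suc n. q k C)"
      using q01 by (intro sum_nonneg) auto
    ultimately show ?thesis
      by (simp add: m_def del: sum.lessThan_Suc)
  qed
  define c where "c = from_nat_into clopens"
  have cl: "countable clopens" "clopens \<noteq> {}"
    using countable_clopen empty_sets by (auto simp: clopens_def)
  have c: "c (to_nat_on clopens C) = C" if "C \<in> clopens" for C
    using that cl by (simp add: c_def)
  \<comment> \<open>Enumerated along \<open>c\<close>, each mean is a point of a countable product
    of unit intervals, and a subsequence converges on all clopen sets at once.\<close>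
  have "compact (PiE UNIV (\<lambda>_. {0..1::real}) :: (nat \<Rightarrow> real) set)"
    using compactin_PiE[of "\<lambda>_. euclideanreal" UNIV "\<lambda>_. {0..1::real}"]
    by (simp add: euclidean_product_topology)
  then have "seq_compact (PiE UNIV (\<lambda>_. {0..1::real}) :: (nat \<Rightarrow> real) set)"
    by (rule compact_imp_seq_compact)
  moreover have "\<forall>n. (\<lambda>k. m n (c k)) \<in> PiE UNIV (\<lambda>_. {0..1::real})"
    using m01 by auto
  ultimately obtain l r where l: "strict_mono (r :: nat \<Rightarrow> nat)" "((\<lambda>n. (\<lambda>k. m n (c k))) \<circ> r) \<longlonglongrightarrow> l"
    by (rule seq_compactE)
  define f where "f C = l (to_nat_on clopens C)" for C
  have f: "(\<lambda>n. m (r n) C) \<longlonglongrightarrow> f C" if "C \<in> clopens" for C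
  proof -
    have "(\<lambda>n. ((\<lambda>n. (\<lambda>k. m n (c k))) \<circ> r) n (to_nat_on clopens C)) \<longlonglongrightarrow> f C"
      unfolding f_def by (rule isCont_tendsto_compose[OF _ l(2)])
        (simp add: continuous_on_product_coordinates[THEN continuous_on_eq_continuous_at[THEN iffD1, OF open_UNIV], rule_format])
    then show ?thesis using c[OF that] by simp
  qed
  obtain N where N: "N \<in> prob_measures T" "\<And>C. C \<in> clopens \<Longrightarrow> measure N C = f C"
  proof (rule measure_extending_content[of f])
    show "0 \<le> f C" if "C \<in> clopens" for C
      using f[OF that] by (rule LIMSEQ_le_const) (use m01 in auto)
    show "f (A \<union> B) = f A + f B" if "A \<in> clopens" "B \<in> clopens" "A \<inter> B = {}" for A B
    proof (rule LIMSEQ_unique)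
      show "(\<lambda>n. m (r n) (A \<union> B)) \<longlonglongrightarrow> f (A \<union> B)" using that by (intro f) auto
      have "m n (A \<union> B) = m n A + m n B" for n
        using q_add[OF that] by (simp add: m_def sum.distrib add_divide_distrib)
      then show "(\<lambda>n. m (r n) (A \<union> B)) \<longlonglongrightarrow> f A + f B"
        using that by (simp add: tendsto_add f)
    qed
    have "m n (topspace T) = 1" for n
      by (simp add: m_def q_top)
    then show "f (topspace T) = 1"
      using f[OF top] by (simp add: LIMSEQ_const_iff)
  qed blast
  have inv: "measure_pmf.expectation \<mu> (\<lambda>g. f (pb g C)) = f C" if C: "C \<in> clopens" for C
  proof (rule LIMSEQ_unique)
    show "(\<lambda>n. measure_pmf.expectation \<mu> (\<lambda>g. m (r n) (pb g C))) \<longlonglongrightarrow>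
        measure_pmf.expectation \<mu> (\<lambda>g. f (pb g C))"
      by (rule integral_dominated_convergence[where w = "\<lambda>_. 1"]) (use m01 f pb C in auto)
    \<comment> \<open>Averaging shifts the index of each summand by one, so only the two extreme
      terms survive, divided by the number of summands.\<close>
    have e: "measure_pmf.expectation \<mu> (\<lambda>g. m n (pb g C)) = m n C + (q (Suc n) C - q 0 C) / Suc n" for n
    proof -
      have "measure_pmf.expectation \<mu> (\<lambda>g. m n (pb g C)) = (\<Sum>k<Suc n. q (Suc k) C) / Suc n"
        using q01 int by (simp add: m_def qS)
      also have "(\<Sum>k<Suc n. q (Suc k) C) = (\<Sum>k<Suc n. q k C) + (q (Suc n) C - q 0 C)"
        using sum_lessThan_telescope[of "\<lambda>k. q k C" "Suc n"] by (simp add: sum_subtractf)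
      finally show ?thesis by (simp add: m_def add_divide_distrib)
    qed
    have "(\<lambda>n. (q (Suc n) C - q 0 C) / Suc n) \<longlonglongrightarrow> 0"
    proof (rule tendsto_rabs_zero_cancel, rule tendsto_sandwich[OF _ _ tendsto_const])
      have "\<bar>q (Suc n) C - q 0 C\<bar> \<le> 1" for n
        using q01[of "Suc n" C] q01[of 0 C] by linarith
      then show "\<forall>\<^sub>F n in sequentially. \<bar>(q (Suc n) C - q 0 C) / Suc n\<bar> \<le> 1 / Suc n"
        by (intro always_eventually allI) (simp add: abs_divide divide_right_mono del: of_nat_Suc)
      show "(\<lambda>n. 1 / real (Suc n)) \<longlonglongrightarrow> 0" by (rule LIMSEQ_Suc[OF lim_1_over_n])
    qed auto
    from tendsto_add[OF f[OF C] LIMSEQ_subseq_LIMSEQ[OF this l(1)]]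
    show "(\<lambda>n. measure_pmf.expectation \<mu> (\<lambda>g. m (r n) (pb g C))) \<longlonglongrightarrow> f C"
      by (simp add: e comp_def)
  qed
  have tr: "translate T act' g N \<in> prob_measures T" "E \<in> sets (borel_on T) \<Longrightarrow> measure (translate T act' g N) E = measure N (pb g E)" for g E
    using translate_prob_measures[of act' g N] cont' N(1) by (auto simp: pb_def)
  obtain N' where N': "N' \<in> prob_measures T"
    "\<And>E. E \<in> sets (borel_on T) \<Longrightarrow> measure N' E = measure_pmf.expectation \<mu> (\<lambda>g. measure (translate T act' g N) E)"
    using mixture[of "\<lambda>g. translate T act' g N" \<mu>] tr(1) by metis
  \<comment> \<open>Invariance is known on clopen sets; realising the averaged translates as a
    measure \<open>N'\<close> extends it to Borel sets.\<close>
  have "N' = N"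
  proof (rule borel_measure_eqI)
    show "emeasure N' C = emeasure N C" if "C \<in> clopens" for C
    proof -
      have "measure N' C = measure N C"
        using that pb clopens_sets[OF that] by (simp add: N' tr N inv)
      then show ?thesis
        using prob_measuresD(1)[OF N'(1)] prob_measuresD(1)[OF N(1)]
        by (simp add: finite_measure.emeasure_eq_measure[OF prob_space.finite_measure])
    qed
  qed (use prob_measuresD[OF N'(1)] prob_measuresD[OF N(1)] prob_space.finite_measure in blast)+
  have "measure_pmf.expectation \<mu> (\<lambda>g. measure (translate T act g N) E) = measure N E"
    if "E \<in> sets (borel_on T)" for E
  proof -
    have "measure_pmf.expectation \<mu> (\<lambda>g. measure (translate T act g N) E)
        = measure_pmf.expectation \<mu> (\<lambda>g. measure (translate T act' g N) E)"
      by (intro integral_cong_AE) (auto simp: AE_measure_pmf_iff translate_def act'_def)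
    then show ?thesis using N'(2)[OF that] \<open>N' = N\<close> by simp
  qed
  with N(1) show ?thesis using that by blast
qed

end

section \<open>Bounded harmonic functions along random walks\<close>

text \<open>The chain is driven by an i.i.d. stream: prepending a letter to the stream is a first
  step of the walk, and the probability estimates below are inductions over this first step.\<close>

locale random_maps =
  fixes p :: "nat pmf" and step :: "'s \<Rightarrow> nat \<Rightarrow> 's"
begin

definition \<Omega> :: "nat stream measure" where "\<Omega> = stream_space (measure_pmf p)"

definition walk :: "'s \<Rightarrow> nat stream \<Rightarrow> nat \<Rightarrow> 's" where
  "walk g \<omega> n = foldl step g (stake n \<omega>)"

definition Pop :: "('s \<Rightarrow> real) \<Rightarrow> 's \<Rightarrow> real" where
  "Pop h g = measure_pmf.expectation p (\<lambda>k. h (step g k))"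

lemma walk_0 [simp]: "walk g \<omega> 0 = g"
  and walk_Stream [simp]: "walk g (x ## \<omega>) (Suc n) = walk (step g x) \<omega> n"
  by (simp_all add: walk_def)

lemma walk_Suc: "walk g \<omega> (Suc n) = step (walk g \<omega> n) (\<omega> !! n)"
  by (simp add: walk_def stake_Suc del: stake.simps)

sublocale prob_space \<Omega>
  unfolding \<Omega>_def by (rule prob_space.prob_space_stream_space[OF measure_pmf.prob_space_axioms])

lemma sets_\<Omega>: "sets \<Omega> = sets (stream_space (count_space UNIV))"
  unfolding \<Omega>_def by (rule sets_stream_space_cong) simp

lemma space_\<Omega> [simp]: "space \<Omega> = UNIV"
  by (simp add: \<Omega>_def space_stream_space)

lemma measurable_stake_\<Omega> [measurable]: "stake n \<in> measurable \<Omega> (count_space UNIV)"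
  using measurable_stake measurable_cong_sets[OF sets_\<Omega> refl] by blast

lemma measurable_walk [measurable]: "(\<lambda>\<omega>. walk g \<omega> n) \<in> measurable \<Omega> (count_space UNIV)"
  unfolding walk_def by (rule measurable_compose[OF measurable_stake_\<Omega>]) simp

lemma measurable_real_walk [measurable]: "(\<lambda>\<omega>. h (walk g \<omega> n) :: real) \<in> borel_measurable \<Omega>"
  by (rule measurable_compose[OF measurable_walk]) simp

lemma Collect_sets: "Measurable.pred \<Omega> Q \<Longrightarrow> {\<omega>. Q \<omega>} \<in> sets \<Omega>"
  by (simp add: pred_def)

lemma emeasure_first_step:
  assumes "A \<in> sets \<Omega>"
  shows "emeasure \<Omega> A = (\<integral>\<^sup>+x. emeasure \<Omega> {\<omega>. x ## \<omega> \<in> A} \<partial>measure_pmf p)"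
  using prob_space.emeasure_stream_space[OF measure_pmf.prob_space_axioms, of A p] assms
  by (simp add: \<Omega>_def space_stream_space)

lemma integrable_bounded: "(\<And>k. \<bar>h k\<bar> \<le> (B::real)) \<Longrightarrow> integrable (measure_pmf p) h"
  by (rule measure_pmf.integrable_const_bound[where B = B]) auto

section \<open>The Markov operator and its iterates\<close>

lemma Pop_bounded: "(\<And>x. \<bar>h x\<bar> \<le> B) \<Longrightarrow> \<bar>Pop h g\<bar> \<le> B"
proof -
  assume h: "\<And>x. \<bar>h x\<bar> \<le> B"
  then have i: "integrable (measure_pmf p) (\<lambda>k. h (step g k))"
    by (intro integrable_bounded)
  have "\<bar>Pop h g\<bar> \<le> measure_pmf.expectation p (\<lambda>k. \<bar>h (step g k)\<bar>)"
    unfolding Pop_def by (rule integral_abs_bound)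
  also have "\<dots> \<le> measure_pmf.expectation p (\<lambda>k. B)"
    using i h by (intro integral_mono) auto
  finally show ?thesis by simp
qed

lemma PopN_bounded: "(\<And>x. \<bar>h x\<bar> \<le> B) \<Longrightarrow> \<bar>(Pop ^^ n) h g\<bar> \<le> B"
  by (induction n arbitrary: g) (auto intro: Pop_bounded)

lemma Pop_mono:
  assumes "\<And>x. \<bar>h x\<bar> \<le> B" "\<And>x. \<bar>k x\<bar> \<le> C" "\<And>x. h x \<le> k x"
  shows "Pop h g \<le> Pop k g"
  unfolding Pop_def using assms by (intro integral_mono integrable_bounded) auto

lemma PopN_mono:
  assumes "\<And>x. \<bar>h x\<bar> \<le> B" "\<And>x. \<bar>k x\<bar> \<le> C" "\<And>x. h x \<le> k x"
  shows "(Pop ^^ n) h g \<le> (Pop ^^ n) k g"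
proof (induction n arbitrary: g)
  case (Suc n)
  show ?case using Pop_mono[OF PopN_bounded[OF assms(1)] PopN_bounded[OF assms(2)] Suc] by simp
qed (simp add: assms)

lemma Pop_affine:
  assumes "\<And>x. \<bar>h x\<bar> \<le> B" "\<And>x. \<bar>k x\<bar> \<le> C"
  shows "Pop (\<lambda>x. a * h x + b * k x + c) g = a * Pop h g + b * Pop k g + c"
proof -
  have [simp]: "integrable (measure_pmf p) (\<lambda>x. h (step g x))" "integrable (measure_pmf p) (\<lambda>x. k (step g x))"
    using assms by (auto intro: integrable_bounded)
  show ?thesis by (simp add: Pop_def)
qed

lemma PopN_affine:
  assumes "\<And>x. \<bar>h x\<bar> \<le> B" "\<And>x. \<bar>k x\<bar> \<le> C"
  shows "(Pop ^^ n) (\<lambda>x. a * h x + b * k x + c) g = a * (Pop ^^ n) h g + b * (Pop ^^ n) k g + c"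
proof (induction n arbitrary: g)
  case (Suc n)
  have "(Pop ^^ n) (\<lambda>x. a * h x + b * k x + c) = (\<lambda>g. a * (Pop ^^ n) h g + b * (Pop ^^ n) k g + c)"
    using Suc by (rule ext)
  then show ?case
    using Pop_affine[OF PopN_bounded[OF assms(1)] PopN_bounded[OF assms(2)]] by simp
qed simp

lemma nn_integral_Pop:
  assumes "\<And>x. 0 \<le> h x" "\<And>x. h x \<le> B"
  shows "(\<integral>\<^sup>+k. ennreal (h (step g k)) \<partial>measure_pmf p) = ennreal (Pop h g)"
  unfolding Pop_def using assms
  by (intro nn_integral_eq_integral integrable_bounded[where B = B]) auto

lemma PopN_nonneg:
  assumes "\<And>x. 0 \<le> h x" "\<And>x. h x \<le> B"
  shows "0 \<le> (Pop ^^ n) h g"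
proof (induction n arbitrary: g)
  case (Suc n)
  then show ?case by (simp add: Pop_def integral_nonneg_AE)
qed (simp add: assms)

lemma nn_integral_walk:
  assumes h: "\<And>x. 0 \<le> h x" "\<And>x. h x \<le> B"
  shows "(\<integral>\<^sup>+\<omega>. ennreal (h (walk g \<omega> n)) \<partial>\<Omega>) = ennreal ((Pop ^^ n) h g)"
proof (induction n arbitrary: g)
  case 0
  then show ?case by (simp add: emeasure_space_1[simplified])
next
  case (Suc n)
  have b: "\<bar>h x\<bar> \<le> B" for x using h by simp
  have m: "(\<lambda>\<omega>. ennreal (h (walk g \<omega> (Suc n)))) \<in> borel_measurable \<Omega>"
    by (rule measurable_compose[OF measurable_walk]) simp
  have "(\<integral>\<^sup>+\<omega>. ennreal (h (walk g \<omega> (Suc n))) \<partial>\<Omega>)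
      = (\<integral>\<^sup>+x. (\<integral>\<^sup>+\<omega>. ennreal (h (walk (step g x) \<omega> n)) \<partial>\<Omega>) \<partial>measure_pmf p)"
    using prob_space.nn_integral_stream_space[OF measure_pmf.prob_space_axioms, OF m[unfolded \<Omega>_def]] by (simp add: \<Omega>_def)
  also have "\<dots> = (\<integral>\<^sup>+x. ennreal ((Pop ^^ n) h (step g x)) \<partial>measure_pmf p)"
    by (simp add: Suc)
  also have "\<dots> = ennreal (Pop ((Pop ^^ n) h) g)"
    using PopN_nonneg[OF h] PopN_bounded[of h B, OF b]
    by (intro nn_integral_Pop[where B = B]) (auto intro: order_trans[OF abs_ge_self])
  finally show ?case by simp
qed

lemma expectation_walk:
  assumes h: "\<And>x. 0 \<le> h x" "\<And>x. h x \<le> B"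
  shows "expectation (\<lambda>\<omega>. h (walk g \<omega> n)) = (Pop ^^ n) h g"
proof -
  have "(\<lambda>\<omega>. h (walk g \<omega> n)) \<in> borel_measurable \<Omega>"
    by (rule measurable_compose[OF measurable_walk]) simp
  then have "expectation (\<lambda>\<omega>. h (walk g \<omega> n)) = enn2real (ennreal ((Pop ^^ n) h g))"
    using h nn_integral_walk[of h B, OF h] by (subst integral_eq_nn_integral) auto
  then show ?thesis using PopN_nonneg[OF h] by simp
qed

section \<open>Variance, maximal inequality and convergence for a bounded harmonic function\<close>

context
  fixes f :: "'s \<Rightarrow> real" and B :: real
  assumes bounded_f: "\<And>x. \<bar>f x\<bar> \<le> B" and harmonic: "\<And>x. Pop f x = f x"
begin

lemma bounded_sq: "\<bar>(f x)\<^sup>2\<bar> \<le> B\<^sup>2"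
  using bounded_f[of x] abs_le_square_iff[of "f x" B] by simp

lemma PopN_harmonic: "(Pop ^^ n) f g = f g"
proof (induction n arbitrary: g)
  case (Suc n)
  then have "(Pop ^^ n) f = f" by (rule ext)
  then show ?case by (simp add: harmonic)
qed simp

text \<open>Harmonicity evaluates the cross term, as \<open>f\<close> still has mean
  \<open>f g\<close> after \<open>n\<close> steps. For \<open>c = f g\<close> this is the variance
  after \<open>n\<close> steps.\<close>

lemma PopN_variance:
  "(Pop ^^ n) (\<lambda>x. (f x - c)\<^sup>2) g = (Pop ^^ n) (\<lambda>x. (f x)\<^sup>2) g - 2 * c * f g + c\<^sup>2"
proof -
  have "(\<lambda>x. (f x - c)\<^sup>2) = (\<lambda>x. 1 * (f x)\<^sup>2 + (- 2 * c) * f x + c\<^sup>2)"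
    by (auto simp: power2_eq_square algebra_simps)
  then show ?thesis
    using PopN_affine[OF bounded_sq bounded_f, where n = n and a = 1 and b = "- 2 * c" and c = "c\<^sup>2" and g = g] by (simp add: PopN_harmonic)
qed

lemma bounded_variance: "(f x - c)\<^sup>2 \<le> (B + \<bar>c\<bar>)\<^sup>2"
  using bounded_f[of x] abs_le_square_iff[of "f x - c" "B + \<bar>c\<bar>"] by linarith

text \<open>Nonnegativity of the variance.\<close>

lemma PopN_sq_mono: "(f g)\<^sup>2 \<le> (Pop ^^ n) (\<lambda>x. (f x)\<^sup>2) g"
  using PopN_nonneg[of "\<lambda>x. (f x - f g)\<^sup>2" "(B + \<bar>f g\<bar>)\<^sup>2" n g] bounded_variance
  unfolding PopN_variance by (simp add: power2_eq_square)

text \<open>Kolmogorov's inequality by conditioning on the first step. A start at distance at least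
  \<open>e\<close> from \<open>c\<close> makes the right side at least 1; from any other start the
  event concerns only the walk after its first step. The centre \<open>c\<close> is kept independent
  of the start, which moves in the induction.\<close>

lemma maximal_inequality:
  assumes "0 < e"
  shows "emeasure \<Omega> {\<omega>. \<exists>i\<le>n. e \<le> \<bar>f (walk g \<omega> i) - c\<bar>}
    \<le> ennreal ((Pop ^^ n) (\<lambda>x. (f x - c)\<^sup>2) g / e\<^sup>2)"
proof (induction n arbitrary: g)
  case 0
  have "1 \<le> (f g - c)\<^sup>2 / e\<^sup>2" if "e \<le> \<bar>f g - c\<bar>"
    using that assms abs_le_square_iff[of e "f g - c"] by simp
  then show ?case
    using emeasure_space_1 by (cases "e \<le> \<bar>f g - c\<bar>") (auto simp: ennreal_ge_1)
next
  case (Suc n)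
  let ?v = "\<lambda>n g. (Pop ^^ n) (\<lambda>x. (f x - c)\<^sup>2) g / e\<^sup>2"
  let ?A = "{\<omega>. \<exists>i\<le>Suc n. e \<le> \<bar>f (walk g \<omega> i) - c\<bar>}"
  show ?case
  proof (cases "e \<le> \<bar>f g - c\<bar>")
    case True
    have "1 \<le> (f g - c)\<^sup>2 / e\<^sup>2"
      using True assms abs_le_square_iff[of e "f g - c"] by simp
    also have "\<dots> \<le> ?v (Suc n) g"
      unfolding PopN_variance using PopN_sq_mono[of g "Suc n"]
      by (intro divide_right_mono) (auto simp: power2_diff)
    finally have "1 \<le> ennreal (?v (Suc n) g)"
      by (simp add: ennreal_ge_1 del: funpow.simps)
    then show ?thesis
      using emeasure_le_1 order_trans by blast
  next
    case False
    have A: "?A \<in> sets \<Omega>" by (rule Collect_sets) measurable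
    have b: "0 \<le> ?v n g" "?v n g \<le> (B + \<bar>c\<bar>)\<^sup>2 / e\<^sup>2" for g
      using PopN_nonneg[of "\<lambda>x. (f x - c)\<^sup>2", OF _ bounded_variance]
        PopN_bounded[of "\<lambda>x. (f x - c)\<^sup>2" "(B + \<bar>c\<bar>)\<^sup>2" n g] bounded_variance
      by (auto intro!: divide_right_mono)
    have "{\<omega>. x ## \<omega> \<in> ?A} = {\<omega>. \<exists>i\<le>n. e \<le> \<bar>f (walk (step g x) \<omega> i) - c\<bar>}" for x
      using False
      by (simp only: mem_Collect_eq less_Suc_eq_le[symmetric] Ex_less_Suc2 walk_0 walk_Stream simp_thms)
    then have "emeasure \<Omega> ?A \<le> (\<integral>\<^sup>+x. ennreal (?v n (step g x)) \<partial>measure_pmf p)"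
      unfolding emeasure_first_step[OF A] by (auto intro!: nn_integral_mono Suc)
    also have "\<dots> = ennreal (Pop (?v n) g)"
      using b by (rule nn_integral_Pop)
    also have "Pop (?v n) g = ?v (Suc n) g"
      by (simp add: Pop_def)
    finally show ?thesis .
  qed
qed


text \<open>The square of a harmonic function is subharmonic. Its bounded increasing second moments
  are the budget that limits all oscillation.\<close>

lemma PopN_sq_incseq: "incseq (\<lambda>m. (Pop ^^ m) (\<lambda>x. (f x)\<^sup>2) g)"
proof (rule incseq_SucI)
  fix m
  have "(Pop ^^ m) (\<lambda>x. (f x)\<^sup>2) g \<le> (Pop ^^ m) (Pop (\<lambda>x. (f x)\<^sup>2)) g"
    using PopN_sq_mono[of _ 1] by (intro PopN_mono[OF bounded_sq Pop_bounded[OF bounded_sq]]) simp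
  then show "(Pop ^^ m) (\<lambda>x. (f x)\<^sup>2) g \<le> (Pop ^^ Suc m) (\<lambda>x. (f x)\<^sup>2) g"
    by (simp add: funpow_swap1)
qed

text \<open>The centre is the random position value at time \<open>m\<close>; induction on
  \<open>m\<close> moves the start forward until the centre is the constant \<open>f g\<close> and
  the maximal inequality applies.\<close>

lemma oscillation_bound:
  assumes "0 < e"
  shows "emeasure \<Omega> {\<omega>. \<exists>i\<le>n. e \<le> \<bar>f (walk g \<omega> (m + i)) - f (walk g \<omega> m)\<bar>}
    \<le> ennreal (((Pop ^^ (m + n)) (\<lambda>x. (f x)\<^sup>2) g - (Pop ^^ m) (\<lambda>x. (f x)\<^sup>2) g) / e\<^sup>2)"
proof (induction m arbitrary: g)
  case 0
  show ?case
    using maximal_inequality[OF assms, of n g "f g"] unfolding PopN_variance by (simp add: power2_eq_square)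
next
  case (Suc m)
  let ?v = "\<lambda>m g. ((Pop ^^ (m + n)) (\<lambda>x. (f x)\<^sup>2) g - (Pop ^^ m) (\<lambda>x. (f x)\<^sup>2) g) / e\<^sup>2"
  let ?A = "{\<omega>. \<exists>i\<le>n. e \<le> \<bar>f (walk g \<omega> (Suc m + i)) - f (walk g \<omega> (Suc m))\<bar>}"
  have A: "?A \<in> sets \<Omega>" by (rule Collect_sets) measurable
  have b: "0 \<le> ?v m g" for g
    using incseqD[OF PopN_sq_incseq, of m "m + n" g] by simp
  have b': "?v m g \<le> (B\<^sup>2 + B\<^sup>2) / e\<^sup>2" for g
    using PopN_bounded[of "\<lambda>x. (f x)\<^sup>2" "B\<^sup>2" "m + n" g, OF bounded_sq]
      PopN_bounded[of "\<lambda>x. (f x)\<^sup>2" "B\<^sup>2" m g, OF bounded_sq]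
    by (intro divide_right_mono) auto
  have i: "integrable (measure_pmf p) (\<lambda>k. (Pop ^^ j) (\<lambda>x. (f x)\<^sup>2) (step g k))" for j
    by (intro integrable_bounded[where B = "B\<^sup>2"] PopN_bounded bounded_sq)
  have "{\<omega>. x ## \<omega> \<in> ?A} = {\<omega>. \<exists>i\<le>n. e \<le> \<bar>f (walk (step g x) \<omega> (m + i)) - f (walk (step g x) \<omega> m)\<bar>}" for x
    by simp
  then have "emeasure \<Omega> ?A \<le> (\<integral>\<^sup>+x. ennreal (?v m (step g x)) \<partial>measure_pmf p)"
    unfolding emeasure_first_step[OF A] by (auto intro!: nn_integral_mono Suc)
  also have "\<dots> = ennreal (Pop (?v m) g)"
    using b b' by (rule nn_integral_Pop)
  also have "Pop (?v m) g = ?v (Suc m) g"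
    using i by (simp add: Pop_def)
  finally show ?case .
qed

text \<open>The second moments increase to a limit \<open>L\<close>, so the probability of an
  oscillation by \<open>e\<close> after time \<open>m\<close> is at most
  \<open>(L - ?a m) / e\<^sup>2\<close> and vanishes as \<open>m\<close> grows. Taking
  \<open>e\<close> along reciprocals of integers makes almost every path Cauchy.\<close>

lemma AE_convergent: "AE \<omega> in \<Omega>. convergent (\<lambda>n. f (walk g \<omega> n))"
proof -
  let ?a = "\<lambda>m. (Pop ^^ m) (\<lambda>x. (f x)\<^sup>2) g"
  have "?a m \<le> B\<^sup>2" for m
    using PopN_bounded[of "\<lambda>x. (f x)\<^sup>2" "B\<^sup>2" m g, OF bounded_sq] by simp
  then obtain L where L: "?a \<longlonglongrightarrow> L" "\<And>m. ?a m \<le> L"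
    using incseq_convergent[OF PopN_sq_incseq] by metis
  have small: "AE \<omega> in \<Omega>. \<exists>m. \<forall>i. \<bar>f (walk g \<omega> (m + i)) - f (walk g \<omega> m)\<bar> < e" if e: "0 < e" for e
  proof -
    let ?A = "\<lambda>m n. {\<omega>. \<exists>i\<le>n. e \<le> \<bar>f (walk g \<omega> (m + i)) - f (walk g \<omega> m)\<bar>}"
    have A: "?A m n \<in> sets \<Omega>" for m n by (rule Collect_sets) measurable
    have U: "emeasure \<Omega> (\<Union>n. ?A m n) \<le> ennreal ((L - ?a m) / e\<^sup>2)" for m
    proof -
      have "emeasure \<Omega> (\<Union>n. ?A m n) = (SUP n. emeasure \<Omega> (?A m n))"
        using A by (intro SUP_emeasure_incseq[symmetric]) (auto simp: incseq_def intro: order_trans)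
      also have "\<dots> \<le> ennreal ((L - ?a m) / e\<^sup>2)"
        using L(2) by (intro SUP_least order_trans[OF oscillation_bound[OF e]] ennreal_leI divide_right_mono) auto
      finally show ?thesis .
    qed
    have "(\<lambda>m. ennreal ((L - ?a m) / e\<^sup>2)) \<longlonglongrightarrow> ennreal ((L - L) / e\<^sup>2)"
      by (intro tendsto_ennrealI tendsto_divide tendsto_diff L tendsto_const) (use e in auto)
    then have "emeasure \<Omega> (\<Inter>m. \<Union>n. ?A m n) \<le> ennreal ((L - L) / e\<^sup>2)"
    proof (rule LIMSEQ_le_const)
      show "\<exists>N. \<forall>m\<ge>N. emeasure \<Omega> (\<Inter>m. \<Union>n. ?A m n) \<le> ennreal ((L - ?a m) / e\<^sup>2)"
        using A by (intro exI[of _ 0] allI impI order_trans[OF emeasure_mono U]) auto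
    qed
    then have "(\<Inter>m. \<Union>n. ?A m n) \<in> null_sets \<Omega>"
      using A by (intro null_setsI) auto
    then show ?thesis
      by (rule AE_I') (auto simp: not_less, metis order_refl)
  qed
  have "AE \<omega> in \<Omega>. \<forall>j::nat. \<exists>m. \<forall>i. \<bar>f (walk g \<omega> (m + i)) - f (walk g \<omega> m)\<bar> < inverse (Suc j)"
    by (subst AE_all_countable) (intro allI small, simp)
  then show ?thesis
  proof (rule eventually_mono)
    fix \<omega> assume *: "\<forall>j::nat. \<exists>m. \<forall>i. \<bar>f (walk g \<omega> (m + i)) - f (walk g \<omega> m)\<bar> < inverse (Suc j)"
    have "Cauchy (\<lambda>n. f (walk g \<omega> n))"
    proof (rule metric_CauchyI)
      fix e :: real assume "0 < e"
      then obtain j where j: "inverse (real (Suc j)) < e / 2"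
        using reals_Archimedean[of "e / 2"] by auto
      from * obtain m where m: "\<And>i. \<bar>f (walk g \<omega> (m + i)) - f (walk g \<omega> m)\<bar> < inverse (Suc j)" by blast
      have "dist (f (walk g \<omega> a)) (f (walk g \<omega> b)) < e" if "m \<le> a" "m \<le> b" for a b
        using m[of "a - m"] m[of "b - m"] that j by (simp add: dist_real_def)
      then show "\<exists>M. \<forall>a\<ge>M. \<forall>b\<ge>M. dist (f (walk g \<omega> a)) (f (walk g \<omega> b)) < e" by blast
    qed
    then show "convergent (\<lambda>n. f (walk g \<omega> n))" by (simp add: Cauchy_convergent)
  qed
qed

text \<open>The \<open>k\<close>-step variance seen at time \<open>i\<close> has as expectation the
  difference of the second moments at times \<open>i + k\<close> and \<open>i\<close>. These sum to
  at most \<open>k * B\<^sup>2\<close>, so \<open>y\<close> along the walk has a finite expected sum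
  and is almost surely summable.\<close>

lemma AE_tendsto_0:
  assumes y: "\<And>x. 0 \<le> y x" "\<And>x. y x \<le> C * ((Pop ^^ k) (\<lambda>x. (f x)\<^sup>2) x - (f x)\<^sup>2)" and "0 \<le> C"
  shows "AE \<omega> in \<Omega>. (\<lambda>n. y (walk g \<omega> n)) \<longlonglongrightarrow> 0"
proof -
  let ?a = "\<lambda>m. (Pop ^^ m) (\<lambda>x. (f x)\<^sup>2) g"
  have a: "0 \<le> ?a m" "?a m \<le> B\<^sup>2" for m
    using PopN_bounded[of "\<lambda>x. (f x)\<^sup>2" "B\<^sup>2" m g, OF bounded_sq]
      PopN_nonneg[of "\<lambda>x. (f x)\<^sup>2" "B\<^sup>2" m g] bounded_sq by auto
  have sqk: "\<bar>(Pop ^^ k) (\<lambda>x. (f x)\<^sup>2) x\<bar> \<le> B\<^sup>2" for x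
    by (rule PopN_bounded[OF bounded_sq])
  have yb: "y x \<le> C * B\<^sup>2" for x
  proof -
    have "C * ((Pop ^^ k) (\<lambda>x. (f x)\<^sup>2) x - (f x)\<^sup>2) \<le> C * B\<^sup>2"
      using sqk[of x] \<open>0 \<le> C\<close> by (intro mult_left_mono) (auto simp: abs_le_iff intro: order_trans[of _ "(Pop ^^ k) (\<lambda>x. (f x)\<^sup>2) x"])
    with y(2)[of x] show ?thesis by linarith
  qed
  have yP: "(Pop ^^ i) y g \<le> C * (?a (i + k) - ?a i)" for i
  proof -
    have "(Pop ^^ i) y g \<le> (Pop ^^ i) (\<lambda>x. C * (Pop ^^ k) (\<lambda>x. (f x)\<^sup>2) x + (- C) * (f x)\<^sup>2 + 0) g"
    proof (rule PopN_mono)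
      show "\<bar>y x\<bar> \<le> C * B\<^sup>2" for x using y(1) yb by simp
      show "\<bar>C * (Pop ^^ k) (\<lambda>x. (f x)\<^sup>2) x + (- C) * (f x)\<^sup>2 + 0\<bar> \<le> C * B\<^sup>2 + C * B\<^sup>2" for x
        using mult_left_mono[OF sqk[of x] \<open>0 \<le> C\<close>] mult_left_mono[OF bounded_sq[of x] \<open>0 \<le> C\<close>] \<open>0 \<le> C\<close>
        by (simp add: abs_mult abs_le_iff)
          (smt (verit) abs_le_iff abs_mult abs_of_nonneg zero_le_power2)
      show "y x \<le> C * (Pop ^^ k) (\<lambda>x. (f x)\<^sup>2) x + (- C) * (f x)\<^sup>2 + 0" for x
        using y(2)[of x] by (simp add: algebra_simps)
    qed
    also have "\<dots> = C * (?a (i + k) - ?a i)"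
      using PopN_affine[OF sqk bounded_sq, where n = i and a = C and b = "- C" and c = 0 and g = g]
      by (simp add: funpow_add algebra_simps)
    finally show ?thesis .
  qed
  \<comment> \<open>A gap of \<open>k\<close> splits into \<open>k\<close> gaps of one, each
    telescoping to at most \<open>B\<^sup>2\<close>.\<close>
  have tele: "(\<Sum>i<N. ?a (i + k) - ?a i) \<le> real k * B\<^sup>2" for N
  proof (induction k)
    case (Suc k)
    have "(\<Sum>i<N. ?a (i + Suc k) - ?a i) = (\<Sum>i<N. ?a (Suc i + k) - ?a (i + k)) + (\<Sum>i<N. ?a (i + k) - ?a i)"
      by (simp add: sum.distrib[symmetric] del: funpow.simps)
    also have "(\<Sum>i<N. ?a (Suc i + k) - ?a (i + k)) = ?a (N + k) - ?a k"
      using sum_lessThan_telescope[of "\<lambda>i. ?a (i + k)" N] by (simp del: funpow.simps)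
    finally show ?case using Suc a(1)[of k] a(2)[of "N + k"] by (simp add: algebra_simps del: funpow.simps)
  qed simp
  have Py0: "0 \<le> (Pop ^^ i) y g" for i
    using y(1) yb by (rule PopN_nonneg)
  have "(\<Sum>i<N. (Pop ^^ i) y g) \<le> C * (real k * B\<^sup>2)" for N
  proof -
    have "(\<Sum>i<N. (Pop ^^ i) y g) \<le> (\<Sum>i<N. C * (?a (i + k) - ?a i))"
      by (intro sum_mono yP)
    also have "\<dots> \<le> C * (real k * B\<^sup>2)"
      unfolding sum_distrib_left[symmetric] using tele \<open>0 \<le> C\<close> by (intro mult_left_mono) auto
    finally show ?thesis .
  qed
  then have sm: "summable (\<lambda>i. (Pop ^^ i) y g)"
    using Py0 by (intro bounded_imp_summable[where B = "C * (real k * B\<^sup>2)"]) (simp_all only: lessThan_Suc_atMost[symmetric])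
  have "(\<integral>\<^sup>+\<omega>. (\<Sum>i. ennreal (y (walk g \<omega> i))) \<partial>\<Omega>) = (\<Sum>i. \<integral>\<^sup>+\<omega>. ennreal (y (walk g \<omega> i)) \<partial>\<Omega>)"
    by (rule nn_integral_suminf) measurable
  also have "\<dots> = (\<Sum>i. ennreal ((Pop ^^ i) y g))"
    using nn_integral_walk[of y "C * B\<^sup>2", OF y(1) yb] by simp
  also have "\<dots> = ennreal (\<Sum>i. (Pop ^^ i) y g)"
    by (rule suminf_ennreal2[OF Py0 sm])
  finally have "(\<integral>\<^sup>+\<omega>. (\<Sum>i. ennreal (y (walk g \<omega> i))) \<partial>\<Omega>) \<noteq> \<infinity>" by simp
  then have "AE \<omega> in \<Omega>. (\<Sum>i. ennreal (y (walk g \<omega> i))) \<noteq> \<infinity>"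
    by (intro nn_integral_noteq_infinite) measurable
  then show ?thesis
  proof (rule eventually_mono)
    fix \<omega> assume "(\<Sum>i. ennreal (y (walk g \<omega> i))) \<noteq> \<infinity>"
    then have "summable (\<lambda>i. y (walk g \<omega> i))"
      using y(1) by (intro summable_suminf_not_top) auto
    then show "(\<lambda>n. y (walk g \<omega> n)) \<longlonglongrightarrow> 0" by (rule summable_LIMSEQ_zero)
  qed
qed

end

end

section \<open>The path space of a random walk\<close>

text \<open>Makes the definite description in \<open>markov_measure\<close> determinate. As
  \<open>S\<close> is countable, a finite-dimensional rectangle is a countable disjoint union of
  cylinders fixing all coordinates up to some \<open>n\<close>.\<close>

lemma markov_measure_unique:
  fixes P Q :: "(nat \<Rightarrow> 'g) measure"
  assumes S: "countable S"
    and sets: "sets P = sets (PiM UNIV (\<lambda>_. count_space S))" "sets Q = sets (PiM UNIV (\<lambda>_. count_space S))"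
    and prob: "prob_space P" "prob_space Q"
    and cyl: "\<And>n h. h \<in> {..n} \<rightarrow> S \<Longrightarrow>
      measure P {\<tau> \<in> space P. \<forall>i\<le>n. \<tau> i = h i} = measure Q {\<tau> \<in> space Q. \<forall>i\<le>n. \<tau> i = h i}"
  shows "P = Q"
proof (rule measure_eqI_PiM_infinite[OF sets])
  interpret P: prob_space P by fact
  interpret Q: prob_space Q by fact
  show "finite_measure P" by unfold_locales
  have sp: "space P = UNIV \<rightarrow>\<^sub>E S" "space Q = UNIV \<rightarrow>\<^sub>E S"
    using sets_eq_imp_space_eq[OF sets(1)] sets_eq_imp_space_eq[OF sets(2)] by (auto simp: space_PiM)
  fix A :: "nat \<Rightarrow> 'g set" and J :: "nat set"
  assume J: "finite J" and A: "\<And>i. i \<in> J \<Longrightarrow> A i \<in> sets (count_space S)"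
  obtain n where n: "J \<subseteq> {..n}"
    using finite_nat_iff_bounded_le[of J] J by blast
  let ?C = "\<lambda>h. {\<tau> \<in> UNIV \<rightarrow>\<^sub>E S. \<forall>i\<le>n. \<tau> i = h i}"
  \<comment> \<open>Extensional \<open>h\<close> only: distinct ones differ at an index up to
    \<open>n\<close>, so their cylinders are disjoint.\<close>
  let ?H = "{h \<in> {..n} \<rightarrow>\<^sub>E S. \<forall>j\<in>J. h j \<in> A j}"
  have H: "countable ?H"
    using countable_PiE[of "{..n}" "\<lambda>_. S"] S by (auto intro: countable_subset[rotated])
  have eq: "prod_emb UNIV (\<lambda>_. count_space S) J (Pi\<^sub>E J A) = (\<Union>h\<in>?H. ?C h)"
  proof (intro subset_antisym subsetI)
    fix \<tau> assume "\<tau> \<in> prod_emb UNIV (\<lambda>_. count_space S) J (Pi\<^sub>E J A)"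
    then have t: "\<tau> \<in> UNIV \<rightarrow>\<^sub>E S" "\<And>j. j \<in> J \<Longrightarrow> \<tau> j \<in> A j"
      by (auto simp: prod_emb_def PiE_iff restrict_def split: if_splits)
    have "restrict \<tau> {..n} \<in> ?H" using t n by auto
    moreover have "\<tau> \<in> ?C (restrict \<tau> {..n})" using t by auto
    ultimately show "\<tau> \<in> (\<Union>h\<in>?H. ?C h)" by blast
  next
    fix \<tau> assume "\<tau> \<in> (\<Union>h\<in>?H. ?C h)"
    then show "\<tau> \<in> prod_emb UNIV (\<lambda>_. count_space S) J (Pi\<^sub>E J A)"
      using n by (fastforce simp: prod_emb_def PiE_iff)
  qed
  have mC: "?C h \<in> sets (PiM UNIV (\<lambda>_. count_space S))" if "h \<in> {..n} \<rightarrow> S" for h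
  proof -
    have "?C h = prod_emb UNIV (\<lambda>_. count_space S) {..n} (Pi\<^sub>E {..n} (\<lambda>i. {h i}))"
      using that by (auto simp: prod_emb_def PiE_iff restrict_def fun_eq_iff split: if_splits)
    also have "\<dots> \<in> sets (PiM UNIV (\<lambda>_. count_space S))"
      using that by (intro sets_PiM_I) auto
    finally show ?thesis .
  qed
  have disj: "disjoint_family_on ?C ?H"
  unfolding disjoint_family_on_def
  proof (intro ballI impI)
    fix h h' assume h: "h \<in> ?H" "h' \<in> ?H" "h \<noteq> h'"
    have "\<exists>i\<le>n. h i \<noteq> h' i"
    proof (rule ccontr)
      assume "\<not> (\<exists>i\<le>n. h i \<noteq> h' i)"
      then have "h = h'"
        using h(1,2) by (intro PiE_ext[of h "{..n}" "\<lambda>_. S" h']) auto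
      with h(3) show False by simp
    qed
    then show "?C h \<inter> ?C h' = {}" by force
  qed
  have m: "?C h \<in> sets P" "?C h \<in> sets Q" and e: "emeasure P (?C h) = emeasure Q (?C h)" if "h \<in> ?H" for h
  proof -
    have h: "h \<in> {..n} \<rightarrow> S" using that unfolding PiE_def by blast
    show "?C h \<in> sets P" "?C h \<in> sets Q" unfolding sets by (rule mC[OF h])+
    show "emeasure P (?C h) = emeasure Q (?C h)"
      using cyl[OF h] unfolding sp by (simp add: P.emeasure_eq_measure Q.emeasure_eq_measure)
  qed
  have "emeasure P (\<Union>h\<in>?H. ?C h) = (\<integral>\<^sup>+h. emeasure P (?C h) \<partial>count_space ?H)"
    by (rule emeasure_UN_countable[OF m(1) H disj])
  also have "\<dots> = (\<integral>\<^sup>+h. emeasure Q (?C h) \<partial>count_space ?H)"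
    by (intro nn_integral_cong e) simp
  also have "\<dots> = emeasure Q (\<Union>h\<in>?H. ?C h)"
    by (rule emeasure_UN_countable[OF m(2) H disj, symmetric])
  finally show "emeasure P (prod_emb UNIV (\<lambda>_. count_space S) J (Pi\<^sub>E J A)) =
      emeasure Q (prod_emb UNIV (\<lambda>_. count_space S) J (Pi\<^sub>E J A))"
    unfolding eq .
qed

locale group_walk = group G for G (structure) +
  fixes \<mu> :: "'a pmf"
  assumes countable_G: "countable (carrier G)" and supp: "set_pmf \<mu> \<subseteq> carrier G"
begin

text \<open>Enumerating the group makes the increments range over a countable type, on whose
  streams every function of finitely many coordinates is measurable.\<close>

definition enc :: "nat \<Rightarrow> 'a" where "enc = from_nat_into (carrier G)"

text \<open>Elements outside the carrier are absorbing, so that harmonicity can be demanded at every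
  element of the type.\<close>

definition step :: "'a \<Rightarrow> nat \<Rightarrow> 'a" where
  "step g k = (if g \<in> carrier G then g \<otimes> enc k else g)"

sublocale W: random_maps "map_pmf (to_nat_on (carrier G)) \<mu>" step .

lemma enc_carrier [simp]: "enc k \<in> carrier G"
  unfolding enc_def using from_nat_into[of "carrier G"] one_closed by blast

lemma map_enc: "map_pmf enc (map_pmf (to_nat_on (carrier G)) \<mu>) = \<mu>"
proof -
  have "map_pmf (enc \<circ> to_nat_on (carrier G)) \<mu> = map_pmf (\<lambda>x. x) \<mu>"
    using supp countable_G by (intro map_pmf_cong) (auto simp: enc_def)
  then show ?thesis by (simp add: pmf.map_comp)
qed

lemma Pop_carrier:
  "g \<in> carrier G \<Longrightarrow> W.Pop h g = measure_pmf.expectation \<mu> (\<lambda>x. h (g \<otimes> x))"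
  by (subst (2) map_enc[symmetric]) (simp add: W.Pop_def step_def)

lemma Pop_not_carrier: "g \<notin> carrier G \<Longrightarrow> W.Pop h g = h g"
  by (simp add: W.Pop_def step_def)

lemma walk_carrier: "g \<in> carrier G \<Longrightarrow> W.walk g \<omega> n \<in> carrier G"
  by (induction n) (auto simp: W.walk_Suc step_def)

lemma walk_cylinder:
  "g \<in> carrier G \<Longrightarrow> h \<in> {..n} \<rightarrow> carrier G \<Longrightarrow>
    emeasure W.\<Omega> {\<omega>. \<forall>i\<le>n. W.walk g \<omega> i = h i} =
      ennreal (if h 0 = g then \<Prod>i<n. pmf \<mu> (inv (h i) \<otimes> h (Suc i)) else 0)"
proof (induction n arbitrary: g h)
  case 0
  then show ?case
    using W.emeasure_space_1 by auto
next
  case (Suc n)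
  let ?A = "{\<omega>. \<forall>i\<le>Suc n. W.walk g \<omega> i = h i}"
  let ?c = "\<Prod>i<n. pmf \<mu> (inv (h (Suc i)) \<otimes> h (Suc (Suc i)))"
  let ?p = "map_pmf (to_nat_on (carrier G)) \<mu>"
  have A: "?A \<in> sets W.\<Omega>" by (rule W.Collect_sets) measurable
  have h: "h i \<in> carrier G" if "i \<le> Suc n" for i using Suc.prems(2) that by auto
  show ?case
  proof (cases "h 0 = g")
    case True
    have "{\<omega>. x ## \<omega> \<in> ?A} = {\<omega>. \<forall>i\<le>n. W.walk (step g x) \<omega> i = h (Suc i)}" for x
      using True by (simp only: mem_Collect_eq less_Suc_eq_le[symmetric] All_less_Suc2 W.walk_0 W.walk_Stream simp_thms)
    moreover have "emeasure W.\<Omega> {\<omega>. \<forall>i\<le>n. W.walk (step g x) \<omega> i = h (Suc i)}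
        = ennreal (if h (Suc 0) = step g x then ?c else 0)" for x
      using h Suc.prems(1) by (intro Suc.IH) (auto simp: step_def)
    ultimately have "emeasure W.\<Omega> ?A = (\<integral>\<^sup>+x. ennreal (if h (Suc 0) = step g x then ?c else 0) \<partial>measure_pmf ?p)"
      unfolding W.emeasure_first_step[OF A] by simp
    also have "\<dots> = (\<integral>\<^sup>+x. ennreal ?c * indicator (enc -` {inv g \<otimes> h (Suc 0)}) x \<partial>measure_pmf ?p)"
    proof (intro nn_integral_cong)
      fix x
      have "h (Suc 0) = step g x \<longleftrightarrow> enc x = inv g \<otimes> h (Suc 0)"
        using h[of 1] Suc.prems(1) by (auto simp: step_def m_assoc[symmetric])
      then show "ennreal (if h (Suc 0) = step g x then ?c else 0) =
          ennreal ?c * indicator (enc -` {inv g \<otimes> h (Suc 0)}) x"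
        by simp
    qed
    also have "\<dots> = ennreal ?c * emeasure (measure_pmf ?p) (enc -` {inv g \<otimes> h (Suc 0)})"
      by (rule nn_integral_cmult_indicator) simp
    also have "emeasure (measure_pmf ?p) (enc -` {inv g \<otimes> h (Suc 0)}) = ennreal (pmf \<mu> (inv g \<otimes> h (Suc 0)))"
      by (subst (2) map_enc[symmetric]) (simp only: emeasure_map_pmf[symmetric] emeasure_pmf_single)
    also have "ennreal ?c * ennreal (pmf \<mu> (inv g \<otimes> h (Suc 0))) = ennreal (?c * pmf \<mu> (inv g \<otimes> h (Suc 0)))"
      by (simp add: ennreal_mult prod_nonneg)
    also have "?c * pmf \<mu> (inv g \<otimes> h (Suc 0)) = (\<Prod>i<Suc n. pmf \<mu> (inv (h i) \<otimes> h (Suc i)))"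
      using True by (subst prod.lessThan_Suc_shift) simp
    finally show ?thesis using True by simp
  next
    case False
    then have "?A = {}" by (auto intro: exI[of _ 0])
    show ?thesis unfolding \<open>?A = {}\<close> using False by simp
  qed
qed

lemma measurable_path: "(\<lambda>\<omega> n. W.walk \<one> \<omega> n) \<in> measurable W.\<Omega> (PiM UNIV (\<lambda>_. count_space (carrier G)))"
proof (rule measurable_PiM_single')
  show "(\<lambda>\<omega>. W.walk \<one> \<omega> i) \<in> measurable W.\<Omega> (count_space (carrier G))" for i
    by (rule measurable_count_space_extend[OF subset_UNIV _ W.measurable_walk])
      (use walk_carrier[OF one_closed] in auto)
qed (use walk_carrier[OF one_closed] in auto)

text \<open>Almost sure statements about paths can thereby be proved on streams, where conditioning
  on the first increment is available.\<close>

lemma walk_measure_eq: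
  "walk_measure G \<mu> = distr W.\<Omega> (PiM UNIV (\<lambda>_. count_space (carrier G))) (\<lambda>\<omega> n. W.walk \<one> \<omega> n)"
    (is "_ = ?D")
proof -
  have D: "sets ?D = sets (PiM UNIV (\<lambda>_. count_space (carrier G)))" "prob_space ?D"
    using W.prob_space_distr[OF measurable_path] by auto
  have sp: "space ?D = UNIV \<rightarrow>\<^sub>E carrier G" by (simp add: space_PiM)
  have cyl: "measure ?D {\<tau> \<in> space ?D. \<forall>i\<le>n. \<tau> i = h i} =
      (if h 0 = \<one> then \<Prod>i<n. pmf \<mu> (inv (h i) \<otimes> h (Suc i)) else 0)"
    if h: "h \<in> {..n} \<rightarrow> carrier G" for n h
  proof -
    have "{\<tau> \<in> space ?D. \<forall>i\<le>n. \<tau> i = h i} =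
        prod_emb UNIV (\<lambda>_. count_space (carrier G)) {..n} (Pi\<^sub>E {..n} (\<lambda>i. {h i}))"
      unfolding sp using h by (auto simp: prod_emb_def PiE_iff restrict_def fun_eq_iff split: if_splits)
    also have "\<dots> \<in> sets (PiM UNIV (\<lambda>_. count_space (carrier G)))"
      using h by (intro sets_PiM_I) auto
    finally have "emeasure ?D {\<tau> \<in> space ?D. \<forall>i\<le>n. \<tau> i = h i}
        = emeasure W.\<Omega> ((\<lambda>\<omega> n. W.walk \<one> \<omega> n) -` {\<tau> \<in> space ?D. \<forall>i\<le>n. \<tau> i = h i} \<inter> space W.\<Omega>)"
      using measurable_path by (intro emeasure_distr) auto
    also have "(\<lambda>\<omega> n. W.walk \<one> \<omega> n) -` {\<tau> \<in> space ?D. \<forall>i\<le>n. \<tau> i = h i} \<inter> space W.\<Omega>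
        = {\<omega>. \<forall>i\<le>n. W.walk \<one> \<omega> i = h i}"
      unfolding sp using walk_carrier[OF one_closed] by auto
    finally show ?thesis
      using walk_cylinder[OF one_closed h] by (simp add: measure_def prod_nonneg)
  qed
  show ?thesis
    unfolding walk_measure_def markov_measure_def
  proof (rule the_equality)
    show "sets ?D = sets (PiM UNIV (\<lambda>_. count_space (carrier G))) \<and> prob_space ?D \<and>
      (\<forall>n. \<forall>h\<in>{..n} \<rightarrow> carrier G. measure ?D {\<tau> \<in> space ?D. \<forall>i\<le>n. \<tau> i = h i} =
          (if h 0 = \<one> then \<Prod>i<n. pmf \<mu> (inv (h i) \<otimes> h (Suc i)) else 0))"
      using D cyl by blast
  next
    fix P :: "(nat \<Rightarrow> 'a) measure"
    assume P: "sets P = sets (PiM UNIV (\<lambda>_. count_space (carrier G))) \<and> prob_space P \<and>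
      (\<forall>n. \<forall>h\<in>{..n} \<rightarrow> carrier G. measure P {\<tau> \<in> space P. \<forall>i\<le>n. \<tau> i = h i} =
          (if h 0 = \<one> then \<Prod>i<n. pmf \<mu> (inv (h i) \<otimes> h (Suc i)) else 0))"
    show "P = ?D"
      by (rule markov_measure_unique[OF countable_G]) (use P D cyl in auto)
  qed
qed

lemma AE_walk_measureI:
  assumes "AE \<omega> in W.\<Omega>. Q (W.walk \<one> \<omega>)" "Measurable.pred (PiM UNIV (\<lambda>_. count_space (carrier G))) Q"
  shows "AE \<tau> in walk_measure G \<mu>. Q \<tau>"
  unfolding walk_measure_eq using assms measurable_path
  by (subst AE_distr_iff) (auto simp: pred_def)

end

section \<open>The hyperbolic compactification\<close>

text \<open>The topology reduces to this truncation: for positive \<open>k\<close>, words are closer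
  than \<open>1 / k\<close> exactly when their \<open>k\<close>-truncations agree. A finite word
  shorter than \<open>k\<close> is returned whole, so its end is visible.\<close>

fun pre :: "nat \<Rightarrow> 'l word \<Rightarrow> 'l list" where
  "pre k (Fin u) = take k u"
| "pre k (Inf s) = map s [0..<k]"

lemma take_pre: "j \<le> k \<Longrightarrow> take j (pre k w) = pre j w"
  by (cases w) (auto simp: take_map min_def)

lemma length_pre_le: "length (pre k w) \<le> k"
  by (cases w) auto

lemma pre_eq_mono: "pre k v = pre k w \<Longrightarrow> j \<le> k \<Longrightarrow> pre j v = pre j w"
  by (metis take_pre)

lemma pre_short: "length (pre k v) < k \<Longrightarrow> pre k v = pre k w \<Longrightarrow> v = w"
  by (cases v; cases w) (auto simp: min_def split: if_splits)

lemma is_prefix_iff: "is_prefix u w \<longleftrightarrow> pre (length u) w = u"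
proof (cases w)
  case (Fin v)
  then show ?thesis by simp (metis append_eq_conv_conj append_take_drop_id)
qed auto

lemma pre_separates: "(\<And>k. pre k v = pre k w) \<Longrightarrow> v = w"
proof -
  assume *: "\<And>k. pre k v = pre k w"
  show "v = w"
  proof (cases v; cases w)
    fix s s' assume "v = Inf s" "w = Inf s'"
    moreover have "s n = s' n" if "v = Inf s" "w = Inf s'" for n
      using *[of "Suc n"] that by simp
    ultimately show ?thesis by auto
  next
    fix u u' assume "v = Fin u" "w = Fin u'"
    then show ?thesis using *[of "length u + length u'"] by simp
  next
    fix u s assume "v = Fin u" "w = Inf s"
    then show ?thesis using arg_cong[OF *[of "Suc (length u)"], of length] by simp
  next
    fix u s assume "v = Inf s" "w = Fin u"
    then show ?thesis using arg_cong[OF *[of "Suc (length u)"], of length] by simp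
  qed
qed

text \<open>A truncation common to distinct words has full length, since a shorter one would show
  the end of both. So the lengths of common prefixes are the \<open>k\<close> with equal
  truncations, a finite initial segment of the naturals.\<close>

lemma common_prefix_length_ge:
  assumes "v \<noteq> w"
  shows "k \<le> common_prefix_length v w \<longleftrightarrow> pre k v = pre k w"
proof -
  let ?A = "{k. pre k v = pre k w}"
  have "{length u |u. is_prefix u v \<and> is_prefix u w} = ?A"
  proof (intro subset_antisym subsetI)
    fix k assume "k \<in> ?A"
    then have k: "pre k v = pre k w" by simp
    then have "length (pre k v) = k"
      using pre_short[of k v w] assms length_pre_le[of k v] by linarith
    then show "k \<in> {length u |u. is_prefix u v \<and> is_prefix u w}"
      using k by (intro CollectI exI[of _ "pre k v"]) (simp add: is_prefix_iff)
  qed (auto simp: is_prefix_iff)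
  then have c: "common_prefix_length v w = Max ?A" by (simp add: common_prefix_length_def)
  obtain n where n: "pre n v \<noteq> pre n w" using pre_separates assms by blast
  have "?A \<subseteq> {..n}" using pre_eq_mono[of _ v w n] n by force
  then have fin: "finite ?A" by (rule finite_subset) simp
  have "0 \<in> ?A" by (cases v; cases w) auto
  then have "Max ?A \<in> ?A" using fin Max_in by blast
  show ?thesis
  proof
    assume "k \<le> common_prefix_length v w"
    then show "pre k v = pre k w"
      using pre_eq_mono \<open>Max ?A \<in> ?A\<close> c by auto
  next
    assume "pre k v = pre k w"
    then show "k \<le> common_prefix_length v w"
      using Max_ge[OF fin] c by simp
  qed
qed

lemma word_dist_less: "0 < k \<Longrightarrow> word_dist v w < 1 / real k \<longleftrightarrow> pre k v = pre k w"
  using common_prefix_length_ge[of v w k]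
  by (auto simp: word_dist_def field_simps)

text \<open>The distance is an ultrametric: words agreeing with \<open>y\<close> up to a given
  length agree with each other up to that length.\<close>

lemma word_dist_metric: "Metric_space Z word_dist"
proof
  have sym: "common_prefix_length v w = common_prefix_length w v" for v w :: "'a word"
    by (simp add: common_prefix_length_def conj_commute)
  show "0 \<le> word_dist x y" for x y :: "'a word" by (simp add: word_dist_def)
  show "word_dist x y = word_dist y x" for x y :: "'a word" by (simp add: word_dist_def sym)
  show "word_dist x y = 0 \<longleftrightarrow> x = y" for x y :: "'a word"
    by (auto simp: word_dist_def)
  show "word_dist x z \<le> word_dist x y + word_dist y z" for x y z :: "'a word"
  proof (cases "x = y \<or> y = z \<or> x = z")
    case False
    let ?c = common_prefix_length
    let ?m = "min (?c x y) (?c y z)"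
    have "pre ?m x = pre ?m y" "pre ?m y = pre ?m z"
      using False common_prefix_length_ge by (metis min.cobounded1, metis min.cobounded2)
    then have "?m \<le> ?c x z" using False common_prefix_length_ge by metis
    then have "?c x y \<le> ?c x z \<or> ?c y z \<le> ?c x z" by linarith
    moreover have "1 / (real a + 1) \<le> 1 / (real b + 1)" if "b \<le> a" for a b :: nat
      using that by (intro divide_left_mono) auto
    ultimately have "word_dist x z \<le> word_dist x y \<or> word_dist x z \<le> word_dist y z"
      using False by (auto simp: word_dist_def)
    moreover have "0 \<le> word_dist x y" "0 \<le> word_dist y z" by (simp_all add: word_dist_def)
    ultimately show ?thesis by linarith
  qed (auto simp: word_dist_def)
qed

section \<open>The space of words and its boundary\<close>

definition Words :: "'a set \<Rightarrow> 'a letter word set" where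
  "Words X = Fin ` reduced_words X \<union> Inf ` infinite_reduced_words X"

definition Ends :: "'a set \<Rightarrow> 'a letter word set" where
  "Ends X = Inf ` infinite_reduced_words X"

lemma topspace_hyp_compactification [simp]: "topspace (hyp_compactification X) = Words X"
  by (simp add: hyp_compactification_def Words_def Metric_space.topspace_mtopology[OF word_dist_metric])

lemma Ends_subset: "Ends X \<subseteq> Words X"
  by (auto simp: Ends_def Words_def)

lemma topspace_hyp_boundary [simp]: "topspace (hyp_boundary X) = Ends X"
  using Ends_subset[of X] by (auto simp: hyp_boundary_def Ends_def[symmetric])

lemma openin_hyp_compactification:
  "openin (hyp_compactification X) U \<longleftrightarrow>
    U \<subseteq> Words X \<and> (\<forall>w\<in>U. \<exists>k. \<forall>v\<in>Words X. pre k v = pre k w \<longrightarrow> v \<in> U)"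
proof -
  interpret Metric_space "Words X" word_dist by (rule word_dist_metric)
  have key: "(\<exists>r>0. mball w r \<subseteq> U) \<longleftrightarrow> (\<exists>k. \<forall>v\<in>Words X. pre k v = pre k w \<longrightarrow> v \<in> U)" if "w \<in> Words X" for w
  proof
    assume "\<exists>r>0. mball w r \<subseteq> U"
    then obtain r where r: "0 < r" "mball w r \<subseteq> U" by blast
    then obtain k where k: "1 / real (Suc k) < r"
      using reals_Archimedean[of r] by (auto simp: inverse_eq_divide)
    have "v \<in> U" if "v \<in> Words X" "pre (Suc k) v = pre (Suc k) w" for v
      using that r k \<open>w \<in> Words X\<close> word_dist_less[of "Suc k" w v] by (intro subsetD[OF r(2)]) (auto simp del: pre.simps)
    then show "\<exists>k. \<forall>v\<in>Words X. pre k v = pre k w \<longrightarrow> v \<in> U" by blast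
  next
    assume "\<exists>k. \<forall>v\<in>Words X. pre k v = pre k w \<longrightarrow> v \<in> U"
    then obtain k where k: "\<And>v. v \<in> Words X \<Longrightarrow> pre k v = pre k w \<Longrightarrow> v \<in> U" by blast
    have "mball w (1 / real (Suc k)) \<subseteq> U"
    proof
      fix v assume "v \<in> mball w (1 / real (Suc k))"
      then have "v \<in> Words X" "pre (Suc k) w = pre (Suc k) v"
        using word_dist_less[of "Suc k" w v] by auto
      then show "v \<in> U" using k pre_eq_mono[of "Suc k" v w k] by simp
    qed
    then show "\<exists>r>0. mball w r \<subseteq> U" by (metis of_nat_0_less_iff zero_less_Suc zero_less_divide_1_iff)
  qed
  have "(\<forall>w. w \<in> U \<longrightarrow> (\<exists>r>0. mball w r \<subseteq> U)) \<longleftrightarrow>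
      (\<forall>w\<in>U. \<exists>k. \<forall>v\<in>Words X. pre k v = pre k w \<longrightarrow> v \<in> U)" if "U \<subseteq> Words X"
  proof (intro iffI ballI allI impI)
    fix w assume "\<forall>w. w \<in> U \<longrightarrow> (\<exists>r>0. mball w r \<subseteq> U)" "w \<in> U"
    then show "\<exists>k. \<forall>v\<in>Words X. pre k v = pre k w \<longrightarrow> v \<in> U"
      using key[OF subsetD[OF that \<open>w \<in> U\<close>]] by simp
  next
    fix w assume "\<forall>w\<in>U. \<exists>k. \<forall>v\<in>Words X. pre k v = pre k w \<longrightarrow> v \<in> U" "w \<in> U"
    then show "\<exists>r>0. mball w r \<subseteq> U"
      using key[OF subsetD[OF that \<open>w \<in> U\<close>]] by simp
  qed
  then show ?thesis
    unfolding hyp_compactification_def Words_def[symmetric] openin_mtopology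
    by (rule conj_cong[OF refl])
qed

lemma openin_hyp_boundary:
  "openin (hyp_boundary X) U \<longleftrightarrow>
    U \<subseteq> Ends X \<and> (\<forall>w\<in>U. \<exists>k. \<forall>v\<in>Ends X. pre k v = pre k w \<longrightarrow> v \<in> U)"
    (is "_ \<longleftrightarrow> ?R")
proof
  assume "openin (hyp_boundary X) U"
  then have "\<exists>V. openin (hyp_compactification X) V \<and> U = V \<inter> Ends X"
    unfolding hyp_boundary_def openin_subtopology Ends_def .
  then obtain V where V: "openin (hyp_compactification X) V" "U = V \<inter> Ends X" by blast
  show ?R
  proof (intro conjI ballI)
    fix w assume w: "w \<in> U"
    then obtain k where "\<forall>v\<in>Words X. pre k v = pre k w \<longrightarrow> v \<in> V"
      using V unfolding openin_hyp_compactification by blast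
    then have "\<forall>v\<in>Ends X. pre k v = pre k w \<longrightarrow> v \<in> U"
      using V(2) Ends_subset[of X] by blast
    then show "\<exists>k. \<forall>v\<in>Ends X. pre k v = pre k w \<longrightarrow> v \<in> U" ..
  qed (use V in blast)
next
  assume R: ?R
  then obtain k where k: "\<And>w v. w \<in> U \<Longrightarrow> v \<in> Ends X \<Longrightarrow> pre (k w) v = pre (k w) w \<Longrightarrow> v \<in> U" by metis
  \<comment> \<open>An ambient open set is needed: each point of \<open>U\<close> contributes its
    whole prefix neighbourhood, finite words included.\<close>
  define V where "V = {v \<in> Words X. \<exists>w\<in>U. pre (k w) v = pre (k w) w}"
  have "openin (hyp_compactification X) V"
    unfolding openin_hyp_compactification V_def by auto metis
  moreover have "U = V \<inter> Ends X"
    using R k Ends_subset[of X] by (auto simp: V_def)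
  ultimately show "openin (hyp_boundary X) U"
    unfolding hyp_boundary_def openin_subtopology Ends_def by blast
qed

section \<open>Cylinders and compactness of the boundary\<close>

definition cyl :: "'a set \<Rightarrow> 'a letter list \<Rightarrow> 'a letter word set" where
  "cyl X s = {w \<in> Ends X. pre (length s) w = s}"

lemma pre_Ends: "w \<in> Ends X \<Longrightarrow> pre k w \<in> reduced_words X \<and> length (pre k w) = k"
proof -
  assume "w \<in> Ends X"
  then obtain s where s: "w = Inf s" "range s \<subseteq> X \<times> UNIV" "\<And>n. s (Suc n) \<noteq> inv_letter (s n)"
    by (auto simp: Ends_def infinite_reduced_words_def)
  have "map s [0..<k] \<in> reduced_words X"
    using s(2,3) by (auto simp: reduced_words_def successively_conv_nth)
  then show ?thesis using s by simp
qed

lemma clopen_cyl: "openin (hyp_boundary X) (cyl X s)" "closedin (hyp_boundary X) (cyl X s)"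
  by (auto simp: openin_hyp_boundary closedin_def cyl_def intro!: exI[of _ "length s"])

lemma cyl_Nil [simp]: "cyl X [] = Ends X"
  by (auto simp: cyl_def Ends_def)

lemma mem_cyl_pre: "w \<in> Ends X \<Longrightarrow> w \<in> cyl X (pre k w)"
  using pre_Ends[of w X k] by (simp add: cyl_def)

lemma mem_cyl_iff: "length s = k \<Longrightarrow> w \<in> cyl X s \<longleftrightarrow> w \<in> Ends X \<and> pre k w = s"
  by (auto simp: cyl_def)

lemma openin_hyp_boundary_cyl:
  assumes "openin (hyp_boundary X) U" "x \<in> U"
  obtains k where "cyl X (pre k x) \<subseteq> U" "x \<in> Ends X"
proof -
  have x: "x \<in> Ends X" and "\<exists>k. \<forall>v\<in>Ends X. pre k v = pre k x \<longrightarrow> v \<in> U"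
    using assms unfolding openin_hyp_boundary by (blast, simp)
  then obtain k where k: "\<forall>v\<in>Ends X. pre k v = pre k x \<longrightarrow> v \<in> U" by metis
  have "cyl X (pre k x) \<subseteq> U"
    using k pre_Ends[OF x, of k] unfolding cyl_def by simp blast
  with x show ?thesis using that by blast
qed

lemma cyl_disjoint: "length s = length t \<Longrightarrow> s \<noteq> t \<Longrightarrow> cyl X s \<inter> cyl X t = {}"
  by (auto simp: cyl_def)

lemma cyl_mono: "cyl X (s @ t) \<subseteq> cyl X s"
proof
  fix w assume "w \<in> cyl X (s @ t)"
  then show "w \<in> cyl X s"
    using take_pre[of "length s" "length (s @ t)" w] by (auto simp: cyl_def)
qed

lemma cyl_extend: "cyl X s \<subseteq> (\<Union>l\<in>X \<times> UNIV. cyl X (s @ [l]))"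
proof
  fix w assume w: "w \<in> cyl X s"
  then have E: "w \<in> Ends X" and p: "pre (length s) w = s" by (auto simp: cyl_def)
  let ?t = "pre (Suc (length s)) w"
  have t: "?t \<in> reduced_words X" "length ?t = Suc (length s)" using pre_Ends[OF E] by auto
  have "?t \<noteq> []" using t(2) by auto
  have "butlast ?t = s"
    using t(2) take_pre[of "length s" "Suc (length s)" w] p by (simp add: butlast_conv_take)
  then have "?t = s @ [last ?t]"
    using append_butlast_last_id[OF \<open>?t \<noteq> []\<close>] by simp
  moreover have "last ?t \<in> X \<times> UNIV"
    using t(1) last_in_set[OF \<open>?t \<noteq> []\<close>] by (auto simp: reduced_words_def)
  moreover have "w \<in> cyl X ?t" by (rule mem_cyl_pre[OF E])
  ultimately show "w \<in> (\<Union>l\<in>X \<times> UNIV. cyl X (s @ [l]))" by (metis UN_I)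
qed

text \<open>The boundary as an inverse limit: ends are constructed from coherent prefixes in the
  compactness proof, in the extension of conjugations and as limit points of paths.\<close>

lemma infinite_word_limit:
  assumes "\<And>n. length (f n) = n" "\<And>n. take n (f (Suc n)) = f n" "\<And>n. f n \<in> reduced_words X"
  obtains w where "w \<in> Ends X" "\<And>n. pre n w = f n"
proof -
  define s where "s n = f (Suc n) ! n" for n
  have ms: "map s [0..<n] = f n" for n
  proof (induction n)
    case (Suc n)
    have "f (Suc n) = take n (f (Suc n)) @ [f (Suc n) ! n]"
      using take_Suc_conv_app_nth[of n "f (Suc n)"] assms(1)[of "Suc n"] by simp
    then show ?case using Suc assms(2) by (simp add: s_def)
  qed (use assms(1)[of 0] in simp)
  have "s \<in> infinite_reduced_words X"
    unfolding infinite_reduced_words_def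
  proof (intro CollectI conjI allI)
    have r: "map s [0..<n] \<in> reduced_words X" for n using ms assms(3) by simp
    have "s n \<in> X \<times> UNIV" for n
      using r[of "Suc n"] by (simp add: reduced_words_def)
    then show "range s \<subseteq> X \<times> UNIV" by blast
    fix n
    show "s (Suc n) \<noteq> inv_letter (s n)"
      using r[of "Suc (Suc n)"] reduced_words_append_iff[of "map s [0..<n]" "[s n, s (Suc n)]" X]
      by simp
  qed
  then show ?thesis using that[of "Inf s"] ms by (auto simp: Ends_def)
qed

lemma cyl_nonreduced: "s \<notin> reduced_words X \<Longrightarrow> cyl X s = {}"
  unfolding cyl_def using pre_Ends[of _ X "length s"] by force

text \<open>Konig's lemma. As there are finitely many letters, a cylinder without finite subcover
  has a one-letter extension without one. The end so produced lies in a covering set, which already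
  contains one of these cylinders.\<close>

lemma compact_hyp_boundary:
  assumes "finite X"
  shows "compact_space (hyp_boundary X)"
  unfolding compact_space_alt
proof (intro allI impI)
  fix \<U>
  assume "(\<forall>U\<in>\<U>. openin (hyp_boundary X) U) \<and> topspace (hyp_boundary X) \<subseteq> \<Union>\<U>"
  then have op: "\<forall>U\<in>\<U>. openin (hyp_boundary X) U" and cov: "topspace (hyp_boundary X) \<subseteq> \<Union>\<U>"
    by auto
  define bad where "bad s \<longleftrightarrow> \<not> (\<exists>\<F>. finite \<F> \<and> \<F> \<subseteq> \<U> \<and> cyl X s \<subseteq> \<Union>\<F>)" for s
  have step: "\<exists>l. bad (s @ [l])" if "bad s" for s
  proof (rule ccontr)
    assume "\<nexists>l. bad (s @ [l])"
    then have "\<forall>l. \<exists>\<F>. finite \<F> \<and> \<F> \<subseteq> \<U> \<and> cyl X (s @ [l]) \<subseteq> \<Union>\<F>"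
      unfolding bad_def by blast
    from choice[OF this] obtain \<F> where
      \<F>: "\<And>l. finite (\<F> l)" "\<And>l. \<F> l \<subseteq> \<U>" "\<And>l. cyl X (s @ [l]) \<subseteq> \<Union>(\<F> l)"
      by blast
    have "cyl X s \<subseteq> \<Union>(\<Union>l\<in>X \<times> UNIV. \<F> l)"
    proof
      fix w assume "w \<in> cyl X s"
      then obtain l where "l \<in> X \<times> UNIV" "w \<in> cyl X (s @ [l])" using cyl_extend[of X s] by blast
      then show "w \<in> \<Union>(\<Union>l\<in>X \<times> UNIV. \<F> l)" using \<F>(3)[of l] by blast
    qed
    moreover have "finite (\<Union>l\<in>X \<times> UNIV. \<F> l)" "(\<Union>l\<in>X \<times> UNIV. \<F> l) \<subseteq> \<U>"
      using \<F>(1) assms by simp (use \<F>(2) in blast)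
    ultimately show False using that unfolding bad_def by blast
  qed
  show "\<exists>\<F>. finite \<F> \<and> \<F> \<subseteq> \<U> \<and> topspace (hyp_boundary X) \<subseteq> \<Union>\<F>"
  proof (rule ccontr)
    assume "\<not> ?thesis"
    then have "bad []" by (simp add: bad_def)
    then obtain f where f: "\<And>n. bad (f n) \<and> length (f n) = n \<and> take n (f (Suc n)) = f n"
    proof -
      have "\<exists>f. \<forall>n. (bad (f n) \<and> length (f n) = n) \<and> take n (f (Suc n)) = f n"
      proof (rule dependent_nat_choice)
        fix x n assume "bad x \<and> length x = n"
        then show "\<exists>y. (bad y \<and> length y = Suc n) \<and> take n y = x"
          using step[of x] by (metis append_eq_conv_conj length_append_singleton)
      qed (use \<open>bad []\<close> in auto)
      then show ?thesis using that by blast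
    qed
    \<comment> \<open>The cylinder of a nonreduced word is empty, hence covered by the empty
      family.\<close>
    have "f n \<in> reduced_words X" for n
      using f[of n] cyl_nonreduced[of "f n" X] unfolding bad_def by (metis empty_subsetI finite.emptyI)
    then obtain w where w: "w \<in> Ends X" "\<And>n. pre n w = f n"
      using infinite_word_limit[of f X] f by blast
    then obtain U where U: "U \<in> \<U>" "w \<in> U" using cov by auto
    then obtain k where "cyl X (f k) \<subseteq> U"
      using op openin_hyp_boundary_cyl[of X U w] w(2) by metis
    then have "\<not> bad (f k)"
      unfolding bad_def not_not using U(1) by (intro exI[of _ "{U}"]) simp
    then show False using f by blast
  qed
qed

lemma clopen_space_hyp_boundary:
  assumes "finite X"
  shows "clopen_space (hyp_boundary X)"
proof
  show "compact_space (hyp_boundary X)" by (rule compact_hyp_boundary[OF assms])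
  show base: "\<exists>C. openin (hyp_boundary X) C \<and> closedin (hyp_boundary X) C \<and> x \<in> C \<and> C \<subseteq> U"
    if U: "openin (hyp_boundary X) U" "x \<in> U" for U x
  proof -
    obtain k where "cyl X (pre k x) \<subseteq> U" and x: "x \<in> Ends X"
      by (rule openin_hyp_boundary_cyl[OF U])
    then show ?thesis
      by (intro exI[of _ "cyl X (pre k x)"] conjI clopen_cyl mem_cyl_pre[OF x])
  qed
  \<comment> \<open>Clopen sets are compact and therefore finite unions of cylinders, of which there
    are countably many.\<close>
  show "countable {C. openin (hyp_boundary X) C \<and> closedin (hyp_boundary X) C}"
  proof (rule countable_subset)
    show "{C. openin (hyp_boundary X) C \<and> closedin (hyp_boundary X) C}
        \<subseteq> (\<lambda>A. \<Union>(cyl X ` A)) ` {A. finite A \<and> A \<subseteq> reduced_words X}"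
    proof
      fix C assume "C \<in> {C. openin (hyp_boundary X) C \<and> closedin (hyp_boundary X) C}"
      then have C: "openin (hyp_boundary X) C" "compactin (hyp_boundary X) C"
        using closedin_compact_space[OF compact_hyp_boundary[OF assms]] by auto
      let ?A = "{s \<in> reduced_words X. cyl X s \<subseteq> C}"
      have "C \<subseteq> \<Union>(cyl X ` ?A)"
      proof
        fix x assume "x \<in> C"
        then obtain k where "cyl X (pre k x) \<subseteq> C" and x: "x \<in> Ends X"
          by (rule openin_hyp_boundary_cyl[OF C(1)])
        then show "x \<in> \<Union>(cyl X ` ?A)" using mem_cyl_pre[OF x, of k] pre_Ends[OF x, of k] by blast
      qed
      moreover have "\<forall>U\<in>cyl X ` ?A. openin (hyp_boundary X) U"
        using clopen_cyl(1)[of X] by simp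
      ultimately have "\<exists>\<F>. finite \<F> \<and> \<F> \<subseteq> cyl X ` ?A \<and> C \<subseteq> \<Union>\<F>"
        using C(2) unfolding compactin_def by blast
      then obtain \<F> where \<F>: "finite \<F>" "\<F> \<subseteq> cyl X ` ?A" "C \<subseteq> \<Union>\<F>"
        by blast
      then obtain A where "A \<subseteq> ?A" "finite A" "\<F> = cyl X ` A"
        by (meson finite_subset_image)
      then show "C \<in> (\<lambda>A. \<Union>(cyl X ` A)) ` {A. finite A \<and> A \<subseteq> reduced_words X}"
        using \<F> by (intro image_eqI[of _ _ A]) auto
    qed
    show "countable ((\<lambda>A. \<Union>(cyl X ` A)) ` {A. finite A \<and> A \<subseteq> reduced_words X})"
      using countable_Collect_finite_subset[OF countable_reduced_words[OF assms]] by (intro countable_image)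
  qed
qed

section \<open>Extending conjugations to the compactification\<close>

context free_normal_subgroup
begin

abbreviation "compactification \<equiv> hyp_compactification X"
abbreviation "boundary \<equiv> hyp_boundary X"
abbreviation "boundary_borel \<equiv> borel_on (hyp_boundary X)"
abbreviation "probs \<equiv> prob_measures (hyp_boundary X)"
abbreviation "act \<equiv> conj_action G F X"

definition cj :: "'a \<Rightarrow> 'a \<Rightarrow> 'a" where "cj g x = g \<otimes> x \<otimes> inv g"

lemma cj_F: "g \<in> carrier G \<Longrightarrow> x \<in> F \<Longrightarrow> cj g x \<in> F"
  unfolding cj_def by (rule inv_op_closed2)

lemma cj_mult: "g \<in> carrier G \<Longrightarrow> x \<in> F \<Longrightarrow> y \<in> F \<Longrightarrow> cj g (x \<otimes> y) = cj g x \<otimes> cj g y"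
  by (simp add: cj_def m_assoc F_carrier inv_cancel)

lemma cj_cj: "g \<in> carrier G \<Longrightarrow> h \<in> carrier G \<Longrightarrow> x \<in> F \<Longrightarrow> cj g (cj h x) = cj (g \<otimes> h) x"
  by (simp add: cj_def m_assoc F_carrier inv_mult_group)

lemma cj_one: "x \<in> F \<Longrightarrow> cj \<one> x = x"
  by (simp add: cj_def F_carrier)

lemma cj_inv: "g \<in> carrier G \<Longrightarrow> x \<in> F \<Longrightarrow> cj g (inv x) = inv (cj g x)"
  by (simp add: cj_def m_assoc F_carrier inv_mult_group)

lemma cj_inv_cj: "g \<in> carrier G \<Longrightarrow> x \<in> F \<Longrightarrow> cj (inv g) (cj g x) = x"
  by (simp add: cj_cj cj_one)

lemma cj_inject: "g \<in> carrier G \<Longrightarrow> x \<in> F \<Longrightarrow> y \<in> F \<Longrightarrow> cj g x = cj g y \<Longrightarrow> x = y"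
  by (metis cj_inv_cj)

definition wmap :: "'a \<Rightarrow> 'a letter list \<Rightarrow> 'a letter list" where
  "wmap g u = rw (cj g (eval_word G u))"

lemma wmap_reduced: "g \<in> carrier G \<Longrightarrow> u \<in> reduced_words X \<Longrightarrow> wmap g u \<in> reduced_words X"
  by (simp add: wmap_def cj_F eval_in_F)

lemma wmap_wmap:
  "g \<in> carrier G \<Longrightarrow> h \<in> carrier G \<Longrightarrow> u \<in> reduced_words X \<Longrightarrow> wmap g (wmap h u) = wmap (g \<otimes> h) u"
  by (simp add: wmap_def cj_F eval_in_F cj_cj)

lemma wmap_one: "u \<in> reduced_words X \<Longrightarrow> wmap \<one> u = u"
  by (simp add: wmap_def cj_one eval_in_F)

text \<open>Words with short image lie in the image of a finite ball under the inverse automorphism,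
  so their length is bounded.\<close>

lemma wmap_proper:
  assumes g: "g \<in> carrier G"
  obtains m where "\<And>u. u \<in> reduced_words X \<Longrightarrow> m \<le> length u \<Longrightarrow> k \<le> length (wmap g u)"
proof -
  let ?S = "(\<lambda>x. length (rw (cj (inv g) x))) ` {x \<in> F. length (rw x) \<le> k}"
  have fin: "finite ?S" using finite_F_le by simp
  show ?thesis
  proof (rule that[of "Suc (Max ?S)"])
    fix u assume u: "u \<in> reduced_words X" "Suc (Max ?S) \<le> length u"
    show "k \<le> length (wmap g u)"
    proof (rule ccontr)
      assume "\<not> k \<le> length (wmap g u)"
      then have "length (rw (cj (inv g) (cj g (eval_word G u)))) \<in> ?S"
        using u g by (intro image_eqI[of _ _ "cj g (eval_word G u)"]) (auto simp: wmap_def cj_F eval_in_F)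
      then have "length u \<in> ?S" using u g by (simp add: cj_inv_cj eval_in_F)
      then show False using Max_ge[OF fin] u(2) by fastforce
    qed
  qed
qed

text \<open>Consecutive prefixes of a long word have images differing by a bounded factor, so these
  images share long prefixes: this replaces bounded cancellation.\<close>

lemma wmap_modulus:
  assumes g: "g \<in> carrier G"
  obtains m where "\<And>u. u \<in> reduced_words X \<Longrightarrow> m \<le> length u \<Longrightarrow> k \<le> length (wmap g u)"
    "\<And>u. u \<in> reduced_words X \<Longrightarrow> take k (wmap g (take m u)) = take k (wmap g u)"
proof -
  let ?L = "Max (insert 0 ((\<lambda>x. length (rw (cj g x))) ` X))"
  have L: "length (wmap g [l]) \<le> ?L" if "fst l \<in> X" for l
  proof -
    have x: "fst l \<in> F" "fst l \<in> carrier G" using that X_subset F_carrier by auto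
    have "length (rw (cj g (fst l))) \<le> ?L"
      using that finite_X by (intro Max_ge) auto
    moreover have "length (rw (cj g (inv (fst l)))) = length (rw (cj g (fst l)))"
      using x g by (simp add: cj_inv rw_inv cj_F)
    ultimately show ?thesis
      using x by (simp add: wmap_def eval_Cons)
  qed
  \<comment> \<open>The image of one further letter has length at most \<open>?L\<close>; the
    reserve of \<open>?L\<close> letters absorbs its cancellation.\<close>
  obtain m where m: "\<And>u. u \<in> reduced_words X \<Longrightarrow> m \<le> length u \<Longrightarrow> k + ?L \<le> length (wmap g u)"
    by (rule wmap_proper[OF g, of "k + ?L"]) blast
  have step: "take k (wmap g (take m u)) = take k (wmap g u)"
    if "u \<in> reduced_words X" "m \<le> length u" for u
    using that
  proof (induction u rule: rev_induct)
    case (snoc l u)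
    show ?case
    proof (cases "m \<le> length u")
      case True
      have u: "u \<in> reduced_words X" "fst l \<in> X" "[l] \<in> reduced_words X"
        using snoc.prems by (auto simp: reduced_words_append_iff)
      have "eval_word G (u @ [l]) = eval_word G u \<otimes> eval_word G [l]"
        using u by (intro eval_append) (auto simp: reduced_letters)
      then have "wmap g (u @ [l]) = rw (cj g (eval_word G u) \<otimes> cj g (eval_word G [l]))"
        using u g by (simp add: wmap_def cj_mult eval_in_F del: eval_Cons)
      moreover have "take k (rw (cj g (eval_word G u) \<otimes> cj g (eval_word G [l]))) = take k (rw (cj g (eval_word G u)))"
        using u g m[OF u(1) True] L[OF u(2)]
        by (intro take_rw_mult) (auto simp: cj_F eval_in_F wmap_def[symmetric])
      ultimately have "take k (wmap g (u @ [l])) = take k (wmap g u)"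
        by (simp add: wmap_def)
      then show ?thesis using snoc.IH[OF u(1) True] True by simp
    next
      case False
      then show ?thesis using snoc.prems by simp
    qed
  qed simp
  have "take k (wmap g (take m u)) = take k (wmap g u)" if "u \<in> reduced_words X" for u
    using step[OF that] by (cases "m \<le> length u") auto
  then show ?thesis using that[of m] m by (meson add_leD1)
qed

text \<open>A modulus of uniform continuity for the prefix topology. The second clause guarantees
  that long words have long images, so that ends go to ends.\<close>

definition modulus :: "'a \<Rightarrow> nat \<Rightarrow> nat" where
  "modulus g k = (SOME m. \<forall>u\<in>reduced_words X. take k (wmap g (take m u)) = take k (wmap g u) \<and>
     (m \<le> length u \<longrightarrow> k \<le> length (wmap g u)))"

lemma modulus:
  assumes "g \<in> carrier G" "u \<in> reduced_words X"
  shows "take k (wmap g (take (modulus g k) u)) = take k (wmap g u)"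
    "modulus g k \<le> length u \<Longrightarrow> k \<le> length (wmap g u)"
proof -
  have "\<exists>m. \<forall>u\<in>reduced_words X. take k (wmap g (take m u)) = take k (wmap g u) \<and>
     (m \<le> length u \<longrightarrow> k \<le> length (wmap g u))"
    by (rule wmap_modulus[OF assms(1), of k]) blast
  from someI_ex[OF this] show "take k (wmap g (take (modulus g k) u)) = take k (wmap g u)"
    "modulus g k \<le> length u \<Longrightarrow> k \<le> length (wmap g u)"
    using assms(2) by (auto simp: modulus_def)
qed

text \<open>An end is determined by its truncations, so the image of an end is prescribed through
  them; \<open>ext_Ends_aux\<close> supplies an end that has them.\<close>

definition ext :: "'a \<Rightarrow> 'a letter word \<Rightarrow> 'a letter word" where
  "ext g w = (case w of Fin u \<Rightarrow> Fin (wmap g u) | Inf s \<Rightarrow>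
     (SOME w'. w' \<in> Ends X \<and> (\<forall>k. pre k w' = take k (wmap g (pre (modulus g k) w)))))"

lemma pre_reduced: "w \<in> Words X \<Longrightarrow> pre k w \<in> reduced_words X"
  using pre_Ends[of w X k] by (auto simp: Words_def Ends_def[symmetric] take_reduced)

lemma modulus_pre:
  assumes "g \<in> carrier G" "w \<in> Words X" "modulus g k \<le> n"
  shows "take k (wmap g (pre (modulus g k) w)) = take k (wmap g (pre n w))"
  using modulus(1)[OF assms(1) pre_reduced[OF assms(2)], of k n] assms(3) by (simp add: take_pre)

lemma ext_Ends_aux:
  assumes g: "g \<in> carrier G" and w: "w \<in> Ends X"
  shows "ext g w \<in> Ends X \<and> (\<forall>k. pre k (ext g w) = take k (wmap g (pre (modulus g k) w)))"
proof -
  have W: "w \<in> Words X" using w Ends_subset by blast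
  let ?f = "\<lambda>k. take k (wmap g (pre (modulus g k) w))"
  have "\<exists>w'. w' \<in> Ends X \<and> (\<forall>k. pre k w' = ?f k)"
  proof (rule infinite_word_limit[of ?f X])
    show "length (?f k) = k" for k
      using modulus(2)[OF g pre_reduced[OF W], of k "modulus g k"] pre_Ends[OF w] by simp
    show "?f k \<in> reduced_words X" for k
      using g W by (intro take_reduced wmap_reduced pre_reduced)
    show "take k (?f (Suc k)) = ?f k" for k
    proof -
      let ?n = "max (modulus g k) (modulus g (Suc k))"
      have "?f (Suc k) = take (Suc k) (wmap g (pre ?n w))" "?f k = take k (wmap g (pre ?n w))"
        using g W by (auto intro!: modulus_pre)
      then show ?thesis by (simp add: min_def)
    qed
  qed blast
  from someI_ex[OF this] show ?thesis
    using w by (auto simp: ext_def Ends_def)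
qed

lemma ext_Ends: "g \<in> carrier G \<Longrightarrow> w \<in> Ends X \<Longrightarrow> ext g w \<in> Ends X"
  using ext_Ends_aux by blast

lemma ext_Fin [simp]: "ext g (Fin u) = Fin (wmap g u)"
  by (simp add: ext_def)

lemma Words_cases:
  assumes "w \<in> Words X"
  obtains u where "w = Fin u" "u \<in> reduced_words X" | "w \<in> Ends X"
  using assms by (auto simp: Words_def Ends_def)

lemma ext_Words: "g \<in> carrier G \<Longrightarrow> w \<in> Words X \<Longrightarrow> ext g w \<in> Words X"
  by (erule Words_cases) (auto simp: Words_def wmap_reduced Ends_def[symmetric] dest: ext_Ends)

text \<open>One formula for finite words and ends, with \<open>n\<close> free above the modulus:
  identities between extended maps follow from those between words by choosing \<open>n\<close>
  above all moduli involved.\<close>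

lemma pre_ext:
  assumes g: "g \<in> carrier G" and w: "w \<in> Words X" and n: "modulus g k \<le> n"
  shows "pre k (ext g w) = take k (wmap g (pre n w))"
  using w
proof (cases rule: Words_cases)
  case (1 u)
  have "take k (wmap g (take n u)) = take k (wmap g (take (modulus g k) (take n u)))"
    using modulus(1)[OF g take_reduced[OF 1(2)]] by simp
  also have "\<dots> = take k (wmap g u)"
    using n modulus(1)[OF g 1(2)] by (simp add: min_def)
  finally show ?thesis using 1 by simp
next
  case 2
  then show ?thesis using ext_Ends_aux[OF g 2] modulus_pre[OF g w n] by simp
qed

lemma ext_ext:
  assumes "g \<in> carrier G" "h \<in> carrier G" "w \<in> Words X"
  shows "ext g (ext h w) = ext (g \<otimes> h) w"
proof (rule pre_separates)
  fix k
  let ?n = "max (modulus h (modulus g k)) (modulus (g \<otimes> h) k)"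
  have r: "pre ?n w \<in> reduced_words X" using assms(3) by (rule pre_reduced)
  have "pre k (ext g (ext h w)) = take k (wmap g (pre (modulus g k) (ext h w)))"
    using assms by (intro pre_ext ext_Words) auto
  also have "pre (modulus g k) (ext h w) = take (modulus g k) (wmap h (pre ?n w))"
    using assms by (intro pre_ext) auto
  also have "take k (wmap g (take (modulus g k) (wmap h (pre ?n w)))) = take k (wmap g (wmap h (pre ?n w)))"
    using assms r by (intro modulus(1) wmap_reduced)
  also have "\<dots> = take k (wmap (g \<otimes> h) (pre ?n w))"
    using assms r by (simp add: wmap_wmap)
  also have "\<dots> = pre k (ext (g \<otimes> h) w)"
    using assms by (intro pre_ext[symmetric]) auto
  finally show "pre k (ext g (ext h w)) = pre k (ext (g \<otimes> h) w)" .
qed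

lemma ext_one: "w \<in> Words X \<Longrightarrow> ext \<one> w = w"
proof (rule pre_separates)
  fix k assume w: "w \<in> Words X"
  have "pre k (ext \<one> w) = take k (wmap \<one> (pre (max k (modulus \<one> k)) w))"
    using w by (intro pre_ext) auto
  also have "\<dots> = pre k w"
    using w by (simp add: wmap_one pre_reduced take_pre)
  finally show "pre k (ext \<one> w) = pre k w" .
qed

section \<open>Identification with the action by homeomorphisms\<close>

lemma continuous_ext:
  assumes g: "g \<in> carrier G"
  shows "continuous_map compactification compactification (ext g)"
  unfolding continuous_map_def
proof (intro conjI allI impI)
  show "ext g \<in> topspace compactification \<rightarrow> topspace compactification"
    using ext_Words[OF g] by simp
  fix U assume U: "openin compactification U"
  show "openin compactification {x \<in> topspace compactification. ext g x \<in> U}"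
    unfolding openin_hyp_compactification
  proof (intro conjI ballI)
    fix w assume "w \<in> {x \<in> topspace compactification. ext g x \<in> U}"
    then have w: "w \<in> Words X" "ext g w \<in> U" by auto
    then have "\<exists>k. \<forall>v\<in>Words X. pre k v = pre k (ext g w) \<longrightarrow> v \<in> U"
      using U unfolding openin_hyp_compactification by blast
    then obtain k where k: "\<forall>v\<in>Words X. pre k v = pre k (ext g w) \<longrightarrow> v \<in> U" ..
    have "ext g v \<in> U" if v: "v \<in> Words X" "pre (modulus g k) v = pre (modulus g k) w" for v
      using k ext_Words[OF g v(1)] pre_ext[OF g v(1) order_refl, of k] pre_ext[OF g w(1) order_refl, of k] v(2)
      by simp
    then show "\<exists>k. \<forall>v\<in>Words X. pre k v = pre k w \<longrightarrow> v \<in> {x \<in> topspace compactification. ext g x \<in> U}"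
      by (intro exI[of _ "modulus g k"]) simp
  qed auto
qed

lemma homeomorphic_ext:
  assumes g: "g \<in> carrier G"
  shows "homeomorphic_map compactification compactification (ext g)"
proof -
  have "homeomorphic_maps compactification compactification (ext g) (ext (inv g))"
    using g by (auto simp: homeomorphic_maps_def continuous_ext ext_ext ext_one)
  then show ?thesis using homeomorphic_map_maps by blast
qed

lemma open_pre: "openin compactification {v \<in> Words X. pre k v = s}"
  unfolding openin_hyp_compactification by (auto intro: exI[of _ k])

text \<open>Finite words are dense: the truncations of \<open>w\<close> are eventually in any
  neighbourhood of \<open>w\<close>, and both maps agree on them.\<close>

lemma continuous_agreeing_on_words:
  assumes f: "continuous_map compactification compactification f"
    and g: "g \<in> carrier G" and fin: "\<And>x. x \<in> F \<Longrightarrow> f (Fin (rw x)) = Fin (rw (cj g x))" and w: "w \<in> Words X"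
  shows "f w = ext g w"
proof (rule pre_separates)
  fix k
  have fw: "f w \<in> Words X"
    using continuous_map_image_subset_topspace[OF f] w by auto
  let ?U = "{x \<in> topspace compactification. f x \<in> {v \<in> Words X. pre k v = pre k (f w)}}"
  have "openin compactification ?U"
    by (rule openin_continuous_map_preimage[OF f open_pre])
  moreover have "w \<in> ?U" using w fw by simp
  ultimately have "\<exists>j. \<forall>v\<in>Words X. pre j v = pre j w \<longrightarrow> v \<in> ?U"
    unfolding openin_hyp_compactification by (elim conjE) (rule bspec)
  then obtain j where "\<forall>v\<in>Words X. pre j v = pre j w \<longrightarrow> v \<in> ?U" ..
  then have j: "pre k (f v) = pre k (f w)" if "v \<in> Words X" "pre j v = pre j w" for v
    using that by simp
  let ?n = "max j (modulus g k)"
  have r: "pre ?n w \<in> reduced_words X" by (rule pre_reduced[OF w])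
  have "f (Fin (pre ?n w)) = Fin (wmap g (pre ?n w))"
    using fin[OF eval_in_F[OF r]] r by (simp add: wmap_def)
  moreover have "pre k (f (Fin (pre ?n w))) = pre k (f w)"
    using r by (intro j) (auto simp: Words_def take_pre)
  ultimately show "pre k (f w) = pre k (ext g w)"
    using pre_ext[OF g w, of k ?n] by simp
qed

text \<open>Resolves the definite description: \<open>ext (inv g)\<close> is the inverse
  homeomorphism, and density of the finite words gives uniqueness.\<close>

lemma conj_action_eq:
  assumes g: "g \<in> carrier G"
  shows "act g = restrict (ext g) (Words X)"
  unfolding conj_action_def homeo_extension_def cj_def[symmetric] word_of_eq
proof (rule the_equality)
  show "homeomorphic_map compactification compactification (restrict (ext g) (Words X)) \<and>
    restrict (ext g) (Words X) \<in> extensional (topspace compactification) \<and>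
    (\<forall>x\<in>F. restrict (ext g) (Words X) (Fin (rw x)) = Fin (rw (cj g x)))"
  proof (intro conjI ballI)
    show "homeomorphic_map compactification compactification (restrict (ext g) (Words X))"
      by (rule homeomorphic_map_eq[OF homeomorphic_ext[OF g]]) simp
    show "restrict (ext g) (Words X) (Fin (rw x)) = Fin (rw (cj g x))" if "x \<in> F" for x
      using that by (auto simp: Words_def wmap_def)
  qed simp
next
  fix f
  assume f: "homeomorphic_map compactification compactification f \<and>
    f \<in> extensional (topspace compactification) \<and>
    (\<forall>x\<in>F. f (Fin (rw x)) = Fin (rw (cj g x)))"
  show "f = restrict (ext g) (Words X)"
  proof (rule extensionalityI[of _ "Words X"])
    show "f w = restrict (ext g) (Words X) w" if "w \<in> Words X" for w
      using f that continuous_agreeing_on_words[OF homeomorphic_imp_continuous_map g, of f w] by simp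
  qed (use f in auto)
qed

lemma act_eq: "g \<in> carrier G \<Longrightarrow> w \<in> Ends X \<Longrightarrow> act g w = ext g w"
  using Ends_subset by (auto simp: conj_action_eq)

lemma continuous_act:
  assumes g: "g \<in> carrier G"
  shows "continuous_map boundary boundary (act g)"
proof -
  have "continuous_map boundary compactification (ext g)"
    unfolding hyp_boundary_def by (rule continuous_map_from_subtopology[OF continuous_ext[OF g]])
  then have "continuous_map boundary boundary (ext g)"
    using ext_Ends[OF g] by (subst (2) hyp_boundary_def) (auto simp: continuous_map_in_subtopology Ends_def[symmetric])
  then show ?thesis
    by (rule continuous_map_eq) (simp add: act_eq[OF g])
qed

text \<open>Ping-pong on the boundary. On ends, conjugation by an element of \<open>F\<close> is
  left multiplication, because the right factor \<open>inv b\<close> only affects letters far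
  out.\<close>

lemma ext_cyl:
  assumes b: "b \<in> F" "2 * K \<le> length (rw b)" and w: "w \<in> Ends X" "w \<notin> cyl X (take K (rw (inv b)))"
  shows "ext b w \<in> cyl X (take K (rw b))"
proof -
  have W: "w \<in> Words X" and bG: "b \<in> carrier G" using w Ends_subset b F_carrier by auto
  \<comment> \<open>Each of the two multiplications by \<open>b\<close> and \<open>inv b\<close>
    costs at most \<open>length (rw b)\<close> letters, and \<open>K\<close> must survive
    both.\<close>
  let ?n = "max (modulus b K) (K + 2 * length (rw b))"
  define x where "x = eval_word G (pre ?n w)"
  have x: "x \<in> F" "rw x = pre ?n w" using pre_reduced[OF W] eval_in_F by (auto simp: x_def)
  have len: "length (rw x) = ?n" using x pre_Ends[OF w(1)] by simp
  have bx: "b \<otimes> x \<in> F" using b x by simp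
  have lb: "length (rw (inv b)) = length (rw b)" using b by (simp add: rw_inv)
  have "pre K (ext b w) = take K (rw (b \<otimes> x \<otimes> inv b))"
    using pre_ext[OF bG W, of K ?n] by (simp add: wmap_def cj_def x_def)
  also have "\<dots> = take K (rw (b \<otimes> x))"
  proof (rule take_rw_mult)
    have "length (rw x) \<le> length (rw (b \<otimes> x)) + length (rw b)"
    proof (rule rw_mult[OF b(1) x(1)])
      fix p c q assume "rw b = p @ c" "rw x = winv c @ q" "rw (b \<otimes> x) = p @ q"
      then show ?thesis by simp
    qed
    then show "K + length (rw (inv b)) \<le> length (rw (b \<otimes> x))" using len lb by linarith
  qed (use b bx in auto)
  also have "\<dots> = take K (rw b)"
  proof (rule take_rw_mult_long[OF b(1) x(1) b(2)])
    have "take K (rw x) = pre K w" using x(2) by (simp add: take_pre)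
    then show "take K (rw x) \<noteq> take K (rw (inv b))"
      using w b lb by (auto simp: cyl_def)
  qed
  finally show ?thesis
    using ext_Ends[OF bG w(1)] b by (auto simp: cyl_def)
qed

end

section \<open>Concentration\<close>

lemma replicate_reduced: "fst l \<in> X \<Longrightarrow> replicate n l \<in> reduced_words X"
  by (induction n) (auto simp: reduced_words_Cons hd_replicate)

lemma winv_replicate: "winv (replicate n l) = replicate n (inv_letter l)"
  by (simp add: winv_def map_replicate)

lemma inv_letter_Pair [simp]: "inv_letter (x, \<beta>) = (x, \<not> \<beta>)"
  by (simp add: inv_letter_def)

text \<open>The amount of cancellation in a product of long words is the length of the longest common
  prefix of two fixed words, whence it only depends on their \<open>K\<close>-prefixes.\<close>

lemma cancellation_position:
  assumes "b = p @ e" "v = winv e @ q" "p @ q \<in> reduced_words X"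
    and "length e < K" "2 * K \<le> length b" "2 * K \<le> length v"
  shows "take (length e) (take K v) = take (length e) (take K (winv b))"
    "take K v ! length e \<noteq> take K (winv b) ! length e"
proof -
  show "take (length e) (take K v) = take (length e) (take K (winv b))"
    using assms by (simp add: min_def)
  have ne: "p \<noteq> []" "q \<noteq> []" using assms by auto
  then have "hd q \<noteq> inv_letter (last p)"
    using assms(3) by (auto simp: reduced_words_append_iff)
  moreover have "take K v ! length e = hd q"
    using assms(4) ne by (simp add: assms(2) nth_append hd_conv_nth)
  moreover have "take K (winv b) ! length e = hd (winv p)"
    using assms(4) ne by (simp add: assms(1) nth_append hd_conv_nth)
  moreover have "hd (winv p) = inv_letter (last p)"
    using ne by (simp add: winv_def hd_rev last_map)
  ultimately show "take K v ! length e \<noteq> take K (winv b) ! length e" by simp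
qed

context free_normal_subgroup
begin

text \<open>The products \<open>c \<otimes> d\<close> and \<open>d \<otimes> c\<close> lose equally
  many letters, so they have the same length. In
  \<open>(c \<otimes> d) \<otimes> inv (d \<otimes> c)\<close> the surviving parts of both factors
  are then equally long, each with at least \<open>K\<close> letters, and they show the common
  prefix at either end.\<close>

lemma commutator_prefix:
  assumes c: "c \<in> F" "2 * K \<le> length (rw c)" and d: "d \<in> F" "2 * K \<le> length (rw d)"
    and same: "take K (rw d) = take K (rw c)" "take K (rw (inv d)) = take K (rw (inv c))"
    and ne: "take K (rw c) \<noteq> take K (rw (inv c))"
    and long: "2 * K \<le> length (rw (c \<otimes> d \<otimes> inv c \<otimes> inv d))"
  shows "take K (rw (c \<otimes> d \<otimes> inv c \<otimes> inv d)) = take K (rw (inv (c \<otimes> d \<otimes> inv c \<otimes> inv d)))"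
proof -
  have CG: "c \<in> carrier G" "d \<in> carrier G" using c d F_carrier by auto
  have ri: "rw (inv c) = winv (rw c)" "rw (inv d) = winv (rw d)" using c d by (simp_all add: rw_inv)
  let ?s = "take K (rw c)" and ?s' = "take K (rw (inv c))"
  have cdF: "c \<otimes> d \<in> F" "d \<otimes> c \<in> F" using c d by auto
  obtain p e q where 1: "rw c = p @ e" "rw d = winv e @ q" "rw (c \<otimes> d) = p @ q"
    by (rule rw_mult[OF c(1) d(1)])
  obtain p2 e2 q2 where 2: "rw d = p2 @ e2" "rw c = winv e2 @ q2" "rw (d \<otimes> c) = p2 @ q2"
    by (rule rw_mult[OF d(1) c(1)])
  have red: "p @ q \<in> reduced_words X" "p2 @ q2 \<in> reduced_words X"
    using rw_reduced[OF cdF(1)] rw_reduced[OF cdF(2)] 1(3) 2(3) by simp_all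
  have n1: "take K (rw d) \<noteq> take K (winv (rw c))" and n2: "take K (rw c) \<noteq> take K (winv (rw d))"
    using ne same ri by simp_all
  have e: "length e < K" "take K (rw (c \<otimes> d)) = ?s"
    using take_product[OF 1(1,2) c(2) n1] 1(3) by simp_all
  have e2: "length e2 < K" "take K (rw (d \<otimes> c)) = ?s"
    using take_product[OF 2(1,2) d(2) n2] 2(3) same by simp_all
  note pos1 = cancellation_position[OF 1(1,2) red(1) e(1) c(2) d(2)]
  note pos2 = cancellation_position[OF 2(1,2) red(2) e2(1) d(2) c(2)]
  have a1: "take (length e) ?s = take (length e) ?s'" "?s ! length e \<noteq> ?s' ! length e"
    using pos1 unfolding ri[symmetric] same by this+
  have a2: "take (length e2) ?s = take (length e2) ?s'" "?s ! length e2 \<noteq> ?s' ! length e2"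
    using pos2 unfolding ri[symmetric] same by this+
  \<comment> \<open>Both are the first index at which \<open>?s\<close> and \<open>?s'\<close>
    differ.\<close>
  have "length e = length e2"
  proof (rule ccontr)
    assume "length e \<noteq> length e2"
    then consider "length e < length e2" | "length e2 < length e" by linarith
    then show False
    proof cases
      case 1
      then have "?s ! length e = ?s' ! length e" using a2(1) by (metis nth_take)
      then show False using a1(2) by contradiction
    next
      case 2
      then have "?s ! length e2 = ?s' ! length e2" using a1(1) by (metis nth_take)
      then show False using a2(2) by contradiction
    qed
  qed
  then have len: "length (rw (c \<otimes> d)) = length (rw (d \<otimes> c))"
    using arg_cong[OF 1(1), of length] arg_cong[OF 1(2), of length]
      arg_cong[OF 2(1), of length] arg_cong[OF 2(2), of length] 1(3) 2(3) by simp
  have w: "c \<otimes> d \<otimes> inv c \<otimes> inv d = (c \<otimes> d) \<otimes> inv (d \<otimes> c)"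
    using CG by (simp add: inv_mult_group m_assoc)
  obtain p3 e3 q3 where 3: "rw (c \<otimes> d) = p3 @ e3" "rw (inv (d \<otimes> c)) = winv e3 @ q3"
    "rw ((c \<otimes> d) \<otimes> inv (d \<otimes> c)) = p3 @ q3"
    by (rule rw_mult[of "c \<otimes> d" "inv (d \<otimes> c)"]) (use cdF in auto)
  have rdc: "rw (d \<otimes> c) = winv q3 @ e3"
    using arg_cong[OF 3(2), of winv] cdF by (simp add: rw_inv)
  have "length p3 = length q3"
    using len 3(1) rdc by simp
  moreover have "2 * K \<le> length p3 + length q3"
    using long unfolding w 3(3) by simp
  ultimately have K: "K \<le> length p3" "K \<le> length q3" by linarith+
  have "take K (rw ((c \<otimes> d) \<otimes> inv (d \<otimes> c))) = ?s"
    using K e(2) by (simp add: 3(1,3))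
  moreover have "take K (rw (inv ((c \<otimes> d) \<otimes> inv (d \<otimes> c)))) = ?s"
  proof -
    have "rw (inv ((c \<otimes> d) \<otimes> inv (d \<otimes> c))) = winv q3 @ winv p3"
      using cdF 3(3) by (simp add: rw_inv)
    then show ?thesis using K e2(2) by (simp add: rdc)
  qed
  ultimately show ?thesis unfolding w by simp
qed

section \<open>Mass estimates from almost invariance\<close>

lemma pow_F: "b \<in> F \<Longrightarrow> b [^] (j::nat) \<in> F"
  by (induction j) auto

lemma cj_pow: "g \<in> carrier G \<Longrightarrow> a \<in> F \<Longrightarrow> cj g (a [^] (j::nat)) = cj g a [^] j"
  by (induction j) (auto simp: cj_mult pow_F, simp add: cj_def)

lemma ext_preimage_sets:
  assumes "b \<in> carrier G" "M \<in> probs"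
  shows "{w \<in> Ends X. ext b w \<in> cyl X s} \<in> sets M" "cyl X s \<in> sets M" "space M = Ends X" "prob_space M"
proof -
  interpret clopen_space boundary by (rule clopen_space_hyp_boundary[OF finite_X])
  have "{w \<in> topspace boundary. act b w \<in> cyl X s} = {w \<in> Ends X. ext b w \<in> cyl X s}"
    using act_eq[OF assms(1)] by auto
  then show "{w \<in> Ends X. ext b w \<in> cyl X s} \<in> sets M"
    using openin_continuous_map_preimage[OF continuous_act[OF assms(1)] clopen_cyl(1)[of X s]]
      openin_sets prob_measuresD(2)[OF assms(2)] by metis
  show "cyl X s \<in> sets M" "space M = Ends X" "prob_space M"
    using prob_measuresD[OF assms(2)] openin_sets[OF clopen_cyl(1)[of X s]] by auto
qed

lemma pair_mass:
  assumes b: "b \<in> F" "2 * K \<le> length (rw b)" and M: "M \<in> probs"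
    and eps: "\<bar>measure M {w \<in> Ends X. ext b w \<in> cyl X (take K (rw b))} - measure M (cyl X (take K (rw b)))\<bar> \<le> \<epsilon>"
  shows "1 - \<epsilon> \<le> measure M (cyl X (take K (rw b))) + measure M (cyl X (take K (rw (inv b))))"
proof -
  have bG: "b \<in> carrier G" using b F_carrier by blast
  note S = ext_preimage_sets[OF bG M]
  interpret prob_space M by (rule S(4))
  let ?s = "take K (rw b)" and ?s' = "take K (rw (inv b))"
  have "space M - cyl X ?s' \<subseteq> {w \<in> Ends X. ext b w \<in> cyl X ?s}"
    using ext_cyl[OF b] S(3) by auto
  then have "measure M (space M - cyl X ?s') \<le> measure M {w \<in> Ends X. ext b w \<in> cyl X ?s}"
    using S by (intro finite_measure_mono) auto
  moreover have "measure M (space M - cyl X ?s') = 1 - measure M (cyl X ?s')"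
    using S by (intro prob_compl) auto
  ultimately show ?thesis using eps by linarith
qed

lemma same_prefix_mass:
  assumes b: "b \<in> F" "2 * K \<le> length (rw b)" "0 < K" "take K (rw b) = take K (rw (inv b))"
    and M: "M \<in> probs"
    and eps: "\<And>j. j < N \<Longrightarrow>
      \<bar>measure M {w \<in> Ends X. ext (b [^] j) w \<in> cyl X (take K (rw b))} - measure M (cyl X (take K (rw b)))\<bar> \<le> \<epsilon>"
  shows "real N * (1 - measure M (cyl X (take K (rw b))) - \<epsilon>) \<le> 1"
proof -
  have bG: "b [^] j \<in> carrier G" for j :: nat using b(1) F_carrier by simp
  note S = ext_preimage_sets[OF bG M]
  interpret prob_space M by (rule S(4))
  let ?s = "take K (rw b)"
  let ?E = "\<lambda>j::nat. space M - {w \<in> Ends X. ext (b [^] j) w \<in> cyl X ?s}"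
  have hit: "ext (b [^] (j - i)) v \<in> cyl X ?s" if "i < j" "v \<in> Ends X" "v \<notin> cyl X ?s" for i j :: nat and v
    using ext_cyl[OF pow_F[OF b(1)] pow_prefix(1)[OF b] that(2), of "j - i"]
      pow_prefix(2,3)[OF b, of "j - i"] that by simp
  \<comment> \<open>For a point of \<open>?E i\<close> the first \<open>i\<close> applications of
    \<open>b\<close> end outside the cylinder; the remaining \<open>j - i\<close> then lead into it,
    as positive powers of \<open>b\<close> show the same prefix at both ends.\<close>
  have disj': "?E i \<inter> ?E j = {}" if "i < j" for i j
  proof (rule ccontr)
    assume "?E i \<inter> ?E j \<noteq> {}"
    then obtain w where w: "w \<in> Ends X" "ext (b [^] i) w \<notin> cyl X ?s" "ext (b [^] j) w \<notin> cyl X ?s"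
      using S(3) by auto
    have "b [^] (j - i) \<otimes> b [^] i = b [^] j"
      using that F_carrier[OF b(1)] by (simp add: nat_pow_mult)
    then have "ext (b [^] (j - i)) (ext (b [^] i) w) = ext (b [^] j) w"
      using w(1) Ends_subset bG by (subst ext_ext) auto
    then show False
      using hit[OF that ext_Ends[OF bG w(1)] w(2)] w(3) by simp
  qed
  have "disjoint_family_on ?E {..<N}"
    unfolding disjoint_family_on_def using disj' by (metis (no_types, lifting) inf_commute linorder_less_linear)
  then have "(\<Sum>j<N. measure M (?E j)) = measure M (\<Union>j<N. ?E j)"
    using sets.compl_sets[OF S(1)] by (intro finite_measure_finite_Union[symmetric]) auto
  also have "\<dots> \<le> 1" by (rule prob_le_1)
  finally have "(\<Sum>j<N. measure M (?E j)) \<le> 1" .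
  moreover have "(\<Sum>j<N. 1 - measure M (cyl X ?s) - \<epsilon>) \<le> (\<Sum>j<N. measure M (?E j))"
  proof (rule sum_mono)
    fix j assume "j \<in> {..<N}"
    moreover have "measure M (?E j) = 1 - measure M {w \<in> Ends X. ext (b [^] j) w \<in> cyl X ?s}"
      by (rule prob_compl[OF S(1)])
    ultimately show "1 - measure M (cyl X ?s) - \<epsilon> \<le> measure M (?E j)"
      using eps[of j] by (simp add: abs_le_iff)
  qed
  ultimately show ?thesis by simp
qed

text \<open>The bound does not depend on \<open>f\<close>, which makes the exponents below work for
  all conjugations simultaneously.\<close>

lemma pigeonhole_long:
  fixes f :: "nat \<Rightarrow> 'a"
  assumes "\<And>n. 1 \<le> n \<Longrightarrow> f n \<in> F" "inj_on f {1..}"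
  shows "card {n \<in> {1..N}. length (rw (f n)) < L} \<le> card {z \<in> F. length (rw z) \<le> L}"
proof (rule card_inj_on_le)
  show "inj_on f {n \<in> {1..N}. length (rw (f n)) < L}"
    using assms(2) by (rule inj_on_subset) auto
qed (use assms(1) finite_F_le in auto)

text \<open>The test set is chosen before \<open>g\<close> and \<open>M\<close>: powers of
  \<open>x\<close> and \<open>y\<close>, their commutators with either sign of the exponent of
  \<open>y\<close>, and powers of all these, with exponents bounded in terms of \<open>K\<close> and
  \<delta>.\<close>

lemma concentration:
  assumes xy: "x \<in> X" "y \<in> X" "x \<noteq> y" and "0 < K" "0 < \<delta>"
  obtains A \<epsilon> where "finite A" "A \<subseteq> F" "0 < \<epsilon>"
    "\<And>g M. g \<in> carrier G \<Longrightarrow> M \<in> probs \<Longrightarrow>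
      (\<And>a s. a \<in> A \<Longrightarrow> length s = K \<Longrightarrow>
        \<bar>measure M {w \<in> Ends X. ext (cj g a) w \<in> cyl X s} - measure M (cyl X s)\<bar> \<le> \<epsilon>) \<Longrightarrow>
      \<exists>s. length s = K \<and> 1 - \<delta> \<le> measure M (cyl X s)"
proof -
  define B where "B = card {z \<in> F. length (rw z) \<le> 2 * K}"
  \<comment> \<open>Three families indexed by \<open>n\<close> must be long at once, namely the
    powers of \<open>x\<close> and the commutators of both signs; each excludes at most
    \<open>B\<close> exponents.\<close>
  define D where "D = 3 * B + 1"
  \<comment> \<open>With no cylinder of mass \<open>1 - \<delta>\<close> and an error of
    \<open>\<delta> / 4\<close>, each disjoint preimage has mass more than
    \<open>\<delta> / 2\<close>; \<open>N\<close> of them exceed total mass 1.\<close>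
  have "0 < \<delta> / 2" using \<open>0 < \<delta>\<close> by simp
  from reals_Archimedean3[OF this] obtain N :: nat where N: "1 < real N * (\<delta> / 2)"
    by blast
  define pw where "pw z \<beta> n = eval_word G (replicate n (z, \<beta>))" for z \<beta> and n :: nat
  define cm where "cm \<beta> n m = eval_word G (replicate n (x, True) @ replicate m (y, \<beta>) @
    replicate n (x, False) @ replicate m (y, \<not> \<beta>))" for \<beta> and n m :: nat
  have pw: "pw z \<beta> n \<in> F" "rw (pw z \<beta> n) = replicate n (z, \<beta>)" if "z \<in> X" for z \<beta> n
    using that replicate_reduced[of "(z, \<beta>)" X n] eval_in_F by (simp_all add: pw_def)
  have cm_red: "replicate n (x, True) @ replicate m (y, \<beta>) @ replicate n (x, False) @ replicate m (y, \<not> \<beta>)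
      \<in> reduced_words X" if "1 \<le> n" "1 \<le> m" for \<beta> n m
    using that xy replicate_reduced[of "(x, _)" X n] replicate_reduced[of "(y, _)" X m]
    by (auto simp: reduced_words_append_iff hd_append)
  have cm: "cm \<beta> n m \<in> F" "length (rw (cm \<beta> n m)) = 2 * n + 2 * m" if "1 \<le> n" "1 \<le> m" for \<beta> n m
    using cm_red[OF that, of \<beta>] eval_in_F[OF cm_red[OF that, of \<beta>]] by (simp_all add: cm_def)
  have cm_eq: "cm \<beta> n m = pw x True n \<otimes> pw y \<beta> m \<otimes> inv (pw x True n) \<otimes> inv (pw y \<beta> m)" for \<beta> n m
  proof -
    let ?a = "replicate n (x, True)" and ?b = "replicate m (y, \<beta>)"
    have r: "?a \<in> reduced_words X" "?b \<in> reduced_words X" using xy by (simp_all add: replicate_reduced)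
    have w: "replicate n (x, False) = winv ?a" "replicate m (y, \<not> \<beta>) = winv ?b"
      by (simp_all add: winv_replicate)
    show ?thesis
      using r[THEN reduced_letters] eval_carrier[of ?a] eval_carrier[of ?b]
      unfolding cm_def pw_def w by (simp add: eval_append eval_winv image_Un m_assoc)
  qed
  have pw_inv: "inv (pw y True m) = pw y False m" for m
    using eval_winv[of "replicate m (y, True)"] xy reduced_letters[OF replicate_reduced[of "(y, True)" X m]]
    by (simp add: pw_def winv_replicate)
  define S where "S = (pw x True ` {1..D}) \<union> (pw y True ` {1..D}) \<union> (\<Union>\<beta>. \<Union>n\<in>{1..D}. cm \<beta> n ` {1..D})"
  \<comment> \<open>Exponents below \<open>N\<close> serve the disjoint preimages; the range
    \<open>N + 2\<close> ensures that the first power is present.\<close>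
  define A where "A = (\<Union>j<N + 2. (\<lambda>a. a [^] j) ` S)"
  have SF: "S \<subseteq> F" using pw xy cm by (auto simp: S_def)
  have "finite A" by (simp add: A_def S_def)
  have A1: "a [^] j \<in> A" if "a \<in> S" "j < N" for a j using that by (auto simp: A_def)
  have A2: "a \<in> A" if "a \<in> S" for a
  proof -
    have "a [^] (1::nat) \<in> A" using that unfolding A_def by (intro UN_I[of 1] imageI) auto
    then show ?thesis using that SF F_carrier by auto
  qed
  show ?thesis
  proof (rule that[of A "\<delta> / 4"])
    show "A \<subseteq> F" using SF by (auto simp: A_def intro: pow_F)
    show "finite A" "0 < \<delta> / 4" using \<open>finite A\<close> \<open>0 < \<delta>\<close> by auto
    fix g M
    assume g: "g \<in> carrier G" and M: "M \<in> probs"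
      and eps: "\<And>a s. a \<in> A \<Longrightarrow> length s = K \<Longrightarrow>
        \<bar>measure M {w \<in> Ends X. ext (cj g a) w \<in> cyl X s} - measure M (cyl X s)\<bar> \<le> \<delta> / 4"
    show "\<exists>s. length s = K \<and> 1 - \<delta> \<le> measure M (cyl X s)"
    proof (rule ccontr)
      assume "\<nexists>s. length s = K \<and> 1 - \<delta> \<le> measure M (cyl X s)"
      then have small: "measure M (cyl X s) < 1 - \<delta>" if "length s = K" for s
        using that by force
      interpret prob_space M using ext_preimage_sets(4)[OF g M] .
      have C [measurable]: "cyl X s \<in> sets M" for s using ext_preimage_sets(2)[OF g M] .
      have same: "take K (rw (cj g a)) \<noteq> take K (rw (inv (cj g a)))"
        if a: "a \<in> S" and l: "2 * K \<le> length (rw (cj g a))" for a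
      proof
        assume eq: "take K (rw (cj g a)) = take K (rw (inv (cj g a)))"
        have aF: "a \<in> F" using a SF by blast
        have lK: "length (take K (rw (cj g a))) = K" using l by simp
        have "real N * (1 - measure M (cyl X (take K (rw (cj g a)))) - \<delta> / 4) \<le> 1"
        proof (rule same_prefix_mass[OF cj_F[OF g aF] l \<open>0 < K\<close> eq M])
          fix j assume "j < N"
          then show "\<bar>measure M {w \<in> Ends X. ext (cj g a [^] j) w \<in> cyl X (take K (rw (cj g a)))} -
              measure M (cyl X (take K (rw (cj g a))))\<bar> \<le> \<delta> / 4"
            using eps[OF A1[OF a \<open>j < N\<close>] lK] g aF by (simp add: cj_pow)
        qed
        moreover have "real N * (\<delta> / 2) \<le> real N * (1 - measure M (cyl X (take K (rw (cj g a)))) - \<delta> / 4)"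
          using small[OF lK] \<open>0 < \<delta>\<close> by (intro mult_left_mono) auto
        ultimately show False using N by linarith
      qed
      have pair: "1 - \<delta> / 4 \<le> measure M (cyl X (take K (rw (cj g a)))) + measure M (cyl X (take K (rw (inv (cj g a)))))"
        if a: "a \<in> S" and l: "2 * K \<le> length (rw (cj g a))" for a
        using a SF l by (intro pair_mass cj_F g M eps A2) auto
      \<comment> \<open>Injectivity is visible before conjugation, where the lengths determine the
        exponents.\<close>
      have inj_cj: "inj_on (\<lambda>n. cj g (f n)) {1..}" if "\<And>n. 1 \<le> n \<Longrightarrow> f n \<in> F"
        "\<And>n n'. 1 \<le> n \<Longrightarrow> 1 \<le> n' \<Longrightarrow> length (rw (f n)) = length (rw (f n')) \<Longrightarrow> n = n'" for f :: "nat \<Rightarrow> 'a"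
      proof (rule inj_onI)
        fix n n' :: nat assume "n \<in> {1..}" "n' \<in> {1..}" "cj g (f n) = cj g (f n')"
        then have "f n = f n'" using that(1) cj_inject[OF g] by simp
        then show "n = n'" using that(2) \<open>n \<in> {1..}\<close> \<open>n' \<in> {1..}\<close> by simp
      qed
      have bad: "card {n \<in> {1..D}. length (rw (cj g (f n))) < 2 * K} \<le> B" if "\<And>n. 1 \<le> n \<Longrightarrow> f n \<in> F"
        "\<And>n n'. 1 \<le> n \<Longrightarrow> 1 \<le> n' \<Longrightarrow> length (rw (f n)) = length (rw (f n')) \<Longrightarrow> n = n'" for f :: "nat \<Rightarrow> 'a"
        unfolding B_def using inj_cj[of f] that by (intro pigeonhole_long) (auto intro: cj_F g)
      \<comment> \<open>The exponent \<open>m\<close> of \<open>y\<close> is fixed first, so that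
        the commutators form families in \<open>n\<close> alone.\<close>
      have "\<exists>m\<in>{1..D}. 2 * K \<le> length (rw (cj g (pw y True m)))"
      proof (rule ccontr)
        assume "\<not> ?thesis"
        then have "{n \<in> {1..D}. length (rw (cj g (pw y True n))) < 2 * K} = {1..D}" by auto
        moreover have "card {n \<in> {1..D}. length (rw (cj g (pw y True n))) < 2 * K} \<le> B"
          using pw xy by (intro bad) auto
        ultimately show False by (simp add: D_def)
      qed
      then obtain m where m: "m \<in> {1..D}" "2 * K \<le> length (rw (cj g (pw y True m)))" by blast
      let ?P = "{n \<in> {1..D}. length (rw (cj g (pw x True n))) < 2 * K}"
      let ?Q = "\<lambda>\<beta>. {n \<in> {1..D}. length (rw (cj g (cm \<beta> n m))) < 2 * K}"
      have "\<exists>n\<in>{1..D}. n \<notin> ?P \<and> n \<notin> ?Q True \<and> n \<notin> ?Q False"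
      proof (rule ccontr)
        assume "\<not> ?thesis"
        then have "{1..D} \<subseteq> ?P \<union> ?Q True \<union> ?Q False" by blast
        then have "D \<le> card (?P \<union> ?Q True \<union> ?Q False)"
          using card_mono[of "?P \<union> ?Q True \<union> ?Q False" "{1..D}"] by simp
        also have "\<dots> \<le> card ?P + card (?Q True) + card (?Q False)"
          using card_Un_le[of ?P "?Q True"] card_Un_le[of "?P \<union> ?Q True" "?Q False"] by linarith
        also have "\<dots> \<le> B + B + B"
        proof -
          have "card ?P \<le> B" using pw xy by (intro bad) auto
          moreover have "card (?Q \<beta>) \<le> B" for \<beta> using cm m by (intro bad) auto
          ultimately show ?thesis by (intro add_mono)
        qed
        finally show False by (simp add: D_def)
      qed
      then obtain n where n: "n \<in> {1..D}" "2 * K \<le> length (rw (cj g (pw x True n)))"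
        "2 * K \<le> length (rw (cj g (cm True n m)))" "2 * K \<le> length (rw (cj g (cm False n m)))"
        by fastforce
      let ?c = "cj g (pw x True n)" and ?d = "cj g (pw y True m)"
      let ?s = "take K (rw ?c)" and ?s' = "take K (rw (inv ?c))" and ?r = "take K (rw ?d)" and ?r' = "take K (rw (inv ?d))"
      have FF: "pw x True n \<in> F" "pw y True m \<in> F" "?c \<in> F" "?d \<in> F" using pw xy cj_F g by auto
      have inS: "pw x True n \<in> S" "pw y True m \<in> S" "\<And>\<beta>. cm \<beta> n m \<in> S"
        using n(1) m(1) unfolding S_def by blast+
      have ne: "?s \<noteq> ?s'" "?r \<noteq> ?r'" using same inS n m by auto
      have mass: "1 - \<delta> / 4 \<le> measure M (cyl X ?s) + measure M (cyl X ?s')"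
        "1 - \<delta> / 4 \<le> measure M (cyl X ?r) + measure M (cyl X ?r')"
        using pair inS n m by auto
      have lens: "length ?s = K" "length ?s' = K" "length ?r = K" "length ?r' = K"
        using n m FF by (simp_all add: rw_inv)
      \<comment> \<open>Two disjoint cylinders already carry \<open>1 - \<delta> / 4\<close>. Hence
        the prefixes of \<open>?d\<close> are among those of \<open>?c\<close>: otherwise the other
        prefix of \<open>?d\<close> would carry at least \<open>1 - \<delta> / 2\<close>, and no
        cylinder is that heavy.\<close>
      have third: "measure M (cyl X t) \<le> \<delta> / 4" if "length t = K" "t \<noteq> ?s" "t \<noteq> ?s'" for t
      proof -
        have "measure M (cyl X t \<union> (cyl X ?s \<union> cyl X ?s')) = measure M (cyl X t) + measure M (cyl X ?s \<union> cyl X ?s')"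
          using that lens cyl_disjoint[of t ?s X] cyl_disjoint[of t ?s' X] by (intro finite_measure_Union) auto
        moreover have "measure M (cyl X ?s \<union> cyl X ?s') = measure M (cyl X ?s) + measure M (cyl X ?s')"
          using lens ne cyl_disjoint[of ?s ?s' X] by (intro finite_measure_Union) auto
        moreover have "measure M (cyl X t \<union> (cyl X ?s \<union> cyl X ?s')) \<le> 1" by (rule prob_le_1)
        ultimately show ?thesis using mass by linarith
      qed
      have r: "?r = ?s \<or> ?r = ?s'"
      proof (rule ccontr)
        assume "\<not> ?thesis"
        then have "measure M (cyl X ?r) \<le> \<delta> / 4" using third[OF lens(3)] by simp
        then show False using mass(2) small[OF lens(4)] \<open>0 < \<delta>\<close> by linarith
      qed
      have r': "?r' = ?s \<or> ?r' = ?s'"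
      proof (rule ccontr)
        assume "\<not> ?thesis"
        then have "measure M (cyl X ?r') \<le> \<delta> / 4" using third[OF lens(4)] by simp
        then show False using mass(2) small[OF lens(3)] \<open>0 < \<delta>\<close> by linarith
      qed
      have cmc: "cj g (cm \<beta> n m) = ?c \<otimes> cj g (pw y \<beta> m) \<otimes> inv ?c \<otimes> inv (cj g (pw y \<beta> m))" for \<beta>
        using g pw xy FF by (simp add: cm_eq cj_mult cj_inv)
      have di: "cj g (pw y False m) = inv ?d"
        using g FF by (simp add: pw_inv[symmetric] cj_inv)
      show False
      proof (cases "?r = ?s")
        case True
        then have "?r' = ?s'" using r' ne by auto
        have "take K (rw (cj g (cm True n m))) = take K (rw (inv (cj g (cm True n m))))"
          unfolding cmc by (rule commutator_prefix) (use FF n m ne True \<open>?r' = ?s'\<close> cmc[of True] in auto)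
        then show False using same[OF inS(3) n(3)] by blast
      next
        case False
        \<comment> \<open>The prefixes are swapped, so \<open>inv ?d\<close> takes the place of
          \<open>?d\<close>; its commutator with \<open>?c\<close> is the image of
          \<open>cm False n m\<close>.\<close>
        then have "?r = ?s'" "?r' = ?s" using r r' ne by auto
        have ii: "inv (inv ?d) = ?d" "length (rw (inv ?d)) = length (rw ?d)" "inv ?d \<in> F"
          using FF F_carrier by (auto simp: rw_inv)
        have "take K (rw (cj g (cm False n m))) = take K (rw (inv (cj g (cm False n m))))"
          unfolding cmc di
          by (rule commutator_prefix) (use FF n m ne ii \<open>?r = ?s'\<close> \<open>?r' = ?s\<close> cmc[of False] di in auto)
        then show False using same[OF inS(3) n(4)] by blast
      qed
    qed
  qed
qed

end

section \<open>Stationary measures and harmonic functions\<close>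

text \<open>Turns the sum defining stationarity into an expectation, for which the integral calculus
  is available.\<close>

lemma has_sum_expectation_iff:
  assumes c: "\<And>g. g \<in> S \<Longrightarrow> 0 \<le> c g \<and> c g \<le> (1::real)" and S: "set_pmf p \<subseteq> S"
  shows "((\<lambda>g. pmf p g * c g) has_sum v) S \<longleftrightarrow> measure_pmf.expectation p c = v"
proof -
  \<comment> \<open>Nothing is known of \<open>c\<close> outside \<open>S\<close>; setting it to 0
    there leaves the expectation unchanged and gives summability over the whole type.\<close>
  define c' where "c' g = (if g \<in> S then c g else 0)" for g
  have a: "Infinite_Set_Sum.abs_summable_on (\<lambda>g. pmf p g * c' g) UNIV"
  proof (rule abs_summable_on_comparison_test[OF pmf_abs_summable[of p]])
    show "norm (pmf p g * c' g) \<le> norm (pmf p g)" for g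
      using c[of g] mult_left_mono[of "c' g" 1 "pmf p g"] by (simp add: c'_def)
  qed
  have "(\<lambda>g. pmf p g * c' g) summable_on UNIV"
    using a abs_summable_equivalent abs_summable_summable by blast
  then have "((\<lambda>g. pmf p g * c' g) has_sum (\<Sum>\<^sub>\<infinity>g. pmf p g * c' g)) UNIV"
    by (rule has_sum_infsum)
  also have "(\<Sum>\<^sub>\<infinity>g. pmf p g * c' g) = measure_pmf.expectation p c'"
    using infsetsum_infsum[OF a] pmf_expectation_eq_infsetsum[of p c'] by simp
  also have "measure_pmf.expectation p c' = measure_pmf.expectation p c"
    using S by (intro integral_cong_AE) (auto simp: AE_measure_pmf_iff c'_def)
  finally have "((\<lambda>g. pmf p g * c g) has_sum measure_pmf.expectation p c) S"
    using S by (subst has_sum_cong_neutral[where T = UNIV and g = "\<lambda>g. pmf p g * c' g"])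
      (auto simp: c'_def)
  then show ?thesis using has_sum_unique by blast
qed

locale free_normal_walk = free_normal_subgroup F G X + group_walk G \<mu>
  for F and G (structure) and X and \<mu> +
  fixes x y
  assumes xy: "x \<in> X" "y \<in> X" "x \<noteq> y" and nondegenerate: "nondegenerate G \<mu>"
begin

sublocale T: clopen_space "boundary"
  by (rule clopen_space_hyp_boundary[OF finite_X])

abbreviation "stationary_measure \<nu> \<equiv> stationary G \<mu> boundary act \<nu>"
abbreviation "borelE \<equiv> sets (borel_on boundary)"
abbreviation "push \<equiv> translate boundary act"

section \<open>Masses of translates as harmonic functions\<close>

lemma measure_translate:
  assumes "g \<in> carrier G" "\<nu> \<in> probs" "E \<in> borelE"
  shows "measure (push g \<nu>) E = measure \<nu> {w \<in> Ends X. ext g w \<in> E}"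
proof -
  have "{w \<in> topspace boundary. act g w \<in> E} = {w \<in> Ends X. ext g w \<in> E}"
    using act_eq[OF assms(1)] by auto
  then show ?thesis
    using T.translate_prob_measures(2)[where act = "act", OF continuous_act[OF assms(1)] assms(2,3)] by simp
qed

lemma translate_closed:
  "g \<in> carrier G \<Longrightarrow> \<nu> \<in> probs \<Longrightarrow> push g \<nu> \<in> probs"
  by (rule T.translate_prob_measures(1)[where act = "act", OF continuous_act])

lemma preimage_borel:
  assumes "g \<in> carrier G" "E \<in> borelE"
  shows "{w \<in> Ends X. ext g w \<in> E} \<in> borelE"
proof -
  have "act g -` E \<inter> space boundary_borel = {w \<in> Ends X. ext g w \<in> E}"
    using act_eq[OF assms(1)] by auto
  then show ?thesis
    using measurable_sets[OF T.continuous_measurable[OF continuous_act[OF assms(1)]] assms(2)] by simp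
qed

lemma stationary_iff:
  "stationary_measure \<nu> \<longleftrightarrow> \<nu> \<in> probs \<and>
    (\<forall>E\<in>borelE. measure_pmf.expectation \<mu> (\<lambda>g. measure (push g \<nu>) E) = measure \<nu> E)"
proof -
  have "((\<lambda>g. pmf \<mu> g * measure (push g \<nu>) E) has_sum measure \<nu> E) (carrier G) \<longleftrightarrow>
      measure_pmf.expectation \<mu> (\<lambda>g. measure (push g \<nu>) E) = measure \<nu> E"
    if "\<nu> \<in> probs" for E
    using translate_closed[OF _ that] T.prob_measuresD(1) prob_space.prob_le_1
    by (intro has_sum_expectation_iff supp) auto
  then show ?thesis
    unfolding stationary_def using T.prob_measuresD(2)[of \<nu>] by auto
qed

text \<open>The number \<open>(g\<nu>)(E)\<close> as a function of \<open>g\<close>. The value 0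
  outside the carrier is consistent with the absorbing steps there.\<close>

definition mass :: "'a letter word measure \<Rightarrow> 'a letter word set \<Rightarrow> 'a \<Rightarrow> real" where
  "mass \<nu> E g = (if g \<in> carrier G then measure \<nu> {w \<in> Ends X. ext g w \<in> E} else 0)"

lemma mass_bounds: "\<nu> \<in> probs \<Longrightarrow> 0 \<le> mass \<nu> E g \<and> mass \<nu> E g \<le> 1"
  using prob_space.prob_le_1[OF T.prob_measuresD(1)] by (simp add: mass_def)

lemma mass_abs: "\<nu> \<in> probs \<Longrightarrow> \<bar>mass \<nu> E g\<bar> \<le> 1"
  using mass_bounds[of \<nu> E g] by simp

lemma mass_translate:
  "\<nu> \<in> probs \<Longrightarrow> g \<in> carrier G \<Longrightarrow> E \<in> borelE \<Longrightarrow> measure (push g \<nu>) E = mass \<nu> E g"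
  by (simp add: measure_translate mass_def)

lemma mass_mult_left:
  assumes "g \<in> carrier G" "h \<in> carrier G"
  shows "mass \<nu> E (g \<otimes> h) = mass \<nu> {w \<in> Ends X. ext g w \<in> E} h"
proof -
  have "{w \<in> Ends X. ext (g \<otimes> h) w \<in> E} = {w \<in> Ends X. ext h w \<in> {w \<in> Ends X. ext g w \<in> E}}"
    using assms ext_ext[OF assms] ext_Ends Ends_subset[of X] by auto
  then show ?thesis using assms by (simp add: mass_def)
qed

lemma mass_one: "\<nu> \<in> probs \<Longrightarrow> E \<in> borelE \<Longrightarrow> mass \<nu> E \<one> = measure \<nu> E"
proof -
  assume "E \<in> borelE"
  then have "E \<subseteq> Ends X" using sets.sets_into_space by fastforce
  then have "{w \<in> Ends X. ext \<one> w \<in> E} = E"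
    using ext_one Ends_subset[of X] by (auto simp: subset_iff)
  then show ?thesis by (simp add: mass_def)
qed

text \<open>Harmonicity at \<open>g\<close> is stationarity tested on the preimage of
  \<open>E\<close> under \<open>g\<close>.\<close>

lemma mass_harmonic:
  assumes "stationary_measure \<nu>" "E \<in> borelE"
  shows "W.Pop (mass \<nu> E) g = mass \<nu> E g"
proof (cases "g \<in> carrier G")
  case True
  have \<nu>: "\<nu> \<in> probs" using assms(1) stationary_iff by blast
  let ?E = "{w \<in> Ends X. ext g w \<in> E}"
  have E: "?E \<in> borelE" by (rule preimage_borel[OF True assms(2)])
  have "W.Pop (mass \<nu> E) g = measure_pmf.expectation \<mu> (\<lambda>x. mass \<nu> E (g \<otimes> x))"
    by (rule Pop_carrier[OF True])
  also have "\<dots> = measure_pmf.expectation \<mu> (\<lambda>x. measure (push x \<nu>) ?E)"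
    using supp mass_mult_left[OF True] mass_translate[OF \<nu> _ E]
    by (intro integral_cong_AE) (auto simp: AE_measure_pmf_iff)
  also have "\<dots> = measure \<nu> ?E" using assms(1) E stationary_iff by blast
  finally show ?thesis using True by (simp add: mass_def)
qed (simp add: Pop_not_carrier)

lemma semigroup_span_carrier: "semigroup_span G (set_pmf \<mu>) = carrier G"
  using nondegenerate by (simp add: nondegenerate_def)

text \<open>The usable form of nondegeneracy: the walk moves from any \<open>g\<close> to
  \<open>g \<otimes> a\<close> in \<open>k\<close> steps with probability at least \<open>c\<close>,
  uniformly in \<open>g\<close>. Stated against all bounded nonnegative \<open>h\<close>, the bounds
  for two factors compose.\<close>

lemma Pop_power_lower_bound:
  assumes "a \<in> carrier G"
  obtains k c where "0 < c" "\<And>h B g. (\<And>x. 0 \<le> h x) \<Longrightarrow> (\<And>x. h x \<le> B) \<Longrightarrow> g \<in> carrier G \<Longrightarrow>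
    c * h (g \<otimes> a) \<le> (W.Pop ^^ k) h g"
proof -
  have "a \<in> semigroup_span G (set_pmf \<mu>)" using assms semigroup_span_carrier by simp
  then have "\<exists>k c. 0 < c \<and> (\<forall>h B g. (\<forall>x. 0 \<le> h x) \<longrightarrow> (\<forall>x. h x \<le> B) \<longrightarrow> g \<in> carrier G \<longrightarrow>
    c * h (g \<otimes> a) \<le> (W.Pop ^^ k) h g)"
  proof induction
    case (incl s)
    have "pmf \<mu> s * h (g \<otimes> s) \<le> (W.Pop ^^ 1) h g"
      if h: "\<forall>x. 0 \<le> h x" "\<forall>x. h x \<le> B" and g: "g \<in> carrier G" for h B g
    proof -
      have "measure_pmf.expectation \<mu> (\<lambda>x. h (g \<otimes> s) * indicator {s} x) \<le> measure_pmf.expectation \<mu> (\<lambda>x. h (g \<otimes> x))"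
      proof (rule integral_mono)
        show "integrable (measure_pmf \<mu>) (\<lambda>x. h (g \<otimes> x))"
          using h by (intro measure_pmf.integrable_const_bound[where B = B]) auto
        show "integrable (measure_pmf \<mu>) (\<lambda>x. h (g \<otimes> s) * indicator {s} x)"
          using h by (intro measure_pmf.integrable_const_bound[where B = B])
            (auto simp: indicator_def intro: order_trans[of 0 "h undefined"])
      qed (use h in \<open>auto simp: indicator_def\<close>)
      then show ?thesis by (simp add: Pop_carrier[OF g] measure_pmf_single mult.commute)
    qed
    moreover have "0 < pmf \<mu> s" using incl by (simp add: pmf_positive)
    ultimately show ?case by blast
  next
    case (mult a b)
    then obtain k c l d where kc: "0 < c" "\<And>h B g. (\<forall>x. 0 \<le> h x) \<Longrightarrow> (\<forall>x. h x \<le> B) \<Longrightarrow> g \<in> carrier G \<Longrightarrow>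
        c * h (g \<otimes> a) \<le> (W.Pop ^^ k) h g"
      and ld: "0 < d" "\<And>h B g. (\<forall>x. 0 \<le> h x) \<Longrightarrow> (\<forall>x. h x \<le> B) \<Longrightarrow> g \<in> carrier G \<Longrightarrow>
        d * h (g \<otimes> b) \<le> (W.Pop ^^ l) h g"
      by blast
    have ab: "a \<in> carrier G" "b \<in> carrier G" using mult semigroup_span_carrier by auto
    have "c * d * h (g \<otimes> (a \<otimes> b)) \<le> (W.Pop ^^ (k + l)) h g"
      if h: "\<forall>x. 0 \<le> h x" "\<forall>x. h x \<le> B" and g: "g \<in> carrier G" for h B g
    proof -
      have h': "0 \<le> (W.Pop ^^ l) h z" "(W.Pop ^^ l) h z \<le> B" for z
        using W.PopN_nonneg[of h B l z] W.PopN_bounded[of h B l z] h by (auto simp: abs_le_iff)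
      have "c * (d * h (g \<otimes> a \<otimes> b)) \<le> c * (W.Pop ^^ l) h (g \<otimes> a)"
        using ld(2)[OF h, of "g \<otimes> a"] g ab kc(1) by (intro mult_left_mono) auto
      also have "\<dots> \<le> (W.Pop ^^ k) ((W.Pop ^^ l) h) g"
        using h' g by (intro kc(2)) auto
      finally show ?thesis using g ab by (simp add: funpow_add m_assoc mult.assoc)
    qed
    moreover have "0 < c * d" using kc(1) ld(1) by simp
    ultimately show ?case by blast
  qed
  then show ?thesis using that by meson
qed

text \<open>Since \<open>a\<close> is reached with probability at least \<open>c\<close> in
  \<open>k\<close> steps, the squared increment is at most \<open>1 / c\<close> times the
  \<open>k\<close>-step variance, which vanishes along the walk.\<close>

lemma AE_increment_tendsto_0:
  assumes st: "stationary_measure \<nu>" "E \<in> borelE" and a: "a \<in> carrier G"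
  shows "AE \<omega> in W.\<Omega>. (\<lambda>i. mass \<nu> E (W.walk \<one> \<omega> i \<otimes> a) - mass \<nu> E (W.walk \<one> \<omega> i)) \<longlonglongrightarrow> 0"
proof -
  have \<nu>: "\<nu> \<in> probs" using st(1) stationary_iff by blast
  let ?m = "mass \<nu> E"
  note H = mass_abs[OF \<nu>] mass_harmonic[OF st]
  obtain k c where kc: "0 < c" "\<And>h B g. (\<And>x. 0 \<le> h x) \<Longrightarrow> (\<And>x. h x \<le> B) \<Longrightarrow> g \<in> carrier G \<Longrightarrow>
      c * h (g \<otimes> a) \<le> (W.Pop ^^ k) h g"
    by (rule Pop_power_lower_bound[OF a]) blast
  define d where "d g = (if g \<in> carrier G then (?m (g \<otimes> a) - ?m g)\<^sup>2 else 0)" for g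
  have "AE \<omega> in W.\<Omega>. (\<lambda>i. d (W.walk \<one> \<omega> i)) \<longlonglongrightarrow> 0"
  proof (rule W.AE_tendsto_0[OF H])
    show "d g \<le> 1 / c * ((W.Pop ^^ k) (\<lambda>x. (?m x)\<^sup>2) g - (?m g)\<^sup>2)" for g
    proof (cases "g \<in> carrier G")
      case True
      have "c * (?m (g \<otimes> a) - ?m g)\<^sup>2 \<le> (W.Pop ^^ k) (\<lambda>x. (?m x - ?m g)\<^sup>2) g"
        using W.bounded_variance[OF H] True by (intro kc(2)) auto
      also have "\<dots> = (W.Pop ^^ k) (\<lambda>x. (?m x)\<^sup>2) g - (?m g)\<^sup>2"
        unfolding W.PopN_variance[OF H] by (simp add: power2_eq_square)
      finally show ?thesis using True kc(1) by (simp add: d_def field_simps)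
    next
      case False
      then show ?thesis using W.PopN_sq_mono[OF H, of g k] kc(1) by (simp add: d_def)
    qed
  qed (use kc(1) in \<open>auto simp: d_def\<close>)
  then show ?thesis
  proof (rule eventually_mono)
    fix \<omega> assume "(\<lambda>i. d (W.walk \<one> \<omega> i)) \<longlonglongrightarrow> 0"
    then have "(\<lambda>i. (?m (W.walk \<one> \<omega> i \<otimes> a) - ?m (W.walk \<one> \<omega> i))\<^sup>2) \<longlonglongrightarrow> 0"
      by (simp add: d_def walk_carrier)
    then show "(\<lambda>i. ?m (W.walk \<one> \<omega> i \<otimes> a) - ?m (W.walk \<one> \<omega> i)) \<longlonglongrightarrow> 0"
      using tendsto_power_zero[of _ _ 2] by (auto intro: tendsto_rabs_zero_cancel dest!: tendsto_real_sqrt)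
  qed
qed

text \<open>Collects the probabilistic input in countably many conditions on a single path; the
  limit point is then obtained deterministically for each such path.\<close>

definition convergent_path :: "'a letter word measure \<Rightarrow> (nat \<Rightarrow> 'a) \<Rightarrow> bool" where
  "convergent_path \<nu> \<tau> \<longleftrightarrow> (\<forall>s\<in>reduced_words X. convergent (\<lambda>i. mass \<nu> (cyl X s) (\<tau> i)) \<and>
    (\<forall>a\<in>F. (\<lambda>i. mass \<nu> (cyl X s) (\<tau> i \<otimes> a) - mass \<nu> (cyl X s) (\<tau> i)) \<longlonglongrightarrow> 0))"

lemma cyl_borel [simp]: "cyl X s \<in> borelE"
  by (rule T.openin_sets[OF clopen_cyl(1)])

lemma AE_convergent_path:
  assumes "stationary_measure \<nu>"
  shows "AE \<omega> in W.\<Omega>. convergent_path \<nu> (W.walk \<one> \<omega>)"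
proof -
  have \<nu>: "\<nu> \<in> probs" using assms stationary_iff by blast
  have "AE \<omega> in W.\<Omega>. convergent (\<lambda>i. mass \<nu> (cyl X s) (W.walk \<one> \<omega> i))" for s
    by (rule W.AE_convergent[OF mass_abs[OF \<nu>] mass_harmonic[OF assms cyl_borel]])
  moreover have "AE \<omega> in W.\<Omega>. \<forall>a\<in>F.
      (\<lambda>i. mass \<nu> (cyl X s) (W.walk \<one> \<omega> i \<otimes> a) - mass \<nu> (cyl X s) (W.walk \<one> \<omega> i)) \<longlonglongrightarrow> 0" for s
    using AE_increment_tendsto_0[OF assms cyl_borel] countable_F F_carrier by (subst AE_ball_countable) auto
  ultimately show ?thesis
    unfolding convergent_path_def using countable_reduced_words[OF finite_X]
    by (subst AE_ball_countable) (auto intro: AE_conjI)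
qed

lemma mass_increment:
  assumes "g \<in> carrier G" "a \<in> F" "\<nu> \<in> probs" "E \<in> borelE"
  shows "measure (push g \<nu>) {w \<in> Ends X. ext (cj g a) w \<in> E} = mass \<nu> E (g \<otimes> a)"
proof -
  have a: "a \<in> carrier G" "cj g a \<in> carrier G" using assms F_carrier cj_F by auto
  have "cj g a \<otimes> g = g \<otimes> a" using assms(1) a(1) by (simp add: cj_def m_assoc)
  then have "mass \<nu> E (g \<otimes> a) = mass \<nu> {w \<in> Ends X. ext (cj g a) w \<in> E} g"
    using mass_mult_left[OF a(2) assms(1)] by metis
  then show ?thesis using mass_translate[OF assms(3,1) preimage_borel[OF a(2) assms(4)]] by simp
qed

section \<open>From almost invariance to a limit point\<close>

lemma reduced_words_length_finite: "finite {s \<in> reduced_words X. length s = K}"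
  by (rule finite_subset[OF _ finite_reduced_words_le[OF finite_X, of K]]) auto

lemma convergent_path_concentrates:
  assumes \<nu>: "\<nu> \<in> probs" and \<tau>: "\<And>i. \<tau> i \<in> carrier G" and convergent_path: "convergent_path \<nu> \<tau>"
    and "0 < K" "0 < \<delta>"
  shows "\<forall>\<^sub>F i in sequentially. \<exists>s\<in>reduced_words X. length s = K \<and> 1 - \<delta> \<le> mass \<nu> (cyl X s) (\<tau> i)"
proof -
  \<comment> \<open>Capping at \<open>1/2\<close> forces the heavy cylinder to have positive mass,
    so that its word is reduced.\<close>
  have d: "0 < min \<delta> (1/2)" using \<open>0 < \<delta>\<close> by simp
  obtain A \<epsilon> where A: "finite A" "A \<subseteq> F" "0 < \<epsilon>"
    "\<And>g M. g \<in> carrier G \<Longrightarrow> M \<in> probs \<Longrightarrow>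
      (\<And>a s. a \<in> A \<Longrightarrow> length s = K \<Longrightarrow>
        \<bar>measure M {w \<in> Ends X. ext (cj g a) w \<in> cyl X s} - measure M (cyl X s)\<bar> \<le> \<epsilon>) \<Longrightarrow>
      \<exists>s. length s = K \<and> 1 - min \<delta> (1/2) \<le> measure M (cyl X s)"
    by (rule concentration[OF xy \<open>0 < K\<close> d]) blast
  let ?R = "{s \<in> reduced_words X. length s = K}"
  have "\<forall>\<^sub>F i in sequentially. \<forall>a\<in>A. \<forall>s\<in>?R. \<bar>mass \<nu> (cyl X s) (\<tau> i \<otimes> a) - mass \<nu> (cyl X s) (\<tau> i)\<bar> < \<epsilon>"
  proof (intro eventually_ball_finite A(1) reduced_words_length_finite ballI)
    fix a s assume "a \<in> A" "s \<in> ?R"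
    then have "(\<lambda>i. mass \<nu> (cyl X s) (\<tau> i \<otimes> a) - mass \<nu> (cyl X s) (\<tau> i)) \<longlonglongrightarrow> 0"
      using convergent_path A(2) unfolding convergent_path_def by blast
    then have "(\<lambda>i. \<bar>mass \<nu> (cyl X s) (\<tau> i \<otimes> a) - mass \<nu> (cyl X s) (\<tau> i)\<bar>) \<longlonglongrightarrow> 0"
      by (rule tendsto_rabs_zero)
    then show "\<forall>\<^sub>F i in sequentially. \<bar>mass \<nu> (cyl X s) (\<tau> i \<otimes> a) - mass \<nu> (cyl X s) (\<tau> i)\<bar> < \<epsilon>"
      using A(3) by (rule order_tendstoD)
  qed
  then show ?thesis
  proof (rule eventually_mono)
    fix i assume i: "\<forall>a\<in>A. \<forall>s\<in>?R. \<bar>mass \<nu> (cyl X s) (\<tau> i \<otimes> a) - mass \<nu> (cyl X s) (\<tau> i)\<bar> < \<epsilon>"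
    have "\<exists>s. length s = K \<and> 1 - min \<delta> (1/2) \<le> measure (push (\<tau> i) \<nu>) (cyl X s)"
    proof (rule A(4)[OF \<tau> translate_closed[OF \<tau> \<nu>]])
      fix a and s :: "'a letter list" assume as: "a \<in> A" "length s = K"
      show "\<bar>measure (push (\<tau> i) \<nu>) {w \<in> Ends X. ext (cj (\<tau> i) a) w \<in> cyl X s} -
          measure (push (\<tau> i) \<nu>) (cyl X s)\<bar> \<le> \<epsilon>"
      proof (cases "s \<in> reduced_words X")
        case True
        then have "s \<in> ?R" using as by simp
        then show ?thesis
          using i as A(2) mass_increment[OF \<tau> _ \<nu> cyl_borel] mass_translate[OF \<nu> \<tau> cyl_borel] by (simp add: subset_iff less_imp_le)
      next
        case False
        then show ?thesis using A(3) by (simp add: cyl_nonreduced)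
      qed
    qed
    then obtain s where s: "length s = K" "1 - min \<delta> (1/2) \<le> mass \<nu> (cyl X s) (\<tau> i)"
      using mass_translate[OF \<nu> \<tau> cyl_borel] by auto
    have "s \<in> reduced_words X"
    proof (rule ccontr)
      assume "s \<notin> reduced_words X"
      then show False using s(2) by (simp add: cyl_nonreduced mass_def split: if_splits)
    qed
    then show "\<exists>s\<in>reduced_words X. length s = K \<and> 1 - \<delta> \<le> mass \<nu> (cyl X s) (\<tau> i)"
      using s by (intro bexI[of _ s]) auto
  qed
qed

text \<open>The heavy cylinder may at first depend on \<open>i\<close>. But the masses converge and
  there are finitely many words of length \<open>K\<close>, so if all limits were below 1, all
  masses would eventually stay below a common bound less than 1.\<close>

lemma convergent_path_limit_cyl:
  assumes \<nu>: "\<nu> \<in> probs" and \<tau>: "\<And>i. \<tau> i \<in> carrier G" and convergent_path: "convergent_path \<nu> \<tau>"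
    and K: "0 < K"
  obtains s where "s \<in> reduced_words X" "length s = K" "(\<lambda>i. mass \<nu> (cyl X s) (\<tau> i)) \<longlonglongrightarrow> 1"
proof -
  let ?R = "{s \<in> reduced_words X. length s = K}"
  define L where "L s = lim (\<lambda>i. mass \<nu> (cyl X s) (\<tau> i))" for s
  have L: "(\<lambda>i. mass \<nu> (cyl X s) (\<tau> i)) \<longlonglongrightarrow> L s" if "s \<in> reduced_words X" for s
    using convergent_path that unfolding convergent_path_def L_def convergent_LIMSEQ_iff by blast
  have L1: "L s \<le> 1" if "s \<in> reduced_words X" for s
    using L[OF that] by (rule LIMSEQ_le_const2) (use mass_bounds[OF \<nu>] in auto)
  have "\<exists>s\<in>?R. L s = 1"
  proof (rule ccontr)
    assume "\<not> ?thesis"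
    then have lt: "L s < 1" if "s \<in> ?R" for s using L1[of s] that by force
    \<comment> \<open>Half of the smallest gap to 1 leaves a strict inequality.\<close>
    let ?D = "insert 1 ((\<lambda>s. (1 - L s) / 2) ` ?R)"
    have fin: "finite ?D" using reduced_words_length_finite by simp
    have pos: "0 < Min ?D" using lt fin by (subst Min_gr_iff) auto
    have le: "Min ?D \<le> (1 - L s) / 2" if "s \<in> ?R" for s
      using that fin by (intro Min_le) auto
    have "\<forall>\<^sub>F i in sequentially. \<forall>s\<in>?R. mass \<nu> (cyl X s) (\<tau> i) < 1 - Min ?D"
    proof (intro eventually_ball_finite reduced_words_length_finite ballI)
      fix s assume s: "s \<in> ?R"
      have "L s < 1 - Min ?D" using le[OF s] lt[OF s] by (simp add: field_simps)
      then show "\<forall>\<^sub>F i in sequentially. mass \<nu> (cyl X s) (\<tau> i) < 1 - Min ?D"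
        using L s by (intro order_tendstoD(2)[of _ "L s"]) auto
    qed
    with convergent_path_concentrates[OF \<nu> \<tau> convergent_path K pos]
    have "\<forall>\<^sub>F i in sequentially. False"
      by eventually_elim force
    then show False by simp
  qed
  then show ?thesis using that L by fastforce
qed

lemma mass_mono: "\<nu> \<in> probs \<Longrightarrow> E \<in> borelE \<Longrightarrow> E' \<in> borelE \<Longrightarrow> E \<subseteq> E' \<Longrightarrow> mass \<nu> E g \<le> mass \<nu> E' g"
proof (cases "g \<in> carrier G")
  case True
  assume *: "\<nu> \<in> probs" "E \<in> borelE" "E' \<in> borelE" "E \<subseteq> E'"
  interpret prob_space \<nu> using T.prob_measuresD(1)[OF *(1)] .
  have "measure \<nu> {w \<in> Ends X. ext g w \<in> E} \<le> measure \<nu> {w \<in> Ends X. ext g w \<in> E'}"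
    using * preimage_borel[OF True *(3)] T.prob_measuresD(2)[OF *(1)] by (intro finite_measure_mono) auto
  then show ?thesis by (simp add: mass_def)
qed (simp add: mass_def)

lemma mass_disjoint:
  assumes \<nu>: "\<nu> \<in> probs" and E: "E \<in> borelE" "E' \<in> borelE" "E \<inter> E' = {}"
  shows "mass \<nu> E g + mass \<nu> E' g \<le> 1"
proof (cases "g \<in> carrier G")
  case True
  interpret prob_space \<nu> using T.prob_measuresD(1)[OF \<nu>] .
  have "measure \<nu> {w \<in> Ends X. ext g w \<in> E} + measure \<nu> {w \<in> Ends X. ext g w \<in> E'}
      = measure \<nu> ({w \<in> Ends X. ext g w \<in> E} \<union> {w \<in> Ends X. ext g w \<in> E'})"
    using E preimage_borel[OF True E(1)] preimage_borel[OF True E(2)] T.prob_measuresD(2)[OF \<nu>]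
    by (intro finite_measure_Union[symmetric]) auto
  then show ?thesis using True prob_le_1 by (simp add: mass_def)
qed (simp add: mass_def)

text \<open>Cylinders whose masses both tend to 1 cannot be disjoint, so the words found for
  successive lengths are coherent and define an end.\<close>

lemma convergent_path_limit:
  assumes \<nu>: "\<nu> \<in> probs" and \<tau>: "\<And>i. \<tau> i \<in> carrier G" and convergent_path: "convergent_path \<nu> \<tau>"
  obtains w where "w \<in> Ends X" "\<And>k. (\<lambda>i. mass \<nu> (cyl X (pre k w)) (\<tau> i)) \<longlonglongrightarrow> 1"
proof -
  have "\<exists>s. s \<in> reduced_words X \<and> length s = K \<and> (\<lambda>i. mass \<nu> (cyl X s) (\<tau> i)) \<longlonglongrightarrow> 1" for K
  proof (cases "K = 0")
    case True
    interpret prob_space \<nu> using T.prob_measuresD(1)[OF \<nu>] .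
    have "mass \<nu> (cyl X []) (\<tau> i) = 1" for i
    proof -
      have "{w \<in> Ends X. ext (\<tau> i) w \<in> Ends X} = space \<nu>"
        using ext_Ends[OF \<tau>] T.prob_measuresD(3)[OF \<nu>] by auto
      then show ?thesis using \<tau> prob_space by (simp add: mass_def)
    qed
    then show ?thesis using True by (intro exI[of _ "[]"]) simp
  next
    case False
    then show ?thesis by (rule_tac convergent_path_limit_cyl[OF \<nu> \<tau> convergent_path, of K]) (simp, blast)
  qed
  then have "\<forall>K. \<exists>s. s \<in> reduced_words X \<and> length s = K \<and> (\<lambda>i. mass \<nu> (cyl X s) (\<tau> i)) \<longlonglongrightarrow> 1" ..
  from choice[OF this] obtain S where S: "\<And>K. S K \<in> reduced_words X" "\<And>K. length (S K) = K"
    "\<And>K. (\<lambda>i. mass \<nu> (cyl X (S K)) (\<tau> i)) \<longlonglongrightarrow> 1" by blast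
  have "take K (S (Suc K)) = S K" for K
  proof (rule ccontr)
    let ?t = "take K (S (Suc K))"
    assume ne: "?t \<noteq> S K"
    have "cyl X (S (Suc K)) \<subseteq> cyl X ?t"
      using cyl_mono[of X ?t "drop K (S (Suc K))"] by simp
    then have le: "mass \<nu> (cyl X (S (Suc K))) (\<tau> i) + mass \<nu> (cyl X (S K)) (\<tau> i) \<le> 1" for i
      using mass_mono[OF \<nu>, of "cyl X (S (Suc K))" "cyl X ?t" "\<tau> i"]
        mass_disjoint[OF \<nu>, of "cyl X ?t" "cyl X (S K)" "\<tau> i"] cyl_disjoint[of ?t "S K" X] ne S(2)
      by simp
    have "1 + 1 \<le> (1::real)"
      by (rule LIMSEQ_le_const2[OF tendsto_add[OF S(3)[of "Suc K"] S(3)[of K]]]) (use le in auto)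
    then show False by simp
  qed
  then obtain w where w: "w \<in> Ends X" "\<And>n. pre n w = S n"
    by (rule infinite_word_limit[of S X, OF S(2) _ S(1)]) blast
  show ?thesis by (rule that[OF w(1)]) (simp add: w(2) S(3))
qed

text \<open>Either \<open>E\<close> or its complement contains a whole cylinder around
  \<open>w\<close>.\<close>

lemma convergent_path_limit_clopen:
  assumes \<nu>: "\<nu> \<in> probs"
    and w: "w \<in> Ends X" "\<And>k. (\<lambda>i. mass \<nu> (cyl X (pre k w)) (\<tau> i)) \<longlonglongrightarrow> 1" and E: "E \<in> T.clopens"
  shows "(\<lambda>i. mass \<nu> E (\<tau> i)) \<longlonglongrightarrow> of_bool (w \<in> E)"
proof (cases "w \<in> E")
  case True
  have "openin boundary E" using E by (simp add: T.clopens_def)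
  then obtain k where k: "cyl X (pre k w) \<subseteq> E"
    using openin_hyp_boundary_cyl[of X E w] True by metis
  have "(\<lambda>i. mass \<nu> E (\<tau> i)) \<longlonglongrightarrow> 1"
  proof (rule tendsto_sandwich[OF _ _ w(2)[of k] tendsto_const])
    show "\<forall>\<^sub>F i in sequentially. mass \<nu> (cyl X (pre k w)) (\<tau> i) \<le> mass \<nu> E (\<tau> i)"
      using mass_mono[OF \<nu> cyl_borel T.clopens_sets[OF E] k] by simp
    show "\<forall>\<^sub>F i in sequentially. mass \<nu> E (\<tau> i) \<le> 1" using mass_bounds[OF \<nu>] by simp
  qed
  then show ?thesis using True by simp
next
  case False
  have "openin boundary (Ends X - E)" "w \<in> Ends X - E"
    using E False w(1) by (auto simp: T.clopens_def closedin_def)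
  then obtain k where k: "cyl X (pre k w) \<subseteq> Ends X - E"
    using openin_hyp_boundary_cyl[of X "Ends X - E" w] by metis
  have "(\<lambda>i. mass \<nu> E (\<tau> i)) \<longlonglongrightarrow> 0"
  proof (rule tendsto_sandwich[OF _ _ tendsto_const])
    show "\<forall>\<^sub>F i in sequentially. mass \<nu> E (\<tau> i) \<le> 1 - mass \<nu> (cyl X (pre k w)) (\<tau> i)"
    proof (rule always_eventually, rule allI)
      fix i
      have "E \<inter> cyl X (pre k w) = {}" using k by blast
      then show "mass \<nu> E (\<tau> i) \<le> 1 - mass \<nu> (cyl X (pre k w)) (\<tau> i)"
        using mass_disjoint[OF \<nu> T.clopens_sets[OF E] cyl_borel] by (simp add: algebra_simps)
    qed
    show "\<forall>\<^sub>F i in sequentially. 0 \<le> mass \<nu> E (\<tau> i)" using mass_bounds[OF \<nu>] by simp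
    show "(\<lambda>i. 1 - mass \<nu> (cyl X (pre k w)) (\<tau> i)) \<longlonglongrightarrow> 0"
      using tendsto_diff[OF tendsto_const[of 1] w(2)[of k]] by simp
  qed
  then show ?thesis using False by simp
qed

section \<open>Uniqueness\<close>

lemma average_stationary:
  assumes "stationary_measure \<nu>" "stationary_measure \<nu>'"
  obtains N where "stationary_measure N" "\<And>E. E \<in> borelE \<Longrightarrow> measure N E = (measure \<nu> E + measure \<nu>' E) / 2"
proof -
  have P: "\<nu> \<in> probs" "\<nu>' \<in> probs"
    using assms stationary_iff by auto
  obtain N where N: "N \<in> probs"
    "\<And>E. E \<in> borelE \<Longrightarrow> measure N E = measure_pmf.expectation (bernoulli_pmf (1/2)) (\<lambda>b. measure (if b then \<nu> else \<nu>') E)"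
    by (rule T.mixture[of "\<lambda>b. if b then \<nu> else \<nu>'" "bernoulli_pmf (1/2)"]) (use P in simp, blast)
  have N2: "measure N E = (measure \<nu> E + measure \<nu>' E) / 2" if "E \<in> borelE" for E
    using N(2)[OF that] by (simp add: integral_bernoulli_pmf)
  have "stationary_measure N"
    unfolding stationary_iff
  proof (intro conjI ballI N(1))
    fix E assume E: "E \<in> borelE"
    have i: "integrable (measure_pmf \<mu>) (mass \<theta> E)" if "\<theta> \<in> probs" for \<theta>
      using mass_abs[OF that] by (intro measure_pmf.integrable_const_bound[where B = 1]) auto
    have e: "measure_pmf.expectation \<mu> (\<lambda>g. measure (push g \<theta>) E) = measure_pmf.expectation \<mu> (mass \<theta> E)"
      if "\<theta> \<in> probs" for \<theta>
      using supp mass_translate[OF that _ E] by (intro integral_cong_AE) (auto simp: AE_measure_pmf_iff)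
    have "mass N E = (\<lambda>g. (mass \<nu> E g + mass \<nu>' E g) / 2)"
      using N2[OF preimage_borel[OF _ E]] by (simp add: mass_def fun_eq_iff)
    then have "measure_pmf.expectation \<mu> (mass N E) = (measure_pmf.expectation \<mu> (mass \<nu> E) + measure_pmf.expectation \<mu> (mass \<nu>' E)) / 2"
      using i[OF P(1)] i[OF P(2)] by simp
    then show "measure_pmf.expectation \<mu> (\<lambda>g. measure (push g N) E) = measure N E"
      using assms P N2[OF E] E e[OF N(1)] e[OF P(1)] e[OF P(2)] by (simp add: stationary_iff)
  qed
  then show ?thesis using that N2 by blast
qed

text \<open>Equality is tested on clopen sets: the difference of the two masses tends to 0 along
  almost every path, while its expectation is the same at every time.\<close>

lemma stationary_unique:
  assumes "stationary_measure \<nu>" "stationary_measure \<nu>'"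
  shows "\<nu> = \<nu>'"
proof -
  have P: "\<nu> \<in> probs" "\<nu>' \<in> probs"
    using assms stationary_iff by auto
  obtain N where N: "stationary_measure N" "\<And>E. E \<in> borelE \<Longrightarrow> measure N E = (measure \<nu> E + measure \<nu>' E) / 2"
    using average_stationary[OF assms] by blast
  have NP: "N \<in> probs" using N(1) stationary_iff by blast
  have eq: "measure \<nu> E = measure \<nu>' E" if E: "E \<in> T.clopens" for E
  proof -
    note EB = T.clopens_sets[OF E]
    have mN: "mass N E g = (mass \<nu> E g + mass \<nu>' E g) / 2" for g
      using N(2)[OF preimage_borel[OF _ EB]] by (simp add: mass_def)
    have "AE \<omega> in W.\<Omega>. (\<lambda>i. mass \<nu> E (W.walk \<one> \<omega> i) - mass \<nu>' E (W.walk \<one> \<omega> i)) \<longlonglongrightarrow> 0"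
      using AE_convergent_path[OF assms(1)] AE_convergent_path[OF assms(2)] AE_convergent_path[OF N(1)]
    proof eventually_elim
      case (elim \<omega>)
      let ?\<tau> = "W.walk \<one> \<omega>"
      have \<tau>: "?\<tau> i \<in> carrier G" for i by (rule walk_carrier[OF one_closed])
      have lim: "\<exists>b. (\<lambda>i. mass \<theta> E (?\<tau> i)) \<longlonglongrightarrow> of_bool b"
        if "\<theta> \<in> probs" "convergent_path \<theta> ?\<tau>" for \<theta>
        by (rule convergent_path_limit[OF that(1) \<tau> that(2)]) (use convergent_path_limit_clopen[OF that(1) _ _ E] in blast)
      obtain a b c where abc: "(\<lambda>i. mass \<nu> E (?\<tau> i)) \<longlonglongrightarrow> of_bool a" "(\<lambda>i. mass \<nu>' E (?\<tau> i)) \<longlonglongrightarrow> of_bool b"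
        "(\<lambda>i. mass N E (?\<tau> i)) \<longlonglongrightarrow> of_bool c"
        using lim[OF P(1) elim(1)] lim[OF P(2) elim(2)] lim[OF NP elim(3)] by blast
      have "(\<lambda>i. mass N E (?\<tau> i)) \<longlonglongrightarrow> (of_bool a + of_bool b) / 2"
        unfolding mN by (intro tendsto_intros abc) simp
      then have "(of_bool a + of_bool b) / 2 = (of_bool c :: real)"
        using abc(3) LIMSEQ_unique by blast
      \<comment> \<open>All three limits are 0 or 1, and the midpoint of two different ones would be
        \<open>1/2\<close>.\<close>
      then have "a = b" by (cases a; cases b; cases c) auto
      then show ?case using tendsto_diff[OF abc(1,2)] by simp
    qed
    then have "(\<lambda>i. W.expectation (\<lambda>\<omega>. mass \<nu> E (W.walk \<one> \<omega> i) - mass \<nu>' E (W.walk \<one> \<omega> i))) \<longlonglongrightarrow> W.expectation (\<lambda>\<omega>. 0)"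
    proof (intro integral_dominated_convergence[where w = "\<lambda>_. 2"])
      show "AE \<omega> in W.\<Omega>. norm (mass \<nu> E (W.walk \<one> \<omega> i) - mass \<nu>' E (W.walk \<one> \<omega> i)) \<le> 2" for i
        using mass_bounds[OF P(1)] mass_bounds[OF P(2)] by (intro AE_I2) (smt (verit) real_norm_def)
    qed auto
    \<comment> \<open>By harmonicity the expectation at time \<open>i\<close> equals the value at
      the identity.\<close>
    moreover have "W.expectation (\<lambda>\<omega>. mass \<nu> E (W.walk \<one> \<omega> i) - mass \<nu>' E (W.walk \<one> \<omega> i)) = measure \<nu> E - measure \<nu>' E" for i
    proof -
      have int: "integrable W.\<Omega> (\<lambda>\<omega>. mass \<theta> E (W.walk \<one> \<omega> i))" if "\<theta> \<in> probs" for \<theta>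
        using mass_abs[OF that] by (intro W.integrable_const_bound[where B = 1]) auto
      have "W.expectation (\<lambda>\<omega>. mass \<theta> E (W.walk \<one> \<omega> i)) = measure \<theta> E" if "stationary_measure \<theta>" for \<theta>
      proof -
        have \<theta>: "\<theta> \<in> probs" using that stationary_iff by blast
        have "W.expectation (\<lambda>\<omega>. mass \<theta> E (W.walk \<one> \<omega> i)) = (W.Pop ^^ i) (mass \<theta> E) \<one>"
          using mass_bounds[OF \<theta>] by (intro W.expectation_walk[where B = 1]) auto
        also have "\<dots> = mass \<theta> E \<one>"
          by (rule W.PopN_harmonic[OF mass_abs[OF \<theta>] mass_harmonic[OF that EB]])
        finally show ?thesis using mass_one[OF \<theta> EB] by simp
      qed
      then show ?thesis using int P assms by simp
    qed
    ultimately show ?thesis by (simp add: LIMSEQ_const_iff)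
  qed
  show ?thesis
  proof (rule T.borel_measure_eqI)
    show "finite_measure \<nu>" "sets \<nu> = borelE" "sets \<nu>' = borelE"
      using T.prob_measuresD[OF P(1)] T.prob_measuresD[OF P(2)] prob_space.finite_measure by auto
    show "emeasure \<nu> E = emeasure \<nu>' E" if "E \<in> T.clopens" for E
      using eq[OF that] T.prob_measuresD(1)[OF P(1)] T.prob_measuresD(1)[OF P(2)]
      by (simp add: finite_measure.emeasure_eq_measure[OF prob_space.finite_measure])
  qed
qed

section \<open>Convergence to point measures\<close>

lemma continuous_borel:
  assumes "continuous_map boundary euclideanreal h"
  shows "h \<in> borel_measurable boundary_borel"
proof (rule borel_measurableI)
  fix S :: "real set" assume "open S"
  then have "openin boundary {v \<in> topspace boundary. h v \<in> S}"
    by (intro openin_continuous_map_preimage[OF assms]) simp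
  moreover have "h -` S \<inter> space boundary_borel = {v \<in> topspace boundary. h v \<in> S}"
    by auto
  ultimately show "h -` S \<inter> space boundary_borel \<in> borelE"
    using T.openin_sets by simp
qed

lemma integral_tendsto_point:
  assumes M: "\<And>i. M i \<in> probs" and h: "h \<in> bounded_continuous boundary"
    and w: "w \<in> Ends X" and lim: "\<And>k. (\<lambda>i. measure (M i) (cyl X (pre k w))) \<longlonglongrightarrow> 1"
  shows "(\<lambda>i. integral\<^sup>L (M i) h) \<longlonglongrightarrow> h w"
proof (rule LIMSEQ_I)
  fix r :: real assume r: "0 < r"
  have hc: "continuous_map boundary euclideanreal h" and "bounded (h ` Ends X)"
    using h by (auto simp: bounded_continuous_def)
  then obtain B where B: "0 < B" "\<And>v. v \<in> Ends X \<Longrightarrow> \<bar>h v\<bar> \<le> B"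
    by (auto simp: bounded_pos)
  define U where "U = {v \<in> topspace boundary. h v \<in> ball (h w) (r / 2)}"
  have "openin boundary U"
    unfolding U_def by (intro openin_continuous_map_preimage[OF hc]) simp
  moreover have "w \<in> U" using w r by (simp add: U_def)
  ultimately have "\<exists>k. cyl X (pre k w) \<subseteq> U" by (metis openin_hyp_boundary_cyl)
  then obtain k where k: "cyl X (pre k w) \<subseteq> U" ..
  let ?C = "cyl X (pre k w)"
  have bound: "\<bar>integral\<^sup>L (M i) h - h w\<bar> \<le> r / 2 + 2 * B * (1 - measure (M i) ?C)" for i
  proof -
    note P = T.prob_measuresD[OF M[of i]]
    interpret prob_space "M i" by (rule P(1))
    have C1: "?C \<in> events" by (simp add: P(2))
    note C = C1 sets.compl_sets[OF C1]
    have hm: "h \<in> borel_measurable (M i)"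
      using continuous_borel[OF hc] P(2) measurable_cong_sets by blast
    have hi: "integrable (M i) h"
      using B(2) P(3) hm by (intro integrable_const_bound[where B = B]) auto
    have int: "integrable (M i) (indicator (space (M i) - ?C) :: _ \<Rightarrow> real)"
      by (rule integrable_real_indicator[OF C(2)]) (simp add: emeasure_eq_measure)
    have "integral\<^sup>L (M i) h - h w = integral\<^sup>L (M i) (\<lambda>v. h v - h w)"
      using hi prob_space by simp
    also have "\<bar>\<dots>\<bar> \<le> integral\<^sup>L (M i) (\<lambda>v. \<bar>h v - h w\<bar>)"
      by (rule integral_abs_bound)
    also have "\<dots> \<le> integral\<^sup>L (M i) (\<lambda>v. r / 2 + 2 * B * indicator (space (M i) - ?C) v)"
    proof (rule integral_mono)
      show "integrable (M i) (\<lambda>v. \<bar>h v - h w\<bar>)" using hi by simp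
      show "integrable (M i) (\<lambda>v. r / 2 + 2 * B * indicator (space (M i) - ?C) v)"
        by (intro Bochner_Integration.integrable_add integrable_const integrable_mult_right int)
      fix v assume v: "v \<in> space (M i)"
      show "\<bar>h v - h w\<bar> \<le> r / 2 + 2 * B * indicator (space (M i) - ?C) v"
      proof (cases "v \<in> ?C")
        case True
        then have "h v \<in> ball (h w) (r / 2)" using k by (auto simp: U_def)
        then show ?thesis using True by (simp add: dist_real_def abs_minus_commute)
      next
        case False
        then show ?thesis using B(2)[of v] B(2)[of w] v w P(3) r by simp
      qed
    qed
    also have "\<dots> = r / 2 + 2 * B * measure (M i) (space (M i) - ?C)"
      using int C(2) prob_space by simp
    also have "measure (M i) (space (M i) - ?C) = 1 - measure (M i) ?C"
      using C by (intro prob_compl)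
    finally show ?thesis .
  qed
  \<comment> \<open>Off the cylinder the integrand is at most \<open>2 * B\<close>, so a missing
    mass below \<open>r / (4 * B)\<close> contributes less than \<open>r / 2\<close>.\<close>
  have "1 - r / (4 * B) < 1" using r B(1) by simp
  then have "\<forall>\<^sub>F i in sequentially. 1 - r / (4 * B) < measure (M i) ?C"
    using lim[of k] by (intro order_tendstoD(1))
  then obtain N where N: "\<And>i. N \<le> i \<Longrightarrow> 1 - r / (4 * B) < measure (M i) ?C"
    by (auto simp: eventually_sequentially)
  have "norm (integral\<^sup>L (M i) h - h w) < r" if "N \<le> i" for i
  proof -
    have "2 * B * (1 - measure (M i) ?C) < 2 * B * (r / (4 * B))"
      using N[OF that] B(1) by (intro mult_strict_left_mono) auto
    also have "\<dots> = r / 2" using B(1) by simp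
    finally show ?thesis using bound[of i] by simp
  qed
  then show "\<exists>N. \<forall>i\<ge>N. norm (integral\<^sup>L (M i) h - h w) < r" by blast
qed

lemma return_prob: "w \<in> Ends X \<Longrightarrow> return boundary_borel w \<in> probs"
  by (intro T.prob_measuresI prob_space_return) auto

lemma weak_star_point:
  assumes M: "\<And>i. M i \<in> probs"
    and w: "w \<in> Ends X" and lim: "\<And>k. (\<lambda>i. measure (M i) (cyl X (pre k w))) \<longlonglongrightarrow> 1"
  shows "limitin (weak_star boundary) M (return boundary_borel w) sequentially"
proof -
  let ?C = "bounded_continuous boundary"
  let ?\<phi> = "\<lambda>\<theta>. \<lambda>h\<in>?C. integral\<^sup>L \<theta> h"
  let ?P = "product_topology (\<lambda>_. euclideanreal) ?C"
  let ?R = "return boundary_borel w"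
  have R: "integral\<^sup>L ?R h = h w" if "h \<in> ?C" for h
    using that w continuous_borel by (intro integral_return) (auto simp: bounded_continuous_def)
  have lim: "limitin ?P (\<lambda>i. ?\<phi> (M i)) (?\<phi> ?R) sequentially"
    unfolding limitin_componentwise
    using integral_tendsto_point[OF M _ w lim] R by (auto simp: PiE_iff)
  show ?thesis
    unfolding limitin_def
  proof (intro conjI allI impI)
    show "?R \<in> topspace (weak_star boundary)"
      unfolding weak_star_def topspace_pullback_topology using return_prob[OF w] by auto
    fix U assume U: "openin (weak_star boundary) U \<and> ?R \<in> U"
    then obtain V where V: "openin ?P V" "U = ?\<phi> -` V \<inter> probs"
      unfolding weak_star_def openin_pullback_topology by blast
    then have "?\<phi> ?R \<in> V" using U by simp
    then have "\<forall>\<^sub>F i in sequentially. ?\<phi> (M i) \<in> V"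
      using lim V(1) unfolding limitin_def by blast
    then show "\<forall>\<^sub>F i in sequentially. M i \<in> U"
      by (rule eventually_mono) (use V(2) M in simp)
  qed
qed

lemma stationary_boundary:
  assumes "stationary_measure \<nu>"
  shows "mu_boundary G \<mu> boundary act \<nu>"
proof -
  have \<nu>: "\<nu> \<in> probs" using assms stationary_iff by blast
  let ?S = "PiM UNIV (\<lambda>_::nat. count_space (carrier G))"
  have meas: "(\<lambda>\<tau>. (H (\<tau> i) :: real)) \<in> borel_measurable ?S" for H i
    by (rule measurable_compose[OF measurable_component_singleton]) auto
  have ball: "Measurable.pred ?S (\<lambda>\<tau>. \<forall>i\<in>I. Q i \<tau>)"
    if "countable I" "\<And>i. i \<in> I \<Longrightarrow> Measurable.pred ?S (Q i)" for I :: "'i set" and Q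
    using that unfolding pred_def by (intro sets.sets_Collect_countable_All')
  have conv: "Measurable.pred ?S (\<lambda>\<tau>. convergent (\<lambda>i. mass \<nu> (cyl X s) (\<tau> i)))" for s
    unfolding Cauchy_convergent_iff[symmetric] pred_def by (rule sets_Collect_Cauchy) (rule meas)
  have inc: "Measurable.pred ?S (\<lambda>\<tau>. (\<lambda>i. mass \<nu> (cyl X s) (\<tau> i \<otimes> a) - mass \<nu> (cyl X s) (\<tau> i)) \<longlonglongrightarrow> 0)" for s a
    by (rule measurable_limit) (intro borel_measurable_diff meas)
  \<comment> \<open>Transferring the almost sure statement from streams to paths requires a
    measurable event; countability of the words and of \<open>F\<close> provides it.\<close>
  have "Measurable.pred ?S (\<lambda>\<tau>. \<forall>s\<in>reduced_words X. convergent (\<lambda>i. mass \<nu> (cyl X s) (\<tau> i)) \<and>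
      (\<forall>a\<in>F. (\<lambda>i. mass \<nu> (cyl X s) (\<tau> i \<otimes> a) - mass \<nu> (cyl X s) (\<tau> i)) \<longlonglongrightarrow> 0))"
    by (intro ball pred_intros_logic countable_reduced_words finite_X countable_F conv inc)
  then have "Measurable.pred ?S (convergent_path \<nu>)"
    unfolding convergent_path_def[abs_def] .
  then have "AE \<tau> in walk_measure G \<mu>. convergent_path \<nu> \<tau>"
    using AE_convergent_path[OF assms] by (intro AE_walk_measureI)
  moreover have "AE \<tau> in walk_measure G \<mu>. \<forall>i. \<tau> i \<in> carrier G"
    unfolding walk_measure_eq by (rule AE_I2) (auto simp: space_PiM)
  ultimately have "AE \<tau> in walk_measure G \<mu>. \<exists>w\<in>topspace boundary.
      limitin (weak_star boundary) (\<lambda>i. push (\<tau> i) \<nu>) (return boundary_borel w) sequentially"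
  proof eventually_elim
    case (elim \<tau>)
    then have \<tau>: "\<tau> i \<in> carrier G" for i by blast
    obtain w where w: "w \<in> Ends X" "\<And>k. (\<lambda>i. mass \<nu> (cyl X (pre k w)) (\<tau> i)) \<longlonglongrightarrow> 1"
      by (rule convergent_path_limit[OF \<nu> \<tau> elim(1)]) blast
    have "limitin (weak_star boundary) (\<lambda>i. push (\<tau> i) \<nu>) (return boundary_borel w) sequentially"
      using w translate_closed[OF \<tau> \<nu>] mass_translate[OF \<nu> \<tau> cyl_borel] by (intro weak_star_point) auto
    then show ?case using w(1) by auto
  qed
  then show ?thesis using assms by (simp add: mu_boundary_def)
qed

section \<open>Atoms\<close>

lemma point_borel [simp]: "w \<in> Ends X \<Longrightarrow> {w} \<in> borelE"
proof -
  assume w: "w \<in> Ends X"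
  have "{w} = (\<Inter>k. cyl X (pre k w))"
  proof (intro subset_antisym subsetI)
    fix v assume v: "v \<in> (\<Inter>k. cyl X (pre k w))"
    have "pre k v = pre k w" for k
      using v pre_Ends[OF w, of k] mem_cyl_iff[of "pre k w" k v X] by blast
    then show "v \<in> {w}" using pre_separates by blast
  qed (use mem_cyl_pre[OF w] in auto)
  then show ?thesis using sets.countable_INT'[of UNIV "\<lambda>k. cyl X (pre k w)" "boundary_borel"] by auto
qed

text \<open>A finite set of ends misses some cylinder of \<open>x\<^sup>n y\<close>, into which the element
  \<open>x\<^sup>n y x (x\<^sup>n y)\<^sup>-\<^sup>1\<close> maps its whole complement.\<close>

lemma no_finite_invariant_set:
  assumes "finite A" "A \<subseteq> Ends X" "A \<noteq> {}" and inv: "\<And>b w. b \<in> F \<Longrightarrow> w \<in> A \<Longrightarrow> ext b w \<in> A"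
  shows False
proof -
  define s where "s n = replicate n (x, True) @ [(y, True)]" for n
  have "\<exists>n. A \<inter> cyl X (s n) = {}"
  proof (rule ccontr)
    assume "\<nexists>n. A \<inter> cyl X (s n) = {}"
    then have "\<forall>n. \<exists>w. w \<in> A \<inter> cyl X (s n)" by blast
    from choice[OF this] obtain c where c: "\<And>n. c n \<in> A \<inter> cyl X (s n)" by blast
    \<comment> \<open>At position \<open>n\<close> the word \<open>s n\<close> has the letter
      \<open>y\<close> and \<open>s m\<close> still has \<open>x\<close>, so the cylinders are
      disjoint.\<close>
    have ne: "c n \<noteq> c m" if "n < m" for n m
    proof
      assume "c n = c m"
      then have "pre (Suc n) (c m) = s n" "pre (Suc m) (c m) = s m"
        using c[of n] c[of m] by (auto simp: cyl_def s_def)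
      then have "take (Suc n) (s m) = s n"
        using take_pre[of "Suc n" "Suc m" "c m"] that by simp
      then have "s m ! n = s n ! n" by (metis lessI nth_take)
      then show False using that xy by (simp add: s_def nth_append)
    qed
    have "inj c" by (rule injI) (metis ne linorder_neqE_nat)
    moreover have "range c \<subseteq> A" using c by auto
    ultimately show False using assms(1) finite_subset range_inj_infinite by blast
  qed
  then obtain n where n: "A \<inter> cyl X (s n) = {}" ..
  define u where "u = s n @ [(x, True)] @ winv (s n)"
  have sn: "s n \<in> reduced_words X" "last (s n) = (y, True)"
    and wn: "winv (s n) = (y, False) # replicate n (x, False)" and len: "length (s n) = Suc n"
    using xy replicate_reduced[of "(x, True)" X n]
    by (auto simp: s_def reduced_words_append_iff winv_replicate)
  have u: "u \<in> reduced_words X"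
    unfolding u_def reduced_words_append_iff
    using sn winv_reduced[OF sn(1)] xy by (simp add: wn)
  let ?b = "eval_word G u"
  have b: "?b \<in> F" "rw ?b = u" using u eval_in_F by auto
  have p: "take (Suc n) u = s n" "take (Suc n) (rw (inv ?b)) = s n"
    unfolding rw_inv[OF b(1)] b(2) by (simp_all add: u_def len)
  obtain w where w: "w \<in> A" using assms(3) by blast
  have "ext ?b w \<in> cyl X (take (Suc n) (rw ?b))"
  proof (rule ext_cyl[OF b(1)])
    show "2 * Suc n \<le> length (rw ?b)" unfolding b(2) by (simp add: u_def len)
    show "w \<in> Ends X" "w \<notin> cyl X (take (Suc n) (rw (inv ?b)))" using w n assms(2) p(2) by auto
  qed
  then show False using inv[OF b(1) w] n p(1) b(2) by auto
qed

text \<open>Maximum principle: stationarity writes the maximal point mass as an average of masses of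
  preimages, none of which is larger, so all of them over the support are maximal too. The points of
  maximal mass thus form a finite invariant set.\<close>

lemma stationary_no_atoms:
  assumes "stationary_measure \<nu>"
  shows "no_atoms \<nu>"
  unfolding no_atoms_def
proof (rule ballI, rule ccontr)
  have \<nu>: "\<nu> \<in> probs" using assms stationary_iff by blast
  note P = T.prob_measuresD[OF \<nu>]
  interpret prob_space \<nu> by (rule P(1))
  fix w0 assume "w0 \<in> space \<nu>" "emeasure \<nu> {w0} \<noteq> 0"
  then have w0: "w0 \<in> Ends X" "0 < prob {w0}"
    using P(3) by (auto simp: emeasure_eq_measure zero_less_measure_iff)
  \<comment> \<open>Points at least as heavy as \<open>w0\<close> are finite in number, so the
    maximal mass is attained.\<close>
  let ?D = "{w \<in> Ends X. prob {w0} \<le> prob {w}}"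
  have pts: "{w} \<in> events" if "w \<in> Ends X" for w using that P(2) by simp
  have "finite ?D"
  proof (rule ccontr)
    assume inf: "infinite ?D"
    obtain n :: nat where n: "1 < real n * prob {w0}"
      using reals_Archimedean3[OF w0(2)] by blast
    obtain S where S: "S \<subseteq> ?D" "finite S" "card S = n"
      using infinite_arbitrarily_large[OF inf] by blast
    have "real n * prob {w0} \<le> (\<Sum>w\<in>S. prob {w})"
      using S sum_bounded_below[of S "prob {w0}" "\<lambda>w. prob {w}"] by auto
    also have "\<dots> = prob S"
      using S pts by (intro finite_measure_eq_sum_singleton[symmetric]) auto
    also have "\<dots> \<le> 1" by (rule prob_le_1)
    finally show False using n by simp
  qed
  define p where "p = Max ((\<lambda>w. prob {w}) ` ?D)"
  define A where "A = {w \<in> Ends X. prob {w} = p}"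
  have "p \<in> (\<lambda>w. prob {w}) ` ?D"
    unfolding p_def using \<open>finite ?D\<close> w0 by (intro Max_in) auto
  then have "A \<noteq> {}" "prob {w0} \<le> p" by (auto simp: A_def)
  then have "A \<subseteq> ?D" by (auto simp: A_def)
  then have "finite A" using \<open>finite ?D\<close> finite_subset by blast
  have le_p: "prob {w} \<le> p" if "w \<in> Ends X" for w
  proof (cases "w \<in> ?D")
    case True
    then show ?thesis unfolding p_def using \<open>finite ?D\<close> by (intro Max_ge) auto
  next
    case False
    then show ?thesis using that \<open>prob {w0} \<le> p\<close> by simp
  qed
  have pre: "{v \<in> Ends X. ext g v = w} = {ext (inv g) w}" if "g \<in> carrier G" "w \<in> Ends X" for g w
  proof (intro subset_antisym subsetI)
    fix v assume "v \<in> {v \<in> Ends X. ext g v = w}"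
    then have v: "v \<in> Words X" "ext g v = w" using Ends_subset by auto
    have "ext (inv g) (ext g v) = v" using that(1) v(1) by (simp add: ext_ext ext_one)
    then show "v \<in> {ext (inv g) w}" using v(2) by simp
  next
    fix v assume "v \<in> {ext (inv g) w}"
    moreover have "ext g (ext (inv g) w) = w" "ext (inv g) w \<in> Ends X"
      using that Ends_subset[of X] ext_Ends[of "inv g" w] by (auto simp: ext_ext ext_one)
    ultimately show "v \<in> {v \<in> Ends X. ext g v = w}" by simp
  qed
  have supp_inv: "ext (inv g) w \<in> A" if "g \<in> set_pmf \<mu>" "w \<in> A" for g w
  proof -
    have w: "w \<in> Ends X" "prob {w} = p" using that by (auto simp: A_def)
    \<comment> \<open>The value \<open>p\<close> outside the carrier keeps \<open>?h\<close> bounded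
      by \<open>p\<close> everywhere.\<close>
    let ?h = "\<lambda>g. if g \<in> carrier G then prob {ext (inv g) w} else p"
    have h: "0 \<le> ?h g \<and> ?h g \<le> p" for g
      using le_p[OF ext_Ends[OF _ w(1)], of "inv g"] w(2) measure_nonneg[of \<nu> "{w}"] by auto
    have i: "integrable (measure_pmf \<mu>) ?h"
      using h by (intro measure_pmf.integrable_const_bound[where B = p]) (auto simp: abs_le_iff)
    have "p = measure_pmf.expectation \<mu> (\<lambda>g. measure (push g \<nu>) {w})"
      using assms w by (simp add: stationary_iff)
    also have "\<dots> = measure_pmf.expectation \<mu> ?h"
      using supp w(1) measure_translate[OF _ \<nu> point_borel[OF w(1)]] pre
      by (intro integral_cong_AE) (auto simp: AE_measure_pmf_iff)
    finally have "measure_pmf.expectation \<mu> (\<lambda>g. p - ?h g) = 0" using i by simp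
    then have "AE g in measure_pmf \<mu>. p - ?h g = 0"
      using i h by (subst (asm) integral_nonneg_eq_0_iff_AE) auto
    then have "p - ?h g = 0" using that(1) by (simp add: AE_measure_pmf_iff)
    moreover have "g \<in> carrier G" using that(1) supp by blast
    ultimately show ?thesis using ext_Ends[of "inv g" w] w(1) by (simp add: A_def)
  qed
  \<comment> \<open>Inverses reverse products, so invariance under the inverses of the support
    passes to the semigroup it generates, which is all of \<open>G\<close>.\<close>
  have all_inv: "ext (inv g) w \<in> A" if "g \<in> carrier G" "w \<in> A" for g w
  proof -
    have "g \<in> semigroup_span G (set_pmf \<mu>)" using that(1) semigroup_span_carrier by simp
    then show ?thesis using that(2)
    proof (induction arbitrary: w)
      case (mult a b)
      have ab: "a \<in> carrier G" "b \<in> carrier G" using mult.hyps semigroup_span_carrier by auto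
      have "w \<in> Words X" using mult.prems Ends_subset by (auto simp: A_def)
      then have "ext (inv (a \<otimes> b)) w = ext (inv b) (ext (inv a) w)"
        using ab by (simp add: ext_ext inv_mult_group)
      then show ?case using mult by simp
    qed (rule supp_inv)
  qed
  show False
  proof (rule no_finite_invariant_set[OF \<open>finite A\<close> _ \<open>A \<noteq> {}\<close>])
    show "A \<subseteq> Ends X" by (auto simp: A_def)
    show "ext b w \<in> A" if "b \<in> F" "w \<in> A" for b w
      using all_inv[of "inv b" w] that F_carrier by simp
  qed
qed

lemma stationary_ex: "\<exists>\<nu>. stationary_measure \<nu>"
proof -
  have "Inf (\<lambda>_. (x, True)) \<in> Ends X"
    using xy by (auto simp: Ends_def infinite_reduced_words_def)
  then have ne: "topspace boundary \<noteq> {}" by auto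
  obtain \<nu> where "\<nu> \<in> probs"
    "\<And>E. E \<in> borelE \<Longrightarrow> measure_pmf.expectation \<mu> (\<lambda>g. measure (push g \<nu>) E) = measure \<nu> E"
    by (rule T.stationary_exists[OF _ ne, of \<mu> "act"]) (use supp continuous_act in auto)
  then show ?thesis using stationary_iff by blast
qed

end

text \<open>With at most one generator any two letters commute, and commutation extends from letters
  to words one factor at a time.\<close>

lemma (in free_normal_subgroup) two_generators:
  assumes "\<not> comm_group (G\<lparr>carrier := F\<rparr>)"
  obtains x y where "x \<in> X" "y \<in> X" "x \<noteq> y"
proof (cases "\<exists>x\<in>X. \<exists>y\<in>X. x \<noteq> y")
  case False
  have letter: "eval_word G [l] \<otimes> eval_word G [m] = eval_word G [m] \<otimes> eval_word G [l]"
    if "fst l \<in> X" "fst m \<in> X" for l m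
  proof -
    have "fst l = fst m" using False that by blast
    then show ?thesis using X_carrier[OF that(1)] by (auto simp: eval_Cons)
  qed
  have one: "eval_word G [l] \<otimes> eval_word G v = eval_word G v \<otimes> eval_word G [l]"
    if "fst l \<in> X" "fst ` set v \<subseteq> X" for l v
    using that(2)
  proof (induction v)
    case Nil
    then show ?case using that(1) X_carrier by (simp add: eval_Cons)
  next
    case (Cons m v)
    have C: "eval_word G [l] \<in> carrier G" "eval_word G [m] \<in> carrier G" "eval_word G v \<in> carrier G"
      using Cons.prems that(1) by (auto intro!: eval_carrier)
    have m: "eval_word G (m # v) = eval_word G [m] \<otimes> eval_word G v"
      using Cons.prems eval_append[of "[m]" v] by simp
    have "eval_word G [l] \<otimes> (eval_word G [m] \<otimes> eval_word G v) = eval_word G [m] \<otimes> (eval_word G [l] \<otimes> eval_word G v)"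
      using C letter[OF that(1), of m] Cons.prems by (simp add: m_assoc[symmetric])
    also have "\<dots> = eval_word G [m] \<otimes> eval_word G v \<otimes> eval_word G [l]"
      using C Cons by (simp add: m_assoc)
    finally show ?case unfolding m .
  qed
  have two: "eval_word G u \<otimes> eval_word G v = eval_word G v \<otimes> eval_word G u"
    if "fst ` set u \<subseteq> X" "fst ` set v \<subseteq> X" for u v
    using that(1)
  proof (induction u)
    case Nil
    then show ?case using that(2) eval_carrier by simp
  next
    case (Cons m u)
    have C: "eval_word G u \<in> carrier G" "eval_word G [m] \<in> carrier G" "eval_word G v \<in> carrier G"
      using Cons.prems that(2) by (auto intro!: eval_carrier)
    have m: "eval_word G (m # u) = eval_word G [m] \<otimes> eval_word G u"
      using Cons.prems eval_append[of "[m]" u] by simp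
    have "eval_word G [m] \<otimes> eval_word G u \<otimes> eval_word G v = eval_word G [m] \<otimes> eval_word G v \<otimes> eval_word G u"
      using C Cons by (simp add: m_assoc)
    also have "\<dots> = eval_word G v \<otimes> (eval_word G [m] \<otimes> eval_word G u)"
      using C one[OF _ that(2), of m] Cons.prems by (simp add: m_assoc)
    finally show ?case unfolding m .
  qed
  have "comm_group (G\<lparr>carrier := F\<rparr>)"
  proof (rule group.group_comm_groupI)
    show "group (G\<lparr>carrier := F\<rparr>)" by (rule subgroup_imp_group[OF subgroup_axioms])
    fix a b assume "a \<in> carrier (G\<lparr>carrier := F\<rparr>)" "b \<in> carrier (G\<lparr>carrier := F\<rparr>)"
    then have "a \<in> F" "b \<in> F" by auto
    then have "a \<otimes> b = b \<otimes> a"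
      using two[of "rw a" "rw b"] reduced_letters by simp
    then show "a \<otimes>\<^bsub>G\<lparr>carrier := F\<rparr>\<^esub> b = b \<otimes>\<^bsub>G\<lparr>carrier := F\<rparr>\<^esub> a" by simp
  qed
  then show ?thesis using assms by blast
qed (use that in blast)

theorem theorem1:
  fixes G :: "('a, 'z) monoid_scheme" and F X :: "'a set" and \<mu> :: "'a pmf"
  assumes "group G" and "countable (carrier G)"
    and "F \<lhd> G"
    and "free_basis G F X" and "finite X"
    and "\<not> comm_group (G\<lparr>carrier := F\<rparr>)"
    and "set_pmf \<mu> \<subseteq> carrier G" and "nondegenerate G \<mu>"
  shows "(\<exists>!\<nu>. stationary G \<mu> (hyp_boundary X) (conj_action G F X) \<nu>) \<and>
    (\<forall>\<nu>. stationary G \<mu> (hyp_boundary X) (conj_action G F X) \<nu> \<longrightarrow>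
       no_atoms \<nu> \<and> mu_boundary G \<mu> (hyp_boundary X) (conj_action G F X) \<nu>)"
proof -
  interpret free_normal_subgroup F G X
    using assms by (intro free_normal_subgroup.intro free_normal_subgroup_axioms.intro)
  obtain x y where "x \<in> X" "y \<in> X" "x \<noteq> y"
    by (rule two_generators[OF assms(6)])
  then interpret free_normal_walk F G X \<mu> x y
    using assms
    by (intro free_normal_walk.intro free_normal_walk_axioms.intro group_walk.intro
        group_walk_axioms.intro free_normal_subgroup_axioms)
  show ?thesis
    using stationary_ex stationary_unique stationary_no_atoms stationary_boundary by blast
qed

end
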